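(* For any real $a<1/2$, the Riemann hypothesis is equivalent to the statement that $$\frac{1}{(n-1)!}\,\frac{d^n}{dz^n}\Big((z-a)^{n-1}\ln(\xi(z))\Big)\Big|_{z=1-a}\ \ge\ 0\qquad\text{for all integers } n\ge 1.$$ Correspondingly, for any real $a>1/2$, the Riemann hypothesis is equivalent to the statement that $$\frac{1}{(n-1)!}\,\frac{d^n}{dz^n}\Big((z-a)^{n-1}\ln(\xi(z))\Big)\Big|_{z=1-a}\ \le\ 0\qquad\text{for all integers } n\ge 1.$$
   Context: The Riemann xi-function is the entire function $\xi(z)=\frac12 z(z-1)\pi^{-z/2}\Gamma(z/2)\zeta(z)$ (removable singularities removed), where $\zeta$ is the Riemann zeta-function; its zeroes are exactly the non-trivial zeroes of $\zeta$. The Riemann hypothesis is the statement that every zero $\rho$ of $\xi$ satisfies $\operatorname{Re}\rho=1/2$. The function $\xi$ is positive on the real axis, and $\ln(\xi(z))$ denotes the analytic branch of the logarithm near the real point $z=1-a$ that is real on the real axis. *)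

theory Defs
  imports "HOL-Complex_Analysis.Complex_Analysis"
begin

(* The analytic continuation of the Dirichlet series to the plane without the pole 1; it is
   unique since the punctured plane is connected, except for the value at the pole,
   which is fixed by convention. *)
definition zeta :: "complex \<Rightarrow> complex" where
  "zeta = (THE f. f holomorphic_on (- {1}) \<and>
                  (\<forall>s. Re s > 1 \<longrightarrow> f s = (\<Sum>n. 1 / of_nat (Suc n) powr s)) \<and>
                  f 1 = 0)"

(* remove_sings fills in the limits at z = 1 (the pole of zeta) and at z = 0, -2, -4, ...
   (the poles of z \<mapsto> Gamma (z / 2), where the library function Gamma takes the value 0). *)
definition xi :: "complex \<Rightarrow> complex" where
  "xi = remove_sings
     (\<lambda>z. 1 / 2 * z * (z - 1) * of_real pi powr (- z / 2) * Gamma (z / 2) * zeta z)"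

definition riemann_hypothesis :: bool where
  "riemann_hypothesis \<longleftrightarrow> (\<forall>\<rho>. xi \<rho> = 0 \<longrightarrow> Re \<rho> = 1 / 2)"

(* Since xi is positive on the real axis, the principal branch Ln (xi z) is analytic near the
   real point 1 - a and real on the real axis there, so it is the required branch of the
   logarithm. The derivative is a complex one; being real, it can be compared with 0 via
   membership in the nonnegative or nonpositive reals. *)
definition li_coeff :: "real \<Rightarrow> nat \<Rightarrow> complex" where
  "li_coeff a n =
     1 / fact (n - 1) *
     (deriv ^^ n) (\<lambda>z. (z - of_real a) ^ (n - 1) * Ln (xi z)) (1 - of_real a)"

end

theory Submission
  imports Defs "HOL-Probability.Probability"
begin

text \<open>
The Li coefficients are Taylor coefficients in disguise. Put \<open>b = 1 - a\<close> and let \<open>u = (z -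
b) / (z - a)\<close>, so that \<open>z = (b - a * u) / (1 - u)\<close>. Expanding \<open>Ln (xi z)\<close> in
powers of \<open>u\<close> and differentiating the products with \<open>(z - a) ^ (n - 1)\<close>, all terms
but the one with \<open>u ^ n\<close> drop out (\<open>higher_deriv_Li_substitution\<close>): up to the factor
\<open>n / (1 - 2 * a)\<close>, the \<open>n\<close>-th Li coefficient is the \<open>n\<close>-th Taylor
coefficient at \<open>u = 0\<close> of the logarithm of xi on the unit disc
(\<open>li_coeff_eq_log_coeff\<close>). For \<open>a < 1/2\<close> the disc corresponds to the half-plane
\<open>Re z > 1/2\<close>, and by the functional equation the Riemann hypothesis says that xi has no zeros
there. The case \<open>a > 1/2\<close> reduces to this one, because the functional equation changes the sign
of the coefficients when \<open>a\<close> is replaced by \<open>1 - a\<close>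
(\<open>li_coeff_reflect\<close>).

If all coefficients are nonnegative, there is no zero in the disc: a logarithm with nonnegative Taylor
coefficients is largest on the positive radius, where it is bounded above since xi is bounded on compact sets,
and this prevents its real part from tending to \<open>- \<infinity>\<close> at a zero of least modulus
(\<open>nonvanishing_of_nonneg_log_coeffs\<close>).

Conversely, if xi has no zeros in \<open>Re z > 1/2\<close>, then its logarithmic derivative has nonnegative
real part there (\<open>Re_logderiv_xi_entire_nonneg\<close>). The \<open>n\<close>-th Li coefficient is the
Fejer sum \<open>\<Sum>k<n. (n - k) * h k\<close> of the Taylor coefficients \<open>h k\<close> of this
logarithmic derivative transported to the disc (\<open>li_coeff_eq_sum\<close>), and the Fejer kernel is
nonnegative (\<open>Fejer_sum_nonneg\<close>). The nonnegativity of the real part means that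
\<open>\<bar>xi\<bar>\<close> does not decrease as one moves right from the critical line, that is,
\<open>\<bar>xi (z - \<delta>)\<bar> \<le> \<bar>xi z\<bar>\<close> for \<open>Re z \<ge> (1 + \<delta>) /
2\<close> (\<open>xi_entire_shift_le\<close>). Equality holds on the boundary line by the functional equation,
the inequality holds far to the right by properties of the Gamma function, and a Phragmen-Lindelof argument
covers the strip between; the growth condition for the quotient comes from a Borel-Caratheodory lower bound
for zero-free functions.

The analytic continuation, the functional equation, the growth bound and the positivity of xi on the real axis
are all read off Riemann's representation of xi as a Mellin integral of a theta function
(\<open>xi_eq_xi_entire\<close>), which rests on the transformation law \<open>theta_transformation\<close>.
\<close>

section \<open>The transformation law of the theta function\<close>

text \<open>
The characteristic function of the standard normal distribution, rescaled.
\<close>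

lemma gaussian_cos_integral:
  fixes t k :: real
  assumes "t > 0"
  shows "has_bochner_integral lborel (\<lambda>x. exp (- pi * t * x\<^sup>2) * cos (2 * pi * k * x))
           (exp (- pi * k\<^sup>2 / t) / sqrt t)"
proof -
  define c where "c = sqrt (2 * pi * t)"
  define \<tau> where "\<tau> = 2 * pi * k / c"
  have c: "c > 0" "c\<^sup>2 = 2 * pi * t" using assms by (auto simp: c_def)
  have int: "integrable lborel (\<lambda>x. std_normal_density x *\<^sub>R iexp (\<tau> * x))"
  proof (rule Bochner_Integration.integrable_bound)
    show "integrable lborel (\<lambda>x. std_normal_density x)" by simp
  qed (auto simp: normal_density_nonneg)
  have "complex_of_real (exp (- (\<tau>\<^sup>2) / 2)) = char std_normal_distribution \<tau>"
    by (simp add: char_std_normal_distribution)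
  also have "\<dots> = (\<integral>x. std_normal_density x *\<^sub>R iexp (\<tau> * x) \<partial>lborel)"
    unfolding char_def by (subst integral_density) (auto simp: normal_density_nonneg)
  finally have "has_bochner_integral lborel (\<lambda>x. std_normal_density x *\<^sub>R iexp (\<tau> * x))
     (complex_of_real (exp (- (\<tau>\<^sup>2) / 2)))"
    using int by (simp add: has_bochner_integral_iff)
  from has_bochner_integral_Re[OF this] have re: "has_bochner_integral lborel (\<lambda>x. Re (std_normal_density x *\<^sub>R iexp (\<tau> * x)))
     (exp (- (\<tau>\<^sup>2) / 2))" by (simp only: Re_complex_of_real)
  have eq: "Re (std_normal_density x *\<^sub>R iexp (\<tau> * x)) = std_normal_density x * cos (\<tau> * x)" for x
    unfolding scaleR_complex.sel Re_exp by simp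
  have c0: "c \<noteq> 0" using c(1) by simp
  define f where "f = (\<lambda>x. std_normal_density x * cos (\<tau> * x))"
  have "has_bochner_integral lborel f (exp (- (\<tau>\<^sup>2) / 2))"
    using re by (simp only: eq f_def)
  hence "has_bochner_integral lborel (\<lambda>x. f (0 + c * x)) (exp (- (\<tau>\<^sup>2) / 2) /\<^sub>R \<bar>c\<bar>)"
    by (rule iffD1[OF lborel_has_bochner_integral_real_affine_iff[where t = 0, OF c0]])
  moreover have "exp (- (\<tau>\<^sup>2) / 2) /\<^sub>R \<bar>c\<bar> = exp (- (\<tau>\<^sup>2) / 2) / c"
    using c(1) by (simp add: field_simps)
  ultimately have *: "has_bochner_integral lborel (\<lambda>x. std_normal_density (c * x) * cos (\<tau> * (c * x))) (exp (- (\<tau>\<^sup>2) / 2) / c)"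
    by (simp only: f_def add_0)
  have "has_bochner_integral lborel (\<lambda>x. sqrt (2 * pi) * (std_normal_density (c * x) * cos (\<tau> * (c * x)))) 
           (sqrt (2 * pi) * (exp (- (\<tau>\<^sup>2) / 2) / c))"
    by (rule has_bochner_integral_mult_right) (use * in auto)
  also have "(\<lambda>x. sqrt (2 * pi) * (std_normal_density (c * x) * cos (\<tau> * (c * x)))) =
     (\<lambda>x. exp (- pi * t * x\<^sup>2) * cos (2 * pi * k * x))"
    using c by (simp add: std_normal_density_def \<tau>_def power_mult_distrib mult.assoc)
  also have "sqrt (2 * pi) * (exp (- (\<tau>\<^sup>2) / 2) / c) = exp (- pi * k\<^sup>2 / t) / sqrt t"
  proof -
    have "- (\<tau>\<^sup>2) / 2 = - pi * k\<^sup>2 / t"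
      using assms c by (simp add: \<tau>_def power_divide power_mult_distrib) (simp add: power2_eq_square)
    thus ?thesis using assms by (simp add: c_def real_sqrt_mult)
  qed
  finally show ?thesis .
qed

lemma integral_symmetric_intervals_tendsto:
  fixes f :: "real \<Rightarrow> real"
  assumes "has_bochner_integral lborel f I" "continuous_on UNIV f"
  shows "(\<lambda>N. integral {- (real N + 1/2)..real N + 1/2} f) \<longlonglongrightarrow> I"
proof -
  let ?S = "\<lambda>N. {- (real N + 1/2)..real N + 1/2}"
  have intf: "integrable lborel f" and I: "I = integral\<^sup>L lborel f"
    using assms(1) by (auto simp: has_bochner_integral_iff)
  have "(\<lambda>N. \<integral>x. indicator (?S N) x *\<^sub>R f x \<partial>lborel) \<longlonglongrightarrow> integral\<^sup>L lborel f"
  proof (rule integral_dominated_convergence[where w = "\<lambda>x. \<bar>f x\<bar>"])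
    show "AE x in lborel. (\<lambda>N. indicator (?S N) x *\<^sub>R f x) \<longlonglongrightarrow> f x"
    proof (rule AE_I2)
      fix x :: real
      obtain N where N: "\<bar>x\<bar> < real N" using reals_Archimedean2 by blast
      have "eventually (\<lambda>n. indicator (?S n) x *\<^sub>R f x = f x) sequentially"
        using eventually_ge_at_top[of N] by eventually_elim (use N in \<open>auto simp: indicator_def\<close>)
      thus "(\<lambda>N. indicator (?S N) x *\<^sub>R f x) \<longlonglongrightarrow> f x" by (rule tendsto_eventually)
    qed
  qed (use intf in \<open>auto simp: indicator_def\<close>)
  moreover have "(\<integral>x. indicator (?S N) x *\<^sub>R f x \<partial>lborel) = integral (?S N) f" for N
  proof -
    have "set_integrable lborel (?S N) f" 
      by (rule borel_integrable_atLeastAtMost') (use assms(2) continuous_on_subset in blast)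
    from set_borel_integral_eq_integral(2)[OF this] show ?thesis 
      by (simp add: set_lebesgue_integral_def)
  qed
  ultimately show ?thesis by (simp add: I)
qed

lemma integral_uniform_suminf:
  fixes f :: "nat \<Rightarrow> real \<Rightarrow> real"
  assumes cont: "\<And>n. continuous_on {a..b} (f n)"
    and bound: "\<And>n x. x \<in> {a..b} \<Longrightarrow> \<bar>f n x\<bar> \<le> M n" and M: "summable M"
  shows "continuous_on {a..b} (\<lambda>x. \<Sum>n. f n x)"
    and "(\<lambda>n. integral {a..b} (f n)) sums integral {a..b} (\<lambda>x. \<Sum>n. f n x)"
proof -
  have lim: "uniform_limit {a..b} (\<lambda>N x. \<Sum>n<N. f n x) (\<lambda>x. \<Sum>n. f n x) sequentially"
    by (rule Weierstrass_m_test[OF _ M]) (use bound in auto)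
  show cont': "continuous_on {a..b} (\<lambda>x. \<Sum>n. f n x)"
    by (rule uniform_limit_theorem[OF _ lim]) (intro always_eventually allI continuous_intros cont, auto)
  obtain I J where I: "\<And>N. ((\<lambda>x. \<Sum>n<N. f n x) has_integral I N) {a..b}"
    and J: "((\<lambda>x. \<Sum>n. f n x) has_integral J) {a..b}" and IJ: "I \<longlonglongrightarrow> J"
    by (rule uniform_limit_integral[OF lim]) (auto intro!: continuous_intros cont)
  have "I N = (\<Sum>n<N. integral {a..b} (f n))" for N
  proof -
    have "((\<lambda>x. \<Sum>n<N. f n x) has_integral (\<Sum>n<N. integral {a..b} (f n))) {a..b}"
      by (intro has_integral_sum integrable_integral integrable_continuous_interval cont) auto
    thus ?thesis using I has_integral_unique by blast
  qed
  hence "I = (\<lambda>N. \<Sum>n<N. integral {a..b} (f n))" by auto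
  thus "(\<lambda>n. integral {a..b} (f n)) sums integral {a..b} (\<lambda>x. \<Sum>n. f n x)"
    using IJ J by (simp add: sums_def integral_unique)
qed

text \<open>
On \<open>[-1/2, 1/2]\<close> an even continuous function is a continuous function of \<open>cos (2 \<pi>
x)\<close>, so by Weierstrass it is a uniform limit of polynomials in \<open>cos (2 \<pi> x)\<close>. Powers
of the cosine are combinations of cosines of multiple angles, hence \<open>D\<close> is orthogonal to all
these polynomials and therefore to itself.
\<close>

lemma even_continuous_cos_moments_zero:
  fixes D :: "real \<Rightarrow> real"
  assumes cont: "continuous_on {-(1/2)..1/2} D"
    and even: "\<And>x. D (- x) = D x"
    and mom: "\<And>k::nat. integral {-(1/2)..1/2} (\<lambda>x. D x * cos (2 * pi * real k * x)) = 0"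
    and x: "x \<in> {-(1/2)..1/2}"
  shows "D x = 0"
proof -
  let ?I = "{-(1/2)..1/2::real}"
  let ?y = "\<lambda>x. cos (2 * pi * x)"
  have int_zero: "((\<lambda>x. D x * cos (2 * pi * x) ^ m * cos (2 * pi * j * x)) has_integral 0) ?I" 
    if "j \<in> \<int>" for m and j :: real
    using that
  proof (induction m arbitrary: j)
    case 0
    then obtain i where i: "j = of_int i" by (auto elim: Ints_cases)
    have "cos (2 * pi * j * x) = cos (2 * pi * real (nat \<bar>i\<bar>) * x)" for x
      by (cases "i \<ge> 0") (auto simp: i)
    moreover have "(\<lambda>x. D x * cos (2 * pi * real (nat \<bar>i\<bar>) * x)) integrable_on ?I"
      by (intro integrable_continuous_interval continuous_intros cont)
    ultimately show ?case using mom[of "nat \<bar>i\<bar>"] by (simp add: has_integral_iff)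
  next
    case (Suc m)
    have "((\<lambda>x. (D x * cos (2 * pi * x) ^ m * cos (2 * pi * (j + 1) * x) +
               D x * cos (2 * pi * x) ^ m * cos (2 * pi * (j - 1) * x)) / 2) has_integral (0 + 0) / 2) ?I"
      by (intro has_integral_divide has_integral_add Suc.IH) (use Suc.prems in auto)
    moreover have "(D x * cos (2 * pi * x) ^ m * cos (2 * pi * (j + 1) * x) +
               D x * cos (2 * pi * x) ^ m * cos (2 * pi * (j - 1) * x)) / 2 =
          D x * cos (2 * pi * x) ^ Suc m * cos (2 * pi * j * x)" for x
    proof -
      have a: "2 * pi * (j + 1) * x = 2 * pi * j * x + 2 * pi * x" "2 * pi * (j - 1) * x = 2 * pi * j * x - 2 * pi * x"
        by (simp_all add: algebra_simps)
      show ?thesis unfolding a by (simp add: cos_add cos_diff algebra_simps)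
    qed
    ultimately show ?case by simp
  qed
  have pow_zero: "((\<lambda>x. D x * cos (2 * pi * x) ^ m) has_integral 0) ?I" for m
    using int_zero[of 0 m] by simp
  define d where "d = (\<lambda>y. D (arccos y / (2 * pi)))"
  have contd: "continuous_on {-1..1} d"
    unfolding d_def
  proof (rule continuous_on_compose2[OF cont])
    have "- pi \<le> arccos y" "arccos y \<le> pi" if "y \<in> {-1..1}" for y
      using arccos_lbound[of y] arccos_ubound[of y] pi_gt_zero that by auto
    thus "(\<lambda>y. arccos y / (2 * pi)) ` {-1..1} \<subseteq> ?I" by (auto simp: field_simps)
  qed (auto intro!: continuous_intros)
  have d: "d (?y x) = D x" if "x \<in> ?I" for x
  proof -
    have "D x = D \<bar>x\<bar>" using even[of x] by (auto simp: abs_if)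
    moreover have "arccos (cos (2 * pi * \<bar>x\<bar>)) = 2 * pi * \<bar>x\<bar>"
      by (rule arccos_cos) (use that in \<open>auto simp: abs_if field_simps\<close>)
    moreover have "?y x = cos (2 * pi * \<bar>x\<bar>)" by (auto simp: abs_if)
    ultimately show ?thesis by (simp add: d_def)
  qed
  have contD2: "continuous_on ?I (\<lambda>x. (D x)\<^sup>2)" using cont by (intro continuous_intros)
  have "integral ?I (\<lambda>x. (D x)\<^sup>2) \<le> e * integral ?I (\<lambda>x. \<bar>D x\<bar>)" if e: "e > 0" for e
  proof -
    obtain p where p: "real_polynomial_function p" "\<And>y. y \<in> {-1..1} \<Longrightarrow> \<bar>d y - p y\<bar> < e"
      using Stone_Weierstrass_real_polynomial_function[OF _ contd e] by auto
    then obtain a n where an: "p = (\<lambda>x. \<Sum>i\<le>n. a i * x ^ i)" by (auto simp: real_polynomial_function_iff_sum)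
    have "((\<lambda>x. \<Sum>i\<le>n. a i * (D x * cos (2 * pi * x) ^ i)) has_integral (\<Sum>i\<le>n. a i * 0)) ?I"
      by (intro has_integral_sum has_integral_mult_right pow_zero) auto
    hence Dp: "((\<lambda>x. D x * p (?y x)) has_integral 0) ?I"
      by (simp add: an sum_distrib_left mult_ac)
    have "((\<lambda>x. (D x)\<^sup>2 - D x * p (?y x)) has_integral integral ?I (\<lambda>x. (D x)\<^sup>2) - 0) ?I"
      by (intro has_integral_diff integrable_integral integrable_continuous_interval contD2 Dp)
    hence "integral ?I (\<lambda>x. (D x)\<^sup>2) = integral ?I (\<lambda>x. (D x)\<^sup>2 - D x * p (?y x))"
      by (simp add: integral_unique)
    also have "\<dots> \<le> integral ?I (\<lambda>x. e * \<bar>D x\<bar>)"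
    proof (rule integral_le)
      show "(\<lambda>x. (D x)\<^sup>2 - D x * p (?y x)) integrable_on ?I"
        by (intro integrable_diff integrable_continuous_interval contD2 has_integral_integrable[OF Dp])
      show "(\<lambda>x. e * \<bar>D x\<bar>) integrable_on ?I"
        by (intro integrable_continuous_interval continuous_intros cont)
      fix x assume x: "x \<in> ?I"
      have "\<bar>d (?y x) - p (?y x)\<bar> < e" by (rule p) auto
      hence "\<bar>D x - p (?y x)\<bar> \<le> e" using d[OF x] by simp
      hence "\<bar>D x\<bar> * \<bar>D x - p (?y x)\<bar> \<le> \<bar>D x\<bar> * e" by (intro mult_left_mono) auto
      moreover have "(D x)\<^sup>2 - D x * p (?y x) = D x * (D x - p (?y x))" 
        by (simp add: power2_eq_square algebra_simps)
      moreover have "D x * (D x - p (?y x)) \<le> \<bar>D x\<bar> * \<bar>D x - p (?y x)\<bar>"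
        by (metis abs_ge_self abs_mult)
      ultimately show "(D x)\<^sup>2 - D x * p (?y x) \<le> e * \<bar>D x\<bar>" by (simp add: mult.commute)
    qed
    finally show ?thesis by simp
  qed
  hence le: "integral ?I (\<lambda>x. (D x)\<^sup>2) \<le> 0"
  proof -
    assume *: "\<And>e. e > 0 \<Longrightarrow> integral ?I (\<lambda>x. (D x)\<^sup>2) \<le> e * integral ?I (\<lambda>x. \<bar>D x\<bar>)"
    let ?J = "integral ?I (\<lambda>x. \<bar>D x\<bar>)"
    have J: "?J \<ge> 0" by (rule integral_nonneg) (intro integrable_continuous_interval continuous_intros cont, simp)
    show ?thesis
    proof (rule field_le_epsilon)
      fix e :: real assume "e > 0"
      have "integral ?I (\<lambda>x. (D x)\<^sup>2) \<le> e / (?J + 1) * ?J" using *[of "e / (?J + 1)"] \<open>e > 0\<close> J by auto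
      also have "\<dots> \<le> e" using J \<open>e > 0\<close> by (simp add: field_simps)
      finally show "integral ?I (\<lambda>x. (D x)\<^sup>2) \<le> 0 + e" by simp
    qed
  qed
  have "integral ?I (\<lambda>x. (D x)\<^sup>2) = 0"
    by (intro order_antisym le integral_nonneg integrable_continuous_interval contD2) auto
  hence "(D x)\<^sup>2 = 0" using integral_eq_0_iff[OF contD2] x by auto
  thus ?thesis by simp
qed

text \<open>
In terms of this sum the theta function \<open>\<Sum>n\<in>\<int>. exp (- \<pi> * n\<^sup>2 * x)\<close> is
\<open>1 + 2 * theta_half_sum x\<close>.
\<close>

definition theta_half_sum :: "real \<Rightarrow> real" where
  "theta_half_sum x = (\<Sum>n. exp (- pi * (real (Suc n))\<^sup>2 * x))"

lemma theta_half_sum_term_le: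
  assumes "x > 0"
  shows "exp (- pi * (real (Suc n))\<^sup>2 * x) \<le> exp (- pi * x) ^ Suc n"
proof -
  have "real (Suc n) \<le> (real (Suc n))\<^sup>2" by (simp add: power2_eq_square)
  hence "pi * x * real (Suc n) \<le> pi * x * (real (Suc n))\<^sup>2" using assms by (intro mult_left_mono) auto
  hence "exp (- pi * (real (Suc n))\<^sup>2 * x) \<le> exp (real (Suc n) * (- pi * x))" by (simp add: mult_ac)
  thus ?thesis by (simp only: exp_of_nat_mult)
qed

lemma summable_exp_power_Suc:
  assumes "c > (0::real)"
  shows "summable (\<lambda>n. exp (- c) ^ Suc n)"
  using assms by (subst summable_Suc_iff) (auto intro: summable_geometric)

lemma summable_theta_half_sum:
  assumes "x > 0"
  shows "summable (\<lambda>n. exp (- pi * (real (Suc n))\<^sup>2 * x))"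
  by (rule summable_comparison_test_ev[OF _ summable_exp_power_Suc[of "pi * x"]])
     (use assms theta_half_sum_term_le[OF assms] in \<open>auto intro!: always_eventually\<close>)

text \<open>
This is Poisson summation for a Gaussian. Both the periodization \<open>A\<close> of the Gaussian and the
cosine series \<open>B\<close> with the dual Gaussian as coefficients are continuous and even, and they have
the same cosine moments: for \<open>A\<close> the integrals over the translates of the period add up to a
Gaussian integral over the line, for \<open>B\<close> the moments are read off by orthogonality. So \<open>A =
B\<close>, and the claim is the value at 0.
\<close>

theorem theta_transformation:
  assumes t: "t > 0"
  shows "1 + 2 * theta_half_sum t = (1 + 2 * theta_half_sum (1 / t)) / sqrt t"
proof -
  let ?I = "{-(1/2)..1/2::real}"
  define g where "g = (\<lambda>x. exp (- pi * t * x\<^sup>2))"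
  define a where "a = (\<lambda>n x. if n = 0 then g x else g (x + real n) + g (x - real n))"
  define b where "b = (\<lambda>n x. (if n = 0 then 1 else 2 * exp (- pi * (real n)\<^sup>2 / t) * cos (2 * pi * real n * x)) / sqrt t)"
  define Ma where "Ma = (\<lambda>n. 2 * exp (- (pi * t / 4)) ^ n)"
  define Mb where "Mb = (\<lambda>n. 2 / sqrt t * exp (- (pi / t)) ^ n)"
  have Ma: "summable Ma" unfolding Ma_def using t by (intro summable_mult summable_geometric) auto
  have Mb: "summable Mb" unfolding Mb_def using t by (intro summable_mult summable_geometric) auto
  have g_le: "g y \<le> exp (- (pi * t / 4)) ^ n" if "\<bar>y\<bar> \<ge> real n - 1/2" "n > 0" for y n
  proof -
    \<comment> \<open>On the period, the translates by \<open>n\<close> have distance at least \<open>n - 1/2\<close> from 0; a linear lower bound for its square gives a geometric majorant.\<close>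
    have "real n / 4 \<le> (real n - 1/2)\<^sup>2"
    proof -
      have "0 \<le> (real n - 1) * (4 * real n - 1)" using that by (intro mult_nonneg_nonneg) auto
      moreover have "4 * (real n - 1/2)\<^sup>2 - real n = (real n - 1) * (4 * real n - 1)"
        by (simp add: power2_eq_square algebra_simps)
      ultimately show ?thesis by linarith
    qed
    also have "\<dots> \<le> \<bar>y\<bar>\<^sup>2" by (intro power_mono) (use that in auto)
    finally have "real n / 4 \<le> y\<^sup>2" by simp
    hence "pi * t * (real n / 4) \<le> pi * t * y\<^sup>2" using t by (intro mult_left_mono) auto
    thus ?thesis by (simp add: g_def exp_of_nat_mult [symmetric] mult_ac)
  qed
  have a_bound: "\<bar>a n x\<bar> \<le> Ma n" if "x \<in> ?I" for n x
  proof (cases "n = 0")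
    case True
    have "\<bar>g x\<bar> \<le> 1" using t by (simp add: g_def)
    thus ?thesis using True by (simp add: a_def Ma_def)
  next
    case False
    have "g (x + real n) \<le> exp (- (pi * t / 4)) ^ n" "g (x - real n) \<le> exp (- (pi * t / 4)) ^ n"
      by (rule g_le; use that False in auto)+
    moreover have "g y \<ge> 0" for y by (simp add: g_def)
    ultimately show ?thesis using False by (simp add: a_def Ma_def abs_of_nonneg)
  qed
  have b_bound: "\<bar>b n x\<bar> \<le> Mb n" for n x
  proof (cases "n = 0")
    case True
    thus ?thesis using t by (simp add: b_def Mb_def field_simps)
  next
    case False
    hence "real n \<le> (real n)\<^sup>2" by (simp add: power2_eq_square)
    hence "exp (- pi * (real n)\<^sup>2 / t) \<le> exp (- (pi / t)) ^ n" using t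
      by (simp add: exp_of_nat_mult [symmetric] field_simps)
    moreover have "\<bar>cos (2 * pi * real n * x)\<bar> \<le> 1" by simp
    ultimately have "exp (- pi * (real n)\<^sup>2 / t) * \<bar>cos (2 * pi * real n * x)\<bar> \<le> exp (- (pi / t)) ^ n * 1"
      by (intro mult_mono) auto
    thus ?thesis using False t by (simp add: b_def Mb_def abs_mult divide_right_mono)
  qed
  have a_cont: "continuous_on ?I (a n)" for n
    unfolding a_def g_def by (cases "n = 0") (auto intro!: continuous_intros)
  have b_cont: "continuous_on ?I (b n)" for n
    unfolding b_def using t by (cases "n = 0") (auto intro!: continuous_intros)
  define A where "A = (\<lambda>x. \<Sum>n. a n x)"
  define B where "B = (\<lambda>x. \<Sum>n. b n x)"
  have A_cont: "continuous_on ?I A" unfolding A_def by (rule integral_uniform_suminf(1)[OF a_cont a_bound Ma])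
  have B_cont: "continuous_on ?I B" unfolding B_def by (rule integral_uniform_suminf(1)[OF b_cont b_bound Mb])
  have cos_le: "\<bar>y * cos z\<bar> \<le> M" if "\<bar>y\<bar> \<le> M" for y z M :: real
    using mult_mono[OF that abs_cos_le_one[of z]] that by (simp add: abs_mult)
  have A_mom: "integral ?I (\<lambda>x. A x * cos (2 * pi * real k * x)) = exp (- pi * (real k)\<^sup>2 / t) / sqrt t" for k
  proof -
    let ?c = "\<lambda>x. cos (2 * pi * real k * x)"
    have c_shift: "?c (x + real n) = ?c x" "?c (x - real n) = ?c x" for x n
    proof -
      have *: "2 * pi * real k * (x + real n) = 2 * pi * real k * x + 2 * real (k * n) * pi"
              "2 * pi * real k * (x - real n) = 2 * pi * real k * x - 2 * real (k * n) * pi"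
        by (simp_all add: algebra_simps)
      show "?c (x + real n) = ?c x" "?c (x - real n) = ?c x"
        unfolding * cos_add cos_diff cos_2npi sin_2npi by simp_all
    qed
    have gc_cont: "continuous_on S (\<lambda>x. g x * ?c x)" for S
      unfolding g_def by (intro continuous_intros)
    have gc_int: "(\<lambda>x. g x * ?c x) integrable_on {u..v}" for u v
      by (intro integrable_continuous_interval gc_cont)
    have eq: "A x * ?c x = (\<Sum>n. a n x * ?c x)" if "x \<in> ?I" for x
    proof -
      have "summable (\<lambda>n. a n x)" 
        by (rule summable_comparison_test[OF _ Ma]) (use a_bound[OF that] in auto)
      thus ?thesis unfolding A_def by (rule suminf_mult2)
    qed
    have "(\<lambda>n. integral ?I (\<lambda>x. a n x * ?c x)) sums integral ?I (\<lambda>x. \<Sum>n. a n x * ?c x)"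
      by (rule integral_uniform_suminf(2)[OF _ _ Ma]) (auto intro!: continuous_intros a_cont cos_le a_bound)
    moreover have "integral ?I (\<lambda>x. \<Sum>n. a n x * ?c x) = integral ?I (\<lambda>x. A x * ?c x)"
      by (rule integral_cong) (use eq in auto)
    ultimately have lim1: "(\<lambda>N. \<Sum>n<Suc N. integral ?I (\<lambda>x. a n x * ?c x)) \<longlonglongrightarrow> integral ?I (\<lambda>x. A x * ?c x)"
      unfolding sums_def by (intro LIMSEQ_Suc) (simp only:)
    have shift: "((\<lambda>x. g (x + d) * ?c x) has_integral integral {-1/2 + d..1/2 + d} (\<lambda>x. g x * ?c x)) ?I"
      if d: "\<And>x. ?c (x + d) = ?c x" for d
    proof -
      have "((\<lambda>x. g x * ?c x) has_integral integral {-1/2 + d..1/2 + d} (\<lambda>x. g x * ?c x)) (cbox (-1/2 + d) (1/2 + d))"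
        using integrable_integral[OF gc_int] by simp
      from has_integral_affinity'[OF this, of 1 d] show ?thesis by (simp add: d)
    qed
    \<comment> \<open>Translating each summand back glues the periods into one long interval.\<close>
    have "(\<Sum>n<Suc N. integral ?I (\<lambda>x. a n x * ?c x)) = integral {- (real N + 1/2)..real N + 1/2} (\<lambda>x. g x * ?c x)" for N
    proof (induction N)
      case 0
      show ?case by (simp add: a_def)
    next
      case (Suc N)
      let ?m = "real (Suc N)"
      have aS: "a (Suc N) x = g (x + ?m) + g (x - ?m)" for x by (simp add: a_def)
      have "((\<lambda>x. g (x + ?m) * ?c x + g (x + (- ?m)) * ?c x) has_integral
          integral {-1/2 + ?m..1/2 + ?m} (\<lambda>x. g x * ?c x) + integral {-1/2 + (- ?m)..1/2 + (- ?m)} (\<lambda>x. g x * ?c x)) ?I"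
        by (intro has_integral_add shift) (simp_all only: add_uminus_conv_diff c_shift)
      hence "integral ?I (\<lambda>x. a (Suc N) x * ?c x) = integral {-1/2 + ?m..1/2 + ?m} (\<lambda>x. g x * ?c x) + integral {-1/2 - ?m..1/2 - ?m} (\<lambda>x. g x * ?c x)"
        unfolding aS distrib_right add_uminus_conv_diff by (rule integral_unique)
      moreover have "integral {- (real N + 1/2)..real N + 1/2} (\<lambda>x. g x * ?c x) + integral {real N + 1/2..?m + 1/2} (\<lambda>x. g x * ?c x) = integral {- (real N + 1/2)..?m + 1/2} (\<lambda>x. g x * ?c x)"
        by (rule Henstock_Kurzweil_Integration.integral_combine) (auto intro: gc_int)
      moreover have "integral {- (?m + 1/2)..- (real N + 1/2)} (\<lambda>x. g x * ?c x) + integral {- (real N + 1/2)..?m + 1/2} (\<lambda>x. g x * ?c x) = integral {- (?m + 1/2)..?m + 1/2} (\<lambda>x. g x * ?c x)"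
        by (rule Henstock_Kurzweil_Integration.integral_combine) (auto intro: gc_int)
      moreover have "-1/2 + ?m = real N + 1/2" "1/2 + ?m = ?m + 1/2" "-1/2 - ?m = - (?m + 1/2)" "1/2 - ?m = - (real N + 1/2)" by auto
      ultimately show ?case using Suc by (simp only: sum.lessThan_Suc[of _ "Suc N"])
    qed
    moreover have "(\<lambda>N. integral {- (real N + 1/2)..real N + 1/2} (\<lambda>x. g x * ?c x)) \<longlonglongrightarrow> exp (- pi * (real k)\<^sup>2 / t) / sqrt t"
      using integral_symmetric_intervals_tendsto[OF gaussian_cos_integral[OF t, of "real k"]] gc_cont
      unfolding g_def by simp
    ultimately show ?thesis using lim1 LIMSEQ_unique by simp
  qed
  have cos_orth: "integral ?I (\<lambda>x. cos (2 * pi * real n * x) * cos (2 * pi * real k * x)) = 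
      (if n = k then if k = 0 then 1 else 1/2 else 0)" for n k
  proof -
    have cos_int: "((\<lambda>x. cos (2 * pi * of_int j * x)) has_integral (if j = 0 then 1 else 0)) ?I" for j :: int
    proof (cases "j = 0")
      case True
      thus ?thesis using has_integral_const_real[of "1::real" "-1/2" "1/2"] by simp
    next
      case False
      let ?F = "\<lambda>x. sin (2 * pi * of_int j * x) / (2 * pi * of_int j)"
      have "((\<lambda>x. cos (2 * pi * of_int j * x)) has_integral ?F (1/2) - ?F (-(1/2))) ?I"
        by (rule fundamental_theorem_of_calculus)
           (use False in \<open>auto intro!: derivative_eq_intros simp: has_real_derivative_iff_has_vector_derivative [symmetric]\<close>)
      moreover have "sin (pi * of_int j) = (0::real)" by (simp add: sin_zero_iff_int2 mult.commute)
      ultimately show ?thesis using False by simp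
    qed
    have "((\<lambda>x. (cos (2 * pi * of_int (int n - int k) * x) + cos (2 * pi * of_int (int n + int k) * x)) / 2) has_integral
      ((if int n - int k = 0 then 1 else 0) + (if int n + int k = 0 then 1 else 0)) / 2) ?I"
      by (intro has_integral_divide has_integral_add cos_int)
    moreover have "(cos (2 * pi * of_int (int n - int k) * x) + cos (2 * pi * of_int (int n + int k) * x)) / 2 = 
        cos (2 * pi * real n * x) * cos (2 * pi * real k * x)" for x
      by (simp add: algebra_simps cos_add cos_diff)
    ultimately show ?thesis by (auto simp: integral_unique)
  qed
  have B_mom: "integral ?I (\<lambda>x. B x * cos (2 * pi * real k * x)) = exp (- pi * (real k)\<^sup>2 / t) / sqrt t" for k
  proof -
    let ?c = "\<lambda>x. cos (2 * pi * real k * x)"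
    have eq: "B x * ?c x = (\<Sum>n. b n x * ?c x)" for x
    proof -
      have "summable (\<lambda>n. b n x)" 
        by (rule summable_comparison_test[OF _ Mb]) (use b_bound in auto)
      thus ?thesis unfolding B_def by (rule suminf_mult2)
    qed
    have "(\<lambda>n. integral ?I (\<lambda>x. b n x * ?c x)) sums integral ?I (\<lambda>x. \<Sum>n. b n x * ?c x)"
      by (rule integral_uniform_suminf(2)[OF _ _ Mb]) (auto intro!: continuous_intros b_cont cos_le b_bound)
    hence 1: "(\<lambda>n. integral ?I (\<lambda>x. b n x * ?c x)) sums integral ?I (\<lambda>x. B x * ?c x)"
      by (simp add: eq)
    have 2: "integral ?I (\<lambda>x. b n x * ?c x) = (if n = k then exp (- pi * (real k)\<^sup>2 / t) / sqrt t else 0)" for n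
    proof -
      have "integral ?I (\<lambda>x. b n x * ?c x) = integral ?I (\<lambda>x. (if n = 0 then 1 else 2 * exp (- pi * (real n)\<^sup>2 / t)) / sqrt t * (cos (2 * pi * real n * x) * ?c x))"
        by (rule integral_cong) (auto simp: b_def)
      also have "\<dots> = (if n = 0 then 1 else 2 * exp (- pi * (real n)\<^sup>2 / t)) / sqrt t * integral ?I (\<lambda>x. cos (2 * pi * real n * x) * ?c x)"
        by (rule integral_mult_right)
      finally show ?thesis unfolding cos_orth by auto
    qed
    have "(\<lambda>n. integral ?I (\<lambda>x. b n x * ?c x)) sums (exp (- pi * (real k)\<^sup>2 / t) / sqrt t)"
      unfolding 2 by (rule sums_single)
    thus ?thesis using 1 sums_unique2 by blast
  qed
  have "A 0 - B 0 = 0"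
  proof (rule even_continuous_cos_moments_zero[where D = "\<lambda>x. A x - B x"])
    show "continuous_on ?I (\<lambda>x. A x - B x)" by (intro continuous_intros A_cont B_cont)
    have "g (-x) = g x" for x by (simp add: g_def)
    hence "a n (-x) = a n x" for n x 
      unfolding a_def by (smt (verit, best))
    moreover have "b n (-x) = b n x" for n x by (simp add: b_def)
    ultimately show "A (- x) - B (- x) = A x - B x" for x by (simp add: A_def B_def)
    fix k :: nat
    let ?c = "\<lambda>x. cos (2 * pi * real k * x)"
    have "integral ?I (\<lambda>x. A x * ?c x - B x * ?c x) = 0"
      by (subst integral_diff) (auto intro!: integrable_continuous_interval continuous_intros A_cont B_cont simp: A_mom B_mom)
    thus "integral ?I (\<lambda>x. (A x - B x) * ?c x) = 0" by (simp add: left_diff_distrib)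
  qed auto
  moreover have "A 0 = 1 + 2 * theta_half_sum t"
  proof -
    have "summable (\<lambda>n. a n 0)" by (rule summable_comparison_test[OF _ Ma]) (use a_bound[of 0] in auto)
    hence A0: "A 0 = a 0 0 + (\<Sum>n. a (Suc n) 0)" unfolding A_def by (subst suminf_split_head) auto
    have sq: "(- 1 - real n)\<^sup>2 = (1 + real n)\<^sup>2" for n by (simp add: power2_eq_square algebra_simps)
    have eqf: "(\<lambda>n. a (Suc n) 0) = (\<lambda>n. 2 * exp (- pi * (real (Suc n))\<^sup>2 * t))"
      by (auto simp: a_def g_def mult_ac sq)
    have s2: "(\<Sum>n. 2 * exp (- pi * (real (Suc n))\<^sup>2 * t)) = 2 * theta_half_sum t"
      unfolding theta_half_sum_def by (rule suminf_mult[OF summable_theta_half_sum[OF t]])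
    show ?thesis unfolding A0 eqf s2 by (simp add: a_def g_def)
  qed
  moreover have "B 0 = (1 + 2 * theta_half_sum (1 / t)) / sqrt t"
  proof -
    have "summable (\<lambda>n. b n 0)" by (rule summable_comparison_test[OF _ Mb]) (use b_bound[of _ 0] in auto)
    hence "B 0 = b 0 0 + (\<Sum>n. b (Suc n) 0)" unfolding B_def by (subst suminf_split_head) auto
    also have "(\<lambda>n. b (Suc n) 0) = (\<lambda>n. 2 / sqrt t * exp (- pi * (real (Suc n))\<^sup>2 * (1 / t)))"
      by (auto simp: b_def)
    also have "(\<Sum>n. 2 / sqrt t * exp (- pi * (real (Suc n))\<^sup>2 * (1 / t))) = 2 / sqrt t * theta_half_sum (1 / t)"
      unfolding theta_half_sum_def by (rule suminf_mult) (use summable_theta_half_sum[of "1 / t"] t in simp)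
    finally show ?thesis by (simp add: b_def add_divide_distrib)
  qed
  ultimately show ?thesis by simp
qed

section \<open>An entire function with the symmetries of xi\<close>

text \<open>
The logarithmic variable turns the inversion \<open>x \<mapsto> 1 / x\<close> of the theta function into the
reflection \<open>u \<mapsto> - u\<close>, and Mellin transforms into two-sided Laplace transforms.
\<close>

definition theta_kernel :: "real \<Rightarrow> real" where
  "theta_kernel u = theta_half_sum (exp (2 * u))"

lemma theta_half_sum_nonneg: "x > 0 \<Longrightarrow> theta_half_sum x \<ge> 0"
  unfolding theta_half_sum_def by (intro suminf_nonneg summable_theta_half_sum) auto

lemma theta_kernel_nonneg: "theta_kernel u \<ge> 0"
  by (simp add: theta_kernel_def theta_half_sum_nonneg)

lemma theta_half_sum_le:
  assumes "x \<ge> 1"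
  shows "theta_half_sum x \<le> 2 * exp (- pi * x)"
proof -
  define q where "q = exp (- pi * x)"
  have "2 \<le> 1 + pi * x" using mult_mono[of 1 pi 1 x] pi_gt3 assms by simp
  also have "\<dots> \<le> exp (pi * x)" by (rule exp_ge_add_one_self)
  finally have q: "q \<le> 1/2" "q > 0" by (simp_all add: q_def exp_minus field_simps)
  have "theta_half_sum x \<le> (\<Sum>n. q ^ Suc n)" unfolding theta_half_sum_def
    by (rule suminf_le) (use theta_half_sum_term_le[of x] summable_theta_half_sum[of x] summable_exp_power_Suc[of "pi * x"] assms in \<open>auto simp: q_def\<close>)
  also have "(\<Sum>n. q ^ Suc n) = q * (1 / (1 - q))" 
    using q by (simp add: suminf_mult suminf_geometric)
  also have "\<dots> \<le> q * 2" using q by (intro mult_left_mono) (auto simp: field_simps)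
  finally show ?thesis by (simp add: q_def mult.commute)
qed

text \<open>
The kernel decays doubly exponentially. A Gaussian bound is enough for everything that follows, including the
growth estimate for xi; the constant \<open>1/4\<close> is what makes xi positive between 0 and 1.
\<close>

lemma theta_kernel_le:
  assumes "u \<ge> 0"
  shows "theta_kernel u \<le> exp (- 2 * u - u\<^sup>2) / 4"
proof -
  define x where "x = exp (2 * u)"
  have x: "1 + 2 * u + 2 * u\<^sup>2 \<le> x" 
    using exp_lower_Taylor_quadratic[of "2 * u"] assms by (simp add: x_def power2_eq_square)
  moreover have u: "2 * u \<ge> 0" "u\<^sup>2 \<ge> 0" using assms by auto
  ultimately have x1: "x \<ge> 1" by linarith
  have "3 * x \<le> pi * x" using pi_gt3 x1 by (intro mult_right_mono) auto
  with x u have "- (pi * x) \<le> - 3 + (- 2 * u - u\<^sup>2)" by linarith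
  hence "- pi * x \<le> - 3 + (- 2 * u - u\<^sup>2)" by simp
  hence "exp (- pi * x) \<le> exp (- 3) * exp (- 2 * u - u\<^sup>2)"
    by (simp only: exp_add [symmetric] exp_le_cancel_iff)
  moreover have "exp (- 3 :: real) \<le> 1/8"
  proof -
    have "(2::real) ^ 3 \<le> exp 1 ^ 3" by (intro power_mono) (use exp_ge_add_one_self[of "1::real"] in auto)
    also have "exp 1 ^ 3 = exp (3::real)" by (simp add: exp_of_nat_mult [symmetric])
    finally show ?thesis by (simp add: exp_minus field_simps)
  qed
  hence "exp (- 3) * exp (- 2 * u - u\<^sup>2) \<le> 1/8 * exp (- 2 * u - u\<^sup>2)" by (intro mult_right_mono) auto
  ultimately show ?thesis using theta_half_sum_le[OF x1] unfolding theta_kernel_def x_def by linarith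
qed

lemma theta_kernel_measurable [measurable]: "theta_kernel \<in> borel_measurable borel"
  unfolding theta_kernel_def theta_half_sum_def by measurable

lemma theta_kernel_reflect:
  "theta_kernel (- u) = exp u * theta_kernel u + (exp u - 1) / 2"
proof -
  have "1 + 2 * theta_half_sum (exp (- 2 * u)) = (1 + 2 * theta_half_sum (1 / exp (- 2 * u))) / sqrt (exp (- 2 * u))"
    by (rule theta_transformation) auto
  moreover have "1 / exp (- 2 * u) = exp (2 * u)" by (simp add: exp_minus field_simps)
  moreover have "sqrt (exp (- 2 * u)) = exp (- u)"
    by (rule real_sqrt_unique) (auto simp: power2_eq_square exp_add [symmetric])
  ultimately have "1 + 2 * theta_kernel (- u) = (1 + 2 * theta_kernel u) / exp (- u)"
    by (simp add: theta_kernel_def)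
  thus ?thesis by (simp add: exp_minus field_simps)
qed

lemma exp_decay_integral:
  assumes "c > (0::real)"
  shows "has_bochner_integral lborel (\<lambda>u. indicator {0<..} u * exp (- (c * u))) (1 / c)"
proof -
  define f where "f = (\<lambda>x::real. exp (- x) * indicator {0<..} x)"
  have "has_bochner_integral lborel f 1"
    using has_bochner_integral_I0i_power_exp_m[of 0] by (simp add: f_def)
  hence "has_bochner_integral lborel (\<lambda>x. f (0 + c * x)) (1 /\<^sub>R \<bar>c\<bar>)"
    using lborel_has_bochner_integral_real_affine_iff[of c f 1 0] assms by auto
  moreover have "f (0 + c * x) = indicator {0<..} x * exp (- (c * x))" for x
    using assms by (simp add: f_def indicator_def zero_less_mult_iff)
  ultimately show ?thesis using assms by (simp add: divide_inverse)
qed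

lemma theta_kernel_exp_le:
  assumes "u > 0"
  shows "exp (u * r) * theta_kernel u \<le> exp (r\<^sup>2 / 4) / 4 * exp (- (2 * u))"
proof -
  have "exp (u * r) * theta_kernel u \<le> exp (u * r) * (exp (- 2 * u - u\<^sup>2) / 4)"
    using theta_kernel_le assms by (intro mult_left_mono) auto
  also have "\<dots> = exp (u * r - u\<^sup>2 - 2 * u) / 4" by (simp add: exp_add [symmetric] algebra_simps)
  also have "\<dots> \<le> exp (r\<^sup>2 / 4 - 2 * u) / 4"
  proof -
    have "0 \<le> (u - r / 2)\<^sup>2" by simp
    hence "u * r - u\<^sup>2 \<le> r\<^sup>2 / 4" by (simp add: power2_eq_square algebra_simps)
    thus ?thesis by simp
  qed
  also have "\<dots> = exp (r\<^sup>2 / 4) / 4 * exp (- (2 * u))" by (simp add: exp_add [symmetric])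
  finally show ?thesis .
qed

lemma integrable_half_mellin_real:
  "integrable lborel (\<lambda>u. indicator {0<..} u * (exp (u * r) * theta_kernel u))"
proof (rule Bochner_Integration.integrable_bound)
  show "integrable lborel (\<lambda>u. exp (r\<^sup>2 / 4) / 4 * (indicator {0<..} u * exp (- (2 * u))))"
    using exp_decay_integral[of 2] by (intro integrable_mult_right) (auto simp: has_bochner_integral_iff)
  show "AE u in lborel. norm (indicator {0<..} u * (exp (u * r) * theta_kernel u)) \<le>
          norm (exp (r\<^sup>2 / 4) / 4 * (indicator {0<..} u * exp (- (2 * u))))"
    using theta_kernel_exp_le theta_kernel_nonneg by (intro AE_I2) (auto simp: indicator_def abs_mult)
qed auto

definition half_mellin :: "complex \<Rightarrow> complex" where
  "half_mellin s = (LINT u|lborel. indicator {0<..} u *\<^sub>R (exp (of_real u * s) * of_real (theta_kernel u)))"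

lemma integrable_half_mellin:
  "integrable lborel (\<lambda>u. indicator {0<..} u *\<^sub>R (exp (of_real u * s) * complex_of_real (theta_kernel u)))"
  by (rule Bochner_Integration.integrable_bound[OF integrable_half_mellin_real[of "Re s"]])
     (auto simp: indicator_def norm_mult theta_kernel_nonneg)

lemma half_mellin_of_real:
  "half_mellin (of_real r) = of_real (LINT u|lborel. indicator {0<..} u * (exp (u * r) * theta_kernel u))"
  unfolding half_mellin_def
  by (subst integral_complex_of_real [symmetric])
     (auto intro!: Bochner_Integration.integral_cong simp: indicator_def exp_of_real [symmetric])

lemma half_mellin_cnj: "half_mellin (cnj s) = cnj (half_mellin s)"
  unfolding half_mellin_def
  by (subst integral_bounded_linear[OF bounded_linear_cnj integrable_half_mellin, symmetric])
     (auto intro!: Bochner_Integration.integral_cong simp: exp_cnj)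

lemma norm_half_mellin_le: "norm (half_mellin s) \<le> exp ((norm s)\<^sup>2 / 4) / 8"
proof -
  have "norm (half_mellin s) \<le> (LINT u|lborel. exp ((norm s)\<^sup>2 / 4) / 4 * (indicator {0<..} u * exp (- (2 * u))))"
    unfolding half_mellin_def
  proof (rule Bochner_Integration.integral_norm_bound_integral[OF integrable_half_mellin])
    show "integrable lborel (\<lambda>u. exp ((norm s)\<^sup>2 / 4) / 4 * (indicator {0<..} u * exp (- (2 * u))))"
      using exp_decay_integral[of 2] by (intro integrable_mult_right) (auto simp: has_bochner_integral_iff)
    fix u :: real
    show "norm (indicator {0<..} u *\<^sub>R (exp (of_real u * s) * complex_of_real (theta_kernel u))) \<le> 
       exp ((norm s)\<^sup>2 / 4) / 4 * (indicator {0<..} u * exp (- (2 * u)))"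
    proof (cases "u > 0")
      case True
      have "exp (u * Re s) * theta_kernel u \<le> exp (u * norm s) * theta_kernel u"
        using True by (intro mult_right_mono theta_kernel_nonneg) (auto simp: complex_Re_le_cmod)
      also have "\<dots> \<le> exp ((norm s)\<^sup>2 / 4) / 4 * exp (- (2 * u))" by (rule theta_kernel_exp_le[OF True])
      finally show ?thesis using True by (simp add: norm_mult theta_kernel_nonneg)
    qed auto
  qed
  also have "\<dots> = exp ((norm s)\<^sup>2 / 4) / 8"
    using exp_decay_integral[of 2] by (simp add: has_bochner_integral_iff)
  finally show ?thesis .
qed

lemma half_mellin_real_le:
  assumes "r \<le> 1"
  shows "(LINT u|lborel. indicator {0<..} u * (exp (u * r) * theta_kernel u)) \<le> 1/4"
proof -
  have "(LINT u|lborel. indicator {0<..} u * (exp (u * r) * theta_kernel u)) \<le> 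
        (LINT u|lborel. 1/4 * (indicator {0<..} u * exp (- (1 * u))))"
  proof (rule integral_mono[OF integrable_half_mellin_real])
    show "integrable lborel (\<lambda>u::real. 1/4 * (indicator {0<..} u * exp (- (1 * u))))"
      using exp_decay_integral[of 1] by (intro integrable_mult_right) (auto simp: has_bochner_integral_iff)
    fix u :: real
    show "indicator {0<..} u * (exp (u * r) * theta_kernel u) \<le> 1/4 * (indicator {0<..} u * exp (- (1 * u)))"
    proof (cases "u > 0")
      case True
      have "exp (u * r) * theta_kernel u \<le> exp u * (exp (- 2 * u - u\<^sup>2) / 4)"
        using True assms theta_kernel_le[of u] by (intro mult_mono theta_kernel_nonneg) auto
      also have "\<dots> = exp (- u - u\<^sup>2) / 4" by (simp add: exp_add [symmetric])
      also have "\<dots> \<le> exp (- u) / 4" by simp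
      finally show ?thesis using True by simp
    qed auto
  qed
  also have "\<dots> = 1/4" using exp_decay_integral[of 1] by (simp add: has_bochner_integral_iff)
  finally show ?thesis .
qed

text \<open>
Expanding the exponential and integrating term by term gives an everywhere convergent power series.
\<close>

lemma half_mellin_entire: "half_mellin holomorphic_on UNIV"
proof -
  define a where "a = (\<lambda>k. (LINT u|lborel. indicator {0<..} u *\<^sub>R (complex_of_real (u ^ k * theta_kernel u))) / fact k)"
  have sums: "(\<lambda>k. a k * s ^ k) sums half_mellin s" for s
  proof -
    define f where "f = (\<lambda>k u. indicator {0<..} u *\<^sub>R ((of_real u * s) ^ k / fact k * complex_of_real (theta_kernel u)))"
    define G where "G = (\<lambda>u. indicator {0<..} u * (exp (u * norm s) * theta_kernel u))"
    have G: "integrable lborel G" unfolding G_def by (rule integrable_half_mellin_real)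
    have nf: "norm (f k u) = indicator {0<..} u * theta_kernel u * ((u * norm s) ^ k / fact k)" for k u
      by (auto simp: f_def indicator_def norm_mult norm_divide norm_power power_mult_distrib theta_kernel_nonneg)
    have partial: "(\<Sum>k<N. norm (f k u)) \<le> G u" for N u
    proof (cases "u > 0")
      case True
      have "(\<Sum>k<N. (u * norm s) ^ k / fact k) \<le> exp (u * norm s)"
      proof -
        have "(\<lambda>k. (u * norm s) ^ k / fact k) sums exp (u * norm s)"
          using exp_converges[of "u * norm s"] by (simp add: divide_inverse mult.commute)
        thus ?thesis using True by (intro sum_le_suminf[THEN order_trans]) (auto simp: sums_iff)
      qed
      hence "theta_kernel u * (\<Sum>k<N. (u * norm s) ^ k / fact k) \<le> theta_kernel u * exp (u * norm s)"
        by (intro mult_left_mono theta_kernel_nonneg)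
      thus ?thesis using True by (simp add: nf G_def sum_distrib_left mult.commute)
    qed (simp add: nf G_def)
    have f_meas: "f k \<in> borel_measurable lborel" for k unfolding f_def by measurable
    have f_int: "integrable lborel (f k)" for k
    proof (rule Bochner_Integration.integrable_bound[OF G f_meas])
      show "AE u in lborel. norm (f k u) \<le> norm (G u)"
      proof (rule AE_I2)
        fix u :: real
        have "norm (f k u) \<le> (\<Sum>k<Suc k. norm (f k u))" by (simp add: sum_nonneg)
        also have "\<dots> \<le> G u" by (rule partial)
        finally show "norm (f k u) \<le> norm (G u)" by simp
      qed
    qed
    have "(\<lambda>k. integral\<^sup>L lborel (f k)) sums (\<integral>u. (\<Sum>k. f k u) \<partial>lborel)"
    proof (rule sums_integral[OF f_int])
      show "AE u in lborel. summable (\<lambda>k. norm (f k u))"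
        by (rule AE_I2, rule summableI_nonneg_bounded[OF _ partial]) auto
      show "summable (\<lambda>k. \<integral>u. norm (f k u) \<partial>lborel)"
      proof (rule summableI_nonneg_bounded)
        fix N
        have "(\<Sum>k<N. \<integral>u. norm (f k u) \<partial>lborel) = (\<integral>u. (\<Sum>k<N. norm (f k u)) \<partial>lborel)"
          by (rule Bochner_Integration.integral_sum [symmetric]) (use f_int in auto)
        also have "\<dots> \<le> integral\<^sup>L lborel G"
          by (rule integral_mono[OF _ G partial]) (use f_int in auto)
        finally show "(\<Sum>k<N. \<integral>u. norm (f k u) \<partial>lborel) \<le> integral\<^sup>L lborel G" .
      qed auto
    qed
    moreover have "(\<Sum>k. f k u) = indicator {0<..} u *\<^sub>R (exp (of_real u * s) * of_real (theta_kernel u))" for u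
    proof -
      have "(\<lambda>k. (of_real u * s) ^ k / fact k) sums exp (of_real u * s)"
        using exp_converges[of "of_real u * s"] by (simp add: scaleR_conv_of_real divide_inverse mult.commute)
      from sums_scaleR_right[OF sums_mult2[OF this, of "of_real (theta_kernel u)"], of "indicator {0<..} u"]
      show ?thesis unfolding f_def by (rule sums_unique [symmetric])
    qed
    moreover have "integral\<^sup>L lborel (f k) = a k * s ^ k" for k
    proof -
      have "f k u = (s ^ k / fact k) * (indicator {0<..} u *\<^sub>R (complex_of_real (u ^ k * theta_kernel u)))" for u
        by (simp add: f_def power_mult_distrib indicator_def)
      hence "integral\<^sup>L lborel (f k) = (\<integral>u. (s ^ k / fact k) * (indicator {0<..} u *\<^sub>R (complex_of_real (u ^ k * theta_kernel u))) \<partial>lborel)" 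
        by (intro Bochner_Integration.integral_cong refl)
      also have "\<dots> = a k * s ^ k" unfolding a_def by (subst integral_mult_right_zero) simp
      finally show ?thesis .
    qed
    ultimately show ?thesis by (simp add: half_mellin_def)
  qed
  have "half_mellin holomorphic_on ball 0 r" for r
    by (rule power_series_holomorphic[where a = a]) (use sums in auto)
  hence "half_mellin field_differentiable at s" for s
    using holomorphic_on_imp_differentiable_at[of half_mellin "ball 0 (norm s + 1)" s] by auto
  thus ?thesis by (auto simp: holomorphic_on_def)
qed

text \<open>
Riemann's integral representation. Splitting the Mellin transform of the theta function at the fixed point of
\<open>x \<mapsto> 1 / x\<close> and folding one half onto the other produces the two half-line transforms and
the polar terms \<open>1 / (s * (s - 1))\<close>, which the factor \<open>s * (s - 1)\<close> removes. In this
form entireness, the functional equation and the growth bound are immediate.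
\<close>

definition xi_entire :: "complex \<Rightarrow> complex" where
  "xi_entire s = 1/2 + s * (s - 1) * (half_mellin s + half_mellin (1 - s))"

lemma xi_entire_holomorphic: "xi_entire holomorphic_on S"
proof -
  have "half_mellin holomorphic_on S" for S using half_mellin_entire holomorphic_on_subset by blast
  moreover from holomorphic_on_compose_gen[OF _ half_mellin_entire, of "\<lambda>s. 1 - s" S]
  have "(\<lambda>s. half_mellin (1 - s)) holomorphic_on S" by (simp add: o_def holomorphic_intros)
  ultimately show ?thesis unfolding xi_entire_def by (intro holomorphic_intros)
qed

lemma xi_entire_reflect: "xi_entire (1 - s) = xi_entire s"
  by (simp add: xi_entire_def algebra_simps)

lemma xi_entire_cnj: "xi_entire (cnj s) = cnj (xi_entire s)"
  using half_mellin_cnj[of s] half_mellin_cnj[of "1 - s"] by (simp add: xi_entire_def)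

text \<open>
Outside the interval from 0 to 1 both summands are nonnegative; inside it, \<open>s * (s - 1) \<ge> -
1/4\<close> and the integrals add up to at most \<open>1/2\<close>, which cannot outweigh the constant
\<open>1/2\<close>.
\<close>

lemma xi_entire_real_pos: "xi_entire (of_real r) \<in> \<real>" "Re (xi_entire (of_real r)) > 0"
proof -
  define I where "I = (\<lambda>r. LINT u|lborel. indicator {0<..} u * (exp (u * r) * theta_kernel u))"
  have I: "half_mellin (of_real r) = of_real (I r)" for r by (simp add: half_mellin_of_real I_def)
  have eq: "xi_entire (of_real r) = of_real (1/2 + r * (r - 1) * (I r + I (1 - r)))"
    using I[of "1 - r"] by (simp add: xi_entire_def I)
  thus "xi_entire (of_real r) \<in> \<real>" by simp
  have I0: "I r \<ge> 0" for r unfolding I_def by (intro integral_nonneg_AE AE_I2) (simp add: theta_kernel_nonneg)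
  have "1/2 + r * (r - 1) * (I r + I (1 - r)) > 0"
  proof (cases "0 \<le> r \<and> r \<le> 1")
    case True
    hence "I r \<le> 1/4" "I (1 - r) \<le> 1/4" unfolding I_def by (intro half_mellin_real_le; simp)+
    moreover have "r * (1 - r) \<ge> 0" using True by simp
    moreover have "r * (1 - r) \<le> 1/4" 
      using zero_le_power2[of "r - 1/2"] by (simp add: power2_eq_square algebra_simps)
    ultimately have "r * (1 - r) * (I r + I (1 - r)) \<le> 1/4 * (1/4 + 1/4)"
      using I0[of r] I0[of "1 - r"] by (intro mult_mono) auto
    thus ?thesis by (simp add: algebra_simps)
  next
    case False
    hence "r * (r - 1) \<ge> 0" by (cases "r < 0") (auto intro: mult_nonpos_nonpos)
    hence "r * (r - 1) * (I r + I (1 - r)) \<ge> 0" using I0[of r] I0[of "1 - r"] by simp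
    thus ?thesis by linarith
  qed
  thus "Re (xi_entire (of_real r)) > 0" by (simp add: eq)
qed

text \<open>
The true order of growth is 1. The cruder order 2 suffices because it is only used, through the logarithm of
the modulus, at bounded real part, where the maximum principle in strips tolerates it.
\<close>

lemma xi_entire_growth: "norm (xi_entire s) \<le> exp (4 * (1 + norm s)\<^sup>2)"
proof -
  define R where "R = 1 + norm s"
  have R: "R \<ge> 1" by (simp add: R_def)
  have "norm (half_mellin z) \<le> exp (R\<^sup>2) / 8" if "norm z \<le> R" for z
  proof -
    have "(norm z)\<^sup>2 \<le> R\<^sup>2" using that by (intro power_mono) auto
    hence "(norm z)\<^sup>2 / 4 \<le> R\<^sup>2" using zero_le_power2[of R] by linarith
    thus ?thesis using norm_half_mellin_le[of z] by (smt (verit) exp_le_cancel_iff divide_right_mono)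
  qed
  moreover have n: "norm s \<le> R" "norm (1 - s) \<le> R" "norm (s - 1) \<le> R"
    using norm_triangle_ineq4[of 1 s] norm_triangle_ineq4[of s 1] by (auto simp: R_def)
  ultimately have "norm (half_mellin s) \<le> exp (R\<^sup>2) / 8" "norm (half_mellin (1 - s)) \<le> exp (R\<^sup>2) / 8" by blast+
  hence "norm (half_mellin s + half_mellin (1 - s)) \<le> exp (R\<^sup>2) / 4"
    using norm_triangle_ineq[of "half_mellin s" "half_mellin (1 - s)"] by linarith
  hence *: "norm s * norm (s - 1) * norm (half_mellin s + half_mellin (1 - s)) \<le> R * R * (exp (R\<^sup>2) / 4)"
    using n R by (intro mult_mono) auto
  have "norm (xi_entire s) \<le> norm (1/2 :: complex) + norm (s * (s - 1) * (half_mellin s + half_mellin (1 - s)))"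
    unfolding xi_entire_def by (rule norm_triangle_ineq)
  also have "\<dots> \<le> 1/2 + R\<^sup>2 * (exp (R\<^sup>2) / 4)" using * by (simp add: norm_mult power2_eq_square)
  also have "\<dots> \<le> exp (R\<^sup>2) * exp (R\<^sup>2)"
  proof -
    have "R\<^sup>2 \<le> exp (R\<^sup>2)" "1 \<le> exp (R\<^sup>2)" using exp_ge_add_one_self[of "R\<^sup>2"] zero_le_power2[of R] by linarith+
    hence "R\<^sup>2 * exp (R\<^sup>2) \<le> exp (R\<^sup>2) * exp (R\<^sup>2)" "1 * 1 \<le> exp (R\<^sup>2) * exp (R\<^sup>2)"
      by (intro mult_right_mono mult_mono; simp)+
    moreover have "R\<^sup>2 * (exp (R\<^sup>2) / 4) = (R\<^sup>2 * exp (R\<^sup>2)) / 4" by simp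
    ultimately show ?thesis by linarith
  qed
  also have "\<dots> \<le> exp (4 * R\<^sup>2)" by (simp add: exp_add [symmetric])
  finally show ?thesis by (simp add: R_def)
qed

section \<open>Identification with the completed zeta function\<close>

text \<open>
Euler's integral after the substitution \<open>t = exp v\<close>.
\<close>

lemma Gamma_integral_exp:
  assumes a: "a > (0::real)"
  shows "(\<integral>\<^sup>+v. ennreal (exp (a * v - exp v)) \<partial>lborel) = ennreal (Gamma a)"
proof -
  define f where "f = (\<lambda>t::real. t powr (a - 1) / exp t)"
  have "(f has_integral Gamma a) {0<..}"
  proof -
    have "negligible {x \<in> {0..} - {0<..}. f x \<noteq> 0}"
      by (rule negligible_subset[of "{0}"]) auto
    moreover have "{x \<in> {0<..} - {0..}. f x \<noteq> 0} = {}" by auto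
    ultimately show ?thesis
      using has_integral_spike_set_eq[of "{0..}" "{0<..}" f "Gamma a"] Gamma_integral_real[OF a]
      by (simp only: f_def negligible_empty)
  qed
  moreover from this have "f absolutely_integrable_on {0<..}"
    by (intro nonnegative_absolutely_integrable_1) (auto simp: f_def has_integral_integrable)
  moreover have "range exp = {0::real<..}"
  proof safe
    fix x :: real assume "x > 0" thus "x \<in> range exp" using exp_ln[of x] by (metis rangeI)
  qed auto
  ultimately have "f absolutely_integrable_on exp ` UNIV \<and> integral (exp ` UNIV) f = Gamma a"
    by (simp add: integral_unique)
  hence "(\<lambda>v. \<bar>exp v\<bar> * f (exp v)) absolutely_integrable_on UNIV \<and> integral UNIV (\<lambda>v. \<bar>exp v\<bar> * f (exp v)) = Gamma a"
    by (subst has_absolute_integral_change_of_variables_1') (auto intro!: derivative_eq_intros inj_onI)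
  moreover have "\<bar>exp v\<bar> * f (exp v) = exp (a * v - exp v)" for v
    by (simp add: f_def powr_def exp_diff left_diff_distrib)
  ultimately have "((\<lambda>v. exp (a * v - exp v)) has_integral Gamma a) UNIV"
    by (auto simp: has_integral_iff set_lebesgue_integral_eq_integral)
  from nn_integral_has_integral_lebesgue[OF _ this] show ?thesis by simp
qed

lemma Mellin_transform_exp_quadratic:
  assumes c: "c > (0::real)" and \<sigma>: "\<sigma> > 0"
  shows "(\<integral>\<^sup>+u. ennreal (exp (u * \<sigma>) * exp (- (c * exp (2 * u)))) \<partial>lborel) =
           ennreal (c powr (- (\<sigma> / 2)) * Gamma (\<sigma> / 2) / 2)"
proof -
  have eq: "exp ((- ln c / 2 + 1/2 * v) * \<sigma>) * exp (- (c * exp (2 * (- ln c / 2 + 1/2 * v)))) =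
        c powr (- (\<sigma> / 2)) * exp (\<sigma> / 2 * v - exp v)" for v
  proof -
    have "2 * (- ln c / 2 + 1/2 * v) = v - ln c" by (simp add: field_simps)
    hence "c * exp (2 * (- ln c / 2 + 1/2 * v)) = exp v" using c by (simp add: exp_diff)
    moreover have "(- ln c / 2 + 1/2 * v) * \<sigma> = - (\<sigma> / 2) * ln c + \<sigma> / 2 * v" by (simp add: algebra_simps)
    ultimately show ?thesis using c 
      by (simp only:) (simp add: powr_def exp_add [symmetric] algebra_simps)
  qed
  have "(\<integral>\<^sup>+u. ennreal (exp (u * \<sigma>) * exp (- (c * exp (2 * u)))) \<partial>lborel) =
     ennreal \<bar>1/2\<bar> * (\<integral>\<^sup>+v. ennreal (c powr (- (\<sigma> / 2)) * exp (\<sigma> / 2 * v - exp v)) \<partial>lborel)"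
    by (subst nn_integral_real_affine[where c = "1/2" and t = "- ln c / 2"]) (simp_all only: eq, auto)
  also have "\<dots> = ennreal (1/2) * (ennreal (c powr (- (\<sigma> / 2))) * ennreal (Gamma (\<sigma> / 2)))"
    using \<sigma> Gamma_integral_exp[of "\<sigma> / 2"]
    by (simp add: ennreal_mult' nn_integral_cmult)
  also have "\<dots> = ennreal (1/2 * (c powr (- (\<sigma> / 2)) * Gamma (\<sigma> / 2)))"
    using \<sigma> Gamma_real_pos[of "\<sigma> / 2"] by (simp only: ennreal_mult' [symmetric] ennreal_mult'' [symmetric] powr_ge_zero less_imp_le)
  finally show ?thesis by simp
qed

text \<open>
Integrating the theta series term by term for real arguments. All terms are nonnegative, so no convergence
question arises in exchanging sum and integral.
\<close>

lemma Mellin_transform_theta_kernel_series: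
  assumes \<sigma>: "\<sigma> > 1"
  shows "(\<integral>\<^sup>+u. ennreal (exp (u * \<sigma>) * theta_kernel u) \<partial>lborel) =
           ennreal (pi powr (- (\<sigma> / 2)) * Gamma (\<sigma> / 2) / 2 * (\<Sum>n. real (Suc n) powr (- \<sigma>)))"
proof -
  define f where "f = (\<lambda>n u. exp (u * \<sigma>) * exp (- (pi * (real (Suc n))\<^sup>2 * exp (2 * u))))"
  have sm: "summable (\<lambda>n. exp (- pi * (real (Suc n))\<^sup>2 * exp (2 * u)))" for u :: real
    by (rule summable_theta_half_sum) simp
  have eq: "exp (u * \<sigma>) * theta_kernel u = (\<Sum>n. f n u)" "summable (\<lambda>n. f n u)" for u
    using suminf_mult[OF sm[of u], of "exp (u * \<sigma>)"] summable_mult[OF sm[of u], of "exp (u * \<sigma>)"]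
    by (simp_all add: f_def theta_kernel_def theta_half_sum_def)
  have "(\<integral>\<^sup>+u. ennreal (exp (u * \<sigma>) * theta_kernel u) \<partial>lborel) = (\<integral>\<^sup>+u. (\<Sum>n. ennreal (f n u)) \<partial>lborel)"
    unfolding eq(1) by (intro nn_integral_cong suminf_ennreal2 [symmetric] eq(2)) (simp add: f_def)
  also have "\<dots> = (\<Sum>n. \<integral>\<^sup>+u. ennreal (f n u) \<partial>lborel)"
    by (rule nn_integral_suminf) (simp add: f_def)
  also have "(\<lambda>n. \<integral>\<^sup>+u. ennreal (f n u) \<partial>lborel) = 
     (\<lambda>n. ennreal (pi powr (- (\<sigma> / 2)) * Gamma (\<sigma> / 2) / 2 * real (Suc n) powr (- \<sigma>)))"
  proof
    fix n
    have "(pi * (real (Suc n))\<^sup>2) powr (- (\<sigma> / 2)) = pi powr (- (\<sigma> / 2)) * real (Suc n) powr (- \<sigma>)"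
    proof -
      have sq: "(real (Suc n))\<^sup>2 = real (Suc n) powr 2" by (simp add: powr_numeral)
      have "(real (Suc n))\<^sup>2 powr (- (\<sigma> / 2)) = real (Suc n) powr (- \<sigma>)"
        unfolding sq powr_powr by simp
      thus ?thesis by (simp add: powr_mult)
    qed
    thus "(\<integral>\<^sup>+u. ennreal (f n u) \<partial>lborel) = ennreal (pi powr (- (\<sigma> / 2)) * Gamma (\<sigma> / 2) / 2 * real (Suc n) powr (- \<sigma>))"
      unfolding f_def using Mellin_transform_exp_quadratic[of "pi * (real (Suc n))\<^sup>2" \<sigma>] \<sigma>
      by (simp add: mult_ac)
  qed
  also have "(\<Sum>n. ennreal (pi powr (- (\<sigma> / 2)) * Gamma (\<sigma> / 2) / 2 * real (Suc n) powr (- \<sigma>))) =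
     ennreal (\<Sum>n. pi powr (- (\<sigma> / 2)) * Gamma (\<sigma> / 2) / 2 * real (Suc n) powr (- \<sigma>))"
  proof (rule suminf_ennreal2)
    show "summable (\<lambda>n. pi powr (- (\<sigma> / 2)) * Gamma (\<sigma> / 2) / 2 * real (Suc n) powr (- \<sigma>))"
      using \<sigma> summable_real_powr_iff[of "- \<sigma>"] summable_Suc_iff[of "\<lambda>n. real n powr (- \<sigma>)"] by (intro summable_mult) simp
  qed (use \<sigma> Gamma_real_pos[of "\<sigma> / 2"] in auto)
  also have "(\<Sum>n. pi powr (- (\<sigma> / 2)) * Gamma (\<sigma> / 2) / 2 * real (Suc n) powr (- \<sigma>)) =
     pi powr (- (\<sigma> / 2)) * Gamma (\<sigma> / 2) / 2 * (\<Sum>n. real (Suc n) powr (- \<sigma>))"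
    using \<sigma> summable_real_powr_iff[of "- \<sigma>"] summable_Suc_iff[of "\<lambda>n. real n powr (- \<sigma>)"] by (intro suminf_mult) simp
  finally show ?thesis .
qed

text \<open>
The same transform computed from the reflection law of the kernel.
\<close>

lemma Mellin_transform_theta_kernel:
  fixes \<sigma> :: real
  assumes \<sigma>: "\<sigma> > 1"
  defines "I \<equiv> \<lambda>r. LINT u|lborel. indicator {0<..} u * (exp (u * r) * theta_kernel u)"
  shows "has_bochner_integral lborel (\<lambda>u. exp (u * \<sigma>) * theta_kernel u)
           (I \<sigma> + I (1 - \<sigma>) + 1 / (2 * \<sigma> * (\<sigma> - 1)))"
proof -
  define P where "P = (\<lambda>r u. indicator {0<..} u * (exp (u * r) * theta_kernel u))"
  \<comment> \<open>\<open>Q\<close> is the left half of the integrand reflected to the positive half-line.\<close>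
  define Q where "Q = (\<lambda>u. P (1 - \<sigma>) u + (indicator {0<..} u * exp (- ((\<sigma> - 1) * u)) - indicator {0<..} u * exp (- (\<sigma> * u))) / 2)"
  have P: "has_bochner_integral lborel (P r) (I r)" for r
    unfolding P_def I_def using integrable_half_mellin_real by (simp add: has_bochner_integral_iff)
  have "has_bochner_integral lborel Q (I (1 - \<sigma>) + (1 / (\<sigma> - 1) - 1 / \<sigma>) / 2)"
    unfolding Q_def using \<sigma>
    by (intro has_bochner_integral_add P has_bochner_integral_divide has_bochner_integral_diff exp_decay_integral) auto
  hence "has_bochner_integral lborel (\<lambda>u. Q (0 + (-1) * u)) ((I (1 - \<sigma>) + (1 / (\<sigma> - 1) - 1 / \<sigma>) / 2) /\<^sub>R \<bar>-1\<bar>)"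
    by (rule iffD1[OF lborel_has_bochner_integral_real_affine_iff[where t = 0], rotated]) auto
  hence "has_bochner_integral lborel (\<lambda>u. P \<sigma> u + Q (- u)) (I \<sigma> + (I (1 - \<sigma>) + (1 / (\<sigma> - 1) - 1 / \<sigma>) / 2))"
    by (intro has_bochner_integral_add P) simp
  moreover have "1 / (\<sigma> - 1) - 1 / \<sigma> = 1 / (\<sigma> * (\<sigma> - 1))" using \<sigma> by (simp add: field_simps)
  moreover have "AE u in lborel. P \<sigma> u + Q (- u) = exp (u * \<sigma>) * theta_kernel u"
    using AE_lborel_singleton[of 0]
  proof eventually_elim
    fix u :: real assume "u \<noteq> 0"
    show "P \<sigma> u + Q (- u) = exp (u * \<sigma>) * theta_kernel u"
    proof (cases "u > 0")
      case True
      thus ?thesis by (simp add: P_def Q_def)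
    next
      case False
      hence u: "- u > 0" using \<open>u \<noteq> 0\<close> by simp
      have "theta_kernel u = exp (- u) * theta_kernel (- u) + (exp (- u) - 1) / 2"
        using theta_kernel_reflect[of "- u"] by simp
      hence "exp (u * \<sigma>) * theta_kernel u = exp (u * \<sigma>) * exp (- u) * theta_kernel (- u) + (exp (u * \<sigma>) * exp (- u) - exp (u * \<sigma>)) / 2"
        by (simp only:) (simp add: algebra_simps diff_divide_distrib)
      moreover have "exp (u * \<sigma>) * exp (- u) = exp (- u * (1 - \<sigma>))" by (simp add: exp_add [symmetric] algebra_simps)
      moreover have "- u * (1 - \<sigma>) = - ((\<sigma> - 1) * - u)" "u * \<sigma> = - (\<sigma> * - u)" by (simp_all add: algebra_simps)
      ultimately show ?thesis using u by (simp add: P_def Q_def mult.commute)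
    qed
  qed
  ultimately show ?thesis
    by (subst has_bochner_integral_cong_AE[symmetric, where f = "\<lambda>u. P \<sigma> u + Q (- u)"])
       (auto simp: has_bochner_integral_iff borel_measurable_integrable add_ac mult.assoc)
qed

lemma xi_entire_of_real:
  assumes \<sigma>: "\<sigma> > 1"
  shows "xi_entire (of_real \<sigma>) = of_real (\<sigma> * (\<sigma> - 1) / 2 * pi powr (- (\<sigma> / 2)) * Gamma (\<sigma> / 2) * (\<Sum>n. real (Suc n) powr (- \<sigma>)))"
proof -
  define I where "I = (\<lambda>r. LINT u|lborel. indicator {0<..} u * (exp (u * r) * theta_kernel u))"
  define S where "S = pi powr (- (\<sigma> / 2)) * Gamma (\<sigma> / 2) / 2 * (\<Sum>n. real (Suc n) powr (- \<sigma>))"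
  have *: "has_bochner_integral lborel (\<lambda>u. exp (u * \<sigma>) * theta_kernel u) (I \<sigma> + I (1 - \<sigma>) + 1 / (2 * \<sigma> * (\<sigma> - 1)))"
    unfolding I_def by (rule Mellin_transform_theta_kernel[OF \<sigma>])
  have S0: "S \<ge> 0" unfolding S_def 
    by (intro mult_nonneg_nonneg divide_nonneg_nonneg suminf_nonneg)
       (use \<sigma> Gamma_real_pos[of "\<sigma> / 2"] summable_real_powr_iff[of "- \<sigma>"] summable_Suc_iff[of "\<lambda>n. real n powr (- \<sigma>)"] in auto)
  have "has_bochner_integral lborel (\<lambda>u. exp (u * \<sigma>) * theta_kernel u) S"
    by (rule has_bochner_integral_nn_integral)
       (use S0 Mellin_transform_theta_kernel_series[OF \<sigma>] in \<open>auto simp: theta_kernel_nonneg S_def\<close>)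
  from has_bochner_integral_eq[OF this *] have S: "S = I \<sigma> + I (1 - \<sigma>) + 1 / (2 * \<sigma> * (\<sigma> - 1))" .
  have I: "half_mellin (of_real r) = of_real (I r)" for r by (simp add: half_mellin_of_real I_def)
  have "xi_entire (of_real \<sigma>) = of_real (1/2 + \<sigma> * (\<sigma> - 1) * (I \<sigma> + I (1 - \<sigma>)))"
    using I[of "1 - \<sigma>"] by (simp add: xi_entire_def I)
  also have "1/2 + \<sigma> * (\<sigma> - 1) * (I \<sigma> + I (1 - \<sigma>)) = \<sigma> * (\<sigma> - 1) * S"
    unfolding S using \<sigma> by (simp add: field_simps)
  finally show ?thesis by (simp add: S_def mult_ac)
qed

definition zeta_series :: "complex \<Rightarrow> complex" where
  "zeta_series s = (\<Sum>n. 1 / of_nat (Suc n) powr s)"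

lemma norm_zeta_series_term: "norm (1 / of_nat (Suc n) powr s :: complex) = real (Suc n) powr (- Re s)"
  using norm_powr_real_powr[of "of_nat (Suc n)" s] by (simp add: norm_divide powr_minus divide_inverse norm_inverse)

lemma summable_real_Suc_powr:
  assumes "\<sigma> > (1::real)"
  shows "summable (\<lambda>n. real (Suc n) powr (- \<sigma>))"
  using assms summable_real_powr_iff[of "- \<sigma>"] summable_Suc_iff[of "\<lambda>n. real n powr (- \<sigma>)"] by simp

lemma zeta_series_holomorphic: "zeta_series holomorphic_on {s. Re s > 1}"
proof (rule holomorphic_uniform_sequence[where f = "\<lambda>N s. \<Sum>n<N. 1 / of_nat (Suc n) powr s"])
  show "open {s. Re s > 1}" by (rule open_halfspace_Re_gt)
  show "(\<lambda>s. \<Sum>n<N. 1 / of_nat (Suc n) powr s) holomorphic_on {s. Re s > 1}" for N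
    by (intro holomorphic_intros) (auto simp: of_nat_Suc [symmetric] simp del: of_nat_Suc)
  fix x assume "x \<in> {s. Re s > 1}"
  define d where "d = (Re x - 1) / 2"
  have d: "d > 0" using \<open>x \<in> _\<close> by (simp add: d_def)
  have Re: "Re s \<ge> 1 + d" if "s \<in> cball x d" for s
  proof -
    have "cmod (x - s) \<le> d" using that by (simp add: dist_norm)
    moreover have "Re x - Re s \<le> cmod (x - s)" using complex_Re_le_cmod[of "x - s"] by simp
    ultimately show ?thesis by (simp add: d_def field_simps)
  qed
  have "uniform_limit (cball x d) (\<lambda>N s. \<Sum>n<N. 1 / of_nat (Suc n) powr s) (\<lambda>s. \<Sum>n. 1 / of_nat (Suc n) powr s) sequentially"
  proof (rule Weierstrass_m_test)
    show "summable (\<lambda>n. real (Suc n) powr (- (1 + d)))" by (rule summable_real_Suc_powr) (use d in auto)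
    show "norm (1 / of_nat (Suc n) powr s) \<le> real (Suc n) powr (- (1 + d))" if "s \<in> cball x d" for n s
      unfolding norm_zeta_series_term using Re[OF that] by (intro powr_mono) auto
  qed
  hence "uniform_limit (cball x d) (\<lambda>N s. \<Sum>n<N. 1 / of_nat (Suc n) powr s) zeta_series sequentially"
    unfolding zeta_series_def .
  moreover have "cball x d \<subseteq> {s. Re s > 1}" using Re d by fastforce
  ultimately show "\<exists>d>0. cball x d \<subseteq> {s. Re s > 1} \<and> uniform_limit (cball x d) (\<lambda>N s. \<Sum>n<N. 1 / of_nat (Suc n) powr s) zeta_series sequentially"
    using d by blast
qed

lemma zeta_series_of_real:
  assumes "\<sigma> > 1"
  shows "zeta_series (of_real \<sigma>) = of_real (\<Sum>n. real (Suc n) powr (- \<sigma>))"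
proof -
  have "1 / of_nat (Suc n) powr complex_of_real \<sigma> = of_real (real (Suc n) powr (- \<sigma>))" for n
    using powr_of_real[of "real (Suc n)" \<sigma>] by (simp add: powr_minus divide_inverse)
  thus ?thesis using summable_real_Suc_powr[OF assms] by (simp add: zeta_series_def suminf_of_real)
qed

text \<open>
The defining formula of xi, solved for zeta. Writing the inverse of \<open>s / 2 * Gamma (s / 2)\<close> as
\<open>rGamma (s / 2 + 1)\<close> cancels the zero of \<open>s * (s - 1)\<close> at \<open>s = 0\<close>, so 1
remains the only pole.
\<close>

definition zeta_continuation :: "complex \<Rightarrow> complex" where
  "zeta_continuation s = (if s = 1 then 0 else xi_entire s * of_real pi powr (s / 2) * rGamma (s / 2 + 1) / (s - 1))"

lemma zeta_continuation_holomorphic: "zeta_continuation holomorphic_on - {1}"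
proof -
  have "(\<lambda>s. xi_entire s * of_real pi powr (s / 2) * rGamma (s / 2 + 1) / (s - 1)) holomorphic_on - {1}"
    by (intro holomorphic_intros xi_entire_holomorphic) auto
  thus ?thesis by (rule holomorphic_transform) (auto simp: zeta_continuation_def)
qed

text \<open>
The two computations of the Mellin transform give the identity at real points; it extends by the identity
theorem.
\<close>

lemma zeta_continuation_eq_series:
  assumes "Re s > 1"
  shows "zeta_continuation s = zeta_series s"
proof -
  have "zeta_continuation s - zeta_series s = 0"
  proof (rule analytic_continuation[of "\<lambda>s. zeta_continuation s - zeta_series s" "{s. Re s > 1}" "of_real ` {1<..}" 2])
    show "(\<lambda>s. zeta_continuation s - zeta_series s) holomorphic_on {s. Re s > 1}"
      by (intro holomorphic_intros zeta_series_holomorphic holomorphic_on_subset[OF zeta_continuation_holomorphic]) auto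
    show "open {s. Re s > 1}" by (rule open_halfspace_Re_gt)
    show "connected {s. Re s > 1}" by (intro convex_connected convex_halfspace_Re_gt)
    show "2 islimpt complex_of_real ` {1<..}"
    proof -
      have eq2: "complex_of_real x = 2 \<longleftrightarrow> x = 2" for x by (metis of_real_eq_iff of_real_numeral)
      have "(2::real) islimpt {1<..}" by (intro open_imp_islimpt) auto
      hence "of_real 2 islimpt complex_of_real ` {1<..}"
        by (rule islimpt_isCont_image) (auto intro!: continuous_intros simp: eventually_at_filter eq2)
      thus ?thesis by simp
    qed
    fix z assume "z \<in> complex_of_real ` {1<..}"
    then obtain \<sigma> where z: "z = of_real \<sigma>" and \<sigma>: "\<sigma> > 1" by auto
    have "complex_of_real pi powr (of_real \<sigma> / 2) = of_real (pi powr (\<sigma> / 2))"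
      using powr_of_real[of pi "\<sigma> / 2"] by simp
    moreover have "rGamma (complex_of_real \<sigma> / 2 + 1) = of_real (rGamma (\<sigma> / 2 + 1))"
      using rGamma_complex_of_real[of "\<sigma> / 2 + 1"] by simp
    ultimately have z1: "zeta_continuation z = of_real (\<sigma> * (\<sigma> - 1) / 2 * pi powr (- (\<sigma> / 2)) * Gamma (\<sigma> / 2) *
        (\<Sum>n. real (Suc n) powr (- \<sigma>)) * pi powr (\<sigma> / 2) * rGamma (\<sigma> / 2 + 1) / (\<sigma> - 1))"
      using \<sigma> unfolding z zeta_continuation_def xi_entire_of_real[OF \<sigma>] by simp
    have "\<sigma> / 2 * rGamma (\<sigma> / 2 + 1) = rGamma (\<sigma> / 2)" by (rule rGamma_plus1)
    also have "rGamma (\<sigma> / 2) = inverse (Gamma (\<sigma> / 2))" by (rule rGamma_inverse_Gamma)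
    finally have r: "\<sigma> / 2 * rGamma (\<sigma> / 2 + 1) = inverse (Gamma (\<sigma> / 2))" .
    have "Gamma (\<sigma> / 2) \<noteq> 0" using Gamma_real_pos[of "\<sigma> / 2"] \<sigma> by linarith
    hence g1: "Gamma (\<sigma> / 2) * (\<sigma> / 2 * rGamma (\<sigma> / 2 + 1)) = 1"
      unfolding r by (rule right_inverse)
    have p1: "pi powr (- (\<sigma> / 2)) * pi powr (\<sigma> / 2) = 1" by (simp add: powr_minus)
    have alg: "x * (x - 1) / 2 * p * G * S * q * r / (x - 1) = (p * q) * (G * (x / 2 * r)) * S" if "x > 1" for x p G S q r :: real
      using that by (simp add: field_simps)
    have "zeta_continuation z = of_real (\<Sum>n. real (Suc n) powr (- \<sigma>))"
      unfolding z1 alg[OF \<sigma>] p1 g1 by simp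
    thus "zeta_continuation z - zeta_series z = 0" by (simp add: z zeta_series_of_real[OF \<sigma>])
  qed (use assms in auto)
  thus ?thesis by simp
qed

theorem zeta_eq_zeta_continuation: "zeta = zeta_continuation"
  unfolding zeta_def
proof (rule the_equality)
  show "zeta_continuation holomorphic_on - {1} \<and> (\<forall>s. 1 < Re s \<longrightarrow> zeta_continuation s = (\<Sum>n. 1 / of_nat (Suc n) powr s)) \<and> zeta_continuation 1 = 0"
    using zeta_continuation_holomorphic zeta_continuation_eq_series by (auto simp: zeta_series_def zeta_continuation_def)
next
  fix f assume f: "f holomorphic_on - {1} \<and> (\<forall>s. 1 < Re s \<longrightarrow> f s = (\<Sum>n. 1 / of_nat (Suc n) powr s)) \<and> f 1 = 0"
  have "f s = zeta_continuation s" if "s \<noteq> 1" for s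
  proof (rule analytic_continuation_open[of "{s. Re s > 1}" "- {1}" f zeta_continuation])
    show "{s. Re s > 1} \<noteq> {}" by (auto intro: exI[of _ 2])
    show "connected (- {1::complex})" by (rule connected_punctured_universe) simp
    show "f z = zeta_continuation z" if "z \<in> {s. Re s > 1}" for z
      using f zeta_continuation_eq_series that by (simp add: zeta_series_def)
  qed (use f zeta_continuation_holomorphic that in \<open>auto simp: open_halfspace_Re_gt\<close>)
  thus "f = zeta_continuation" using f by (auto simp: fun_eq_iff zeta_continuation_def)
qed

lemma xi_formula_eq_xi_entire:
  assumes "s \<noteq> 1" "s / 2 \<notin> \<int>\<^sub>\<le>\<^sub>0"
  shows "1 / 2 * s * (s - 1) * of_real pi powr (- s / 2) * Gamma (s / 2) * zeta s = xi_entire s"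
proof -
  have "s / 2 * rGamma (s / 2 + 1) = rGamma (s / 2)" by (rule rGamma_plus1)
  also have "rGamma (s / 2) = inverse (Gamma (s / 2))" by (rule rGamma_inverse_Gamma)
  finally have "s / 2 * rGamma (s / 2 + 1) = inverse (Gamma (s / 2))" .
  moreover have "Gamma (s / 2) \<noteq> 0" using assms by (simp add: Gamma_eq_zero_iff)
  ultimately have "Gamma (s / 2) * (s / 2 * rGamma (s / 2 + 1)) = 1" by simp
  moreover have "complex_of_real pi powr (- s / 2) * of_real pi powr (s / 2) = 1"
    by (simp add: powr_minus)
  moreover have "(s - 1) * zeta s = xi_entire s * of_real pi powr (s / 2) * rGamma (s / 2 + 1)"
    using assms(1) by (simp add: zeta_eq_zeta_continuation zeta_continuation_def)
  moreover have "1 / 2 * s * (s - 1) * of_real pi powr (- s / 2) * Gamma (s / 2) * zeta s =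
     complex_of_real pi powr (- s / 2) * Gamma (s / 2) * (s / 2) * ((s - 1) * zeta s)" by simp
  moreover have "p * G * h * (x * q * r) = (p * q) * (G * (h * r)) * x" for p G h x q r :: complex
    by (simp add: mult_ac)
  ultimately show ?thesis by simp
qed

theorem xi_eq_xi_entire: "xi = xi_entire"
proof
  fix z :: complex
  let ?f = "\<lambda>z. 1 / 2 * z * (z - 1) * of_real pi powr (- z / 2) * Gamma (z / 2) * zeta z"
  \<comment> \<open>The exceptional points of the formula are isolated, so near \<open>z\<close> it can fail only at \<open>z\<close> itself.\<close>
  have "eventually (\<lambda>w. w \<in> (\<lambda>w. w / 2) -` (- (\<int>\<^sub>\<le>\<^sub>0 - {z / 2}))) (nhds z)"
  proof (rule eventually_nhds_in_open)
    have cl: "closed (\<int>\<^sub>\<le>\<^sub>0 - {z / 2})" 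
      by (rule closed_subset_Ints) (use nonpos_Ints_subset_Ints in blast)
    show "open ((\<lambda>w. w / 2) -` (- (\<int>\<^sub>\<le>\<^sub>0 - {z / 2})))"
      by (rule open_vimage[OF open_Compl[OF cl]]) (auto intro!: continuous_intros)
  qed auto
  hence "eventually (\<lambda>w. w \<in> (\<lambda>w. w / 2) -` (- (\<int>\<^sub>\<le>\<^sub>0 - {z / 2}))) (at z)"
    by (auto simp: eventually_at_filter elim: eventually_mono)
  hence ev: "eventually (\<lambda>w. xi_entire w = ?f w) (at z)"
    using eventually_neq_at_within[of z] eventually_neq_at_within[of 1]
    by eventually_elim (rule xi_formula_eq_xi_entire [symmetric], auto)
  have "isCont xi_entire z"
    using xi_entire_holomorphic[of UNIV] 
    by (meson UNIV_I continuous_on_eq_continuous_at holomorphic_on_imp_continuous_on open_UNIV)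
  hence "?f \<midarrow>z\<rightarrow> xi_entire z"
    by (intro Lim_transform_eventually[OF isContD ev])
  thus "xi z = xi_entire z" unfolding xi_def by (rule remove_sings_eqI)
qed

section \<open>Bounds for the Gamma function\<close>

lemma norm_rGamma_series:
  "norm (rGamma_series (w :: complex) n) = norm (pochhammer w (n + 1)) / (fact n * exp (Re w * ln (real n)))"
  by (simp add: rGamma_series_def norm_divide norm_mult)

lemma rGamma_series_real:
  "rGamma_series (x :: real) n = pochhammer x (n + 1) / (fact n * exp (x * ln (real n)))"
  by (simp add: rGamma_series_def)

text \<open>
The modulus of \<open>Gamma (w - \<eta>) / Gamma w\<close> is largest at the real point with the same real
part. In Euler's limit formula this holds factor by factor, since \<open>(x + k) / (x - \<eta> + k)\<close>
dominates \<open>\<bar>w + k\<bar> / \<bar>w - \<eta> + k\<bar>\<close>.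
\<close>

lemma norm_Gamma_shift_le:
  fixes w :: complex and \<eta> :: real
  assumes \<eta>: "\<eta> \<ge> 0" and w: "Re w > \<eta>"
  shows "norm (Gamma (w - of_real \<eta>)) * Gamma (Re w) \<le> norm (Gamma w) * Gamma (Re w - \<eta>)"
proof -
  define x where "x = Re w"
  have x: "x > \<eta>" "x > 0" using w \<eta> by (auto simp: x_def)
  have factor: "norm (w + of_nat k) * (x - \<eta> + real k) \<le> norm (w - of_real \<eta> + of_nat k) * (x + real k)" for k
  proof -
    define p where "p = x + real k"
    define q where "q = x - \<eta> + real k"
    define y where "y = Im w"
    have pq: "0 < q" "q \<le> p" using x \<eta> by (auto simp: p_def q_def)
    have "norm (w + of_nat k) = sqrt (p\<^sup>2 + y\<^sup>2)" "norm (w - of_real \<eta> + of_nat k) = sqrt (q\<^sup>2 + y\<^sup>2)"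
      by (simp_all add: cmod_def p_def q_def y_def x_def)
    moreover have "sqrt (p\<^sup>2 + y\<^sup>2) * q \<le> sqrt (q\<^sup>2 + y\<^sup>2) * p"
    proof (rule power2_le_imp_le)
      have "q\<^sup>2 \<le> p\<^sup>2" using pq by (intro power_mono) auto
      hence "y\<^sup>2 * q\<^sup>2 \<le> y\<^sup>2 * p\<^sup>2" by (intro mult_left_mono) auto
      thus "(sqrt (p\<^sup>2 + y\<^sup>2) * q)\<^sup>2 \<le> (sqrt (q\<^sup>2 + y\<^sup>2) * p)\<^sup>2"
        by (simp add: power_mult_distrib algebra_simps)
    qed (use pq in auto)
    ultimately show ?thesis by (simp add: p_def q_def)
  qed
  have poch: "norm (pochhammer w n) * pochhammer (x - \<eta>) n \<le> norm (pochhammer (w - of_real \<eta>) n) * pochhammer x n" for n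
    unfolding pochhammer_prod prod_norm [symmetric] prod.distrib [symmetric]
    by (intro prod_mono conjI factor) (use x in auto)
  have "norm (rGamma_series w n) * rGamma_series (x - \<eta>) n \<le> norm (rGamma_series (w - of_real \<eta>) n) * rGamma_series x n" for n
  proof -
    have alg: "A / (F * E1) * (B / (F * E2)) \<le> C / (F * E2) * (D / (F * E1))"
      if "A * B \<le> C * D" "F > 0" "E1 > 0" "E2 > 0" for A B C D E1 E2 F :: real
    proof -
      have "A * B / (F * E1 * (F * E2)) \<le> C * D / (F * E1 * (F * E2))"
        using that by (intro divide_right_mono) auto
      thus ?thesis by (simp add: mult_ac)
    qed
    show ?thesis unfolding norm_rGamma_series rGamma_series_real
      using alg[OF poch[of "n + 1"]] by (simp add: x_def)
  qed
  hence le: "norm (rGamma w) * rGamma (x - \<eta>) \<le> norm (rGamma (w - of_real \<eta>)) * rGamma x"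
    by (intro LIMSEQ_le[OF tendsto_mult[OF tendsto_norm[OF rGamma_series_LIMSEQ] rGamma_series_LIMSEQ]
          tendsto_mult[OF tendsto_norm[OF rGamma_series_LIMSEQ] rGamma_series_LIMSEQ]]) auto
  have "w \<notin> \<int>\<^sub>\<le>\<^sub>0" "w - of_real \<eta> \<notin> \<int>\<^sub>\<le>\<^sub>0" using x by (auto elim!: nonpos_Ints_cases simp: x_def complex_eq_iff)
  hence "norm (Gamma w) > 0" "norm (Gamma (w - of_real \<eta>)) > 0" by (auto simp: Gamma_eq_zero_iff)
  moreover have "Gamma x > 0" "Gamma (x - \<eta>) > 0" using x by (auto intro: Gamma_real_pos)
  ultimately show ?thesis using le[unfolded rGamma_inverse_Gamma norm_inverse]
    by (simp add: field_simps x_def)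
qed

text \<open>
In Euler's limit formula for the reciprocal, \<open>\<bar>w + k\<bar> / (x + k)\<close> is at most \<open>exp
(y\<^sup>2 / (2 * (k + 1)\<^sup>2))\<close>, and the exponents sum to at most \<open>y\<^sup>2\<close>.
\<close>

lemma norm_Gamma_ge:
  fixes w :: complex
  assumes "Re w \<ge> 1"
  shows "norm (Gamma w) \<ge> Gamma (Re w) * exp (- (Im w)\<^sup>2)"
proof -
  define x where "x = Re w"
  define y where "y = Im w"
  have x: "x \<ge> 1" using assms by (simp add: x_def)
  have factor: "norm (w + of_nat k) \<le> (x + real k) * exp (y\<^sup>2 / 2 * (1 / (real k + 1)\<^sup>2))" for k
  proof -
    define p where "p = x + real k"
    have p: "p \<ge> real k + 1" "p > 0" using x by (auto simp: p_def)
    have "norm (w + of_nat k) = sqrt (p\<^sup>2 + y\<^sup>2)" by (simp add: cmod_def p_def x_def y_def)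
    also have "\<dots> \<le> p * exp (y\<^sup>2 / 2 * (1 / (real k + 1)\<^sup>2))"
    proof (rule real_le_lsqrt)
      have "(real k + 1)\<^sup>2 \<le> p\<^sup>2" using p by (intro power_mono) auto
      hence "y\<^sup>2 / p\<^sup>2 \<le> y\<^sup>2 / (real k + 1)\<^sup>2" using p by (intro divide_left_mono) auto
      moreover have "1 + y\<^sup>2 / (real k + 1)\<^sup>2 \<le> exp (y\<^sup>2 / (real k + 1)\<^sup>2)" by (rule exp_ge_add_one_self)
      ultimately have "1 + y\<^sup>2 / p\<^sup>2 \<le> exp (y\<^sup>2 / (real k + 1)\<^sup>2)" by linarith
      hence "p\<^sup>2 * (1 + y\<^sup>2 / p\<^sup>2) \<le> p\<^sup>2 * exp (y\<^sup>2 / (real k + 1)\<^sup>2)" by (intro mult_left_mono) auto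
      moreover have "p\<^sup>2 * (1 + y\<^sup>2 / p\<^sup>2) = p\<^sup>2 + y\<^sup>2" using p by (simp add: field_simps)
      moreover have "(exp (y\<^sup>2 / 2 * (1 / (real k + 1)\<^sup>2)))\<^sup>2 = exp (y\<^sup>2 / (real k + 1)\<^sup>2)"
        unfolding exp_double [symmetric] by simp
      ultimately show "p\<^sup>2 + y\<^sup>2 \<le> (p * exp (y\<^sup>2 / 2 * (1 / (real k + 1)\<^sup>2)))\<^sup>2"
        by (simp add: power_mult_distrib)
    qed (use p in auto)
    finally show ?thesis by (simp add: p_def)
  qed
  have sum_le: "(\<Sum>k=0..<n. 1 / (real k + 1)\<^sup>2) \<le> 2" for n
  proof -
    have *: "(\<Sum>k=0..<m. 1 / (real k + 1)\<^sup>2) \<le> 2 - 1 / real m" if "m > 0" for m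
      using that
    proof (induction m rule: nat_induct_non_zero)
      case (Suc n)
      have "1 / (real n + 1)\<^sup>2 \<le> 1 / (real n * (real n + 1))" using Suc by (intro divide_left_mono) (auto simp: power2_eq_square)
      also have "\<dots> = 1 / real n - 1 / real (Suc n)" using Suc by (simp add: field_simps)
      finally show ?case using Suc by simp
    qed auto
    show ?thesis
    proof (cases "n = 0")
      case False
      hence "(\<Sum>k=0..<n. 1 / (real k + 1)\<^sup>2) \<le> 2 - 1 / real n" by (intro *) simp
      moreover have "1 / real n \<ge> 0" by simp
      ultimately show ?thesis by linarith
    qed simp
  qed
  have poch: "norm (pochhammer w n) \<le> pochhammer x n * exp (y\<^sup>2)" for n
  proof -
    have "norm (pochhammer w n) \<le> (\<Prod>k=0..<n. (x + real k) * exp (y\<^sup>2 / 2 * (1 / (real k + 1)\<^sup>2)))"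
      unfolding pochhammer_prod prod_norm [symmetric] by (intro prod_mono conjI factor) auto
    also have "\<dots> = pochhammer x n * exp (y\<^sup>2 / 2 * (\<Sum>k=0..<n. 1 / (real k + 1)\<^sup>2))"
      by (simp add: prod.distrib pochhammer_prod exp_sum [symmetric] sum_distrib_left)
    also have "\<dots> \<le> pochhammer x n * exp (y\<^sup>2)"
    proof -
      have "y\<^sup>2 / 2 * (\<Sum>k=0..<n. 1 / (real k + 1)\<^sup>2) \<le> y\<^sup>2 / 2 * 2" by (intro mult_left_mono sum_le) auto
      thus ?thesis using x by (intro mult_left_mono) (auto simp: pochhammer_nonneg)
    qed
    finally show ?thesis .
  qed
  have "norm (rGamma_series w n) \<le> rGamma_series x n * exp (y\<^sup>2)" for n
    using divide_right_mono[OF poch[of "n + 1"], of "fact n * exp (x * ln (real n))"]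
    unfolding norm_rGamma_series rGamma_series_real by (simp add: x_def)
  hence le: "norm (rGamma w) \<le> rGamma x * exp (y\<^sup>2)"
    by (intro LIMSEQ_le[OF tendsto_norm[OF rGamma_series_LIMSEQ] tendsto_mult[OF rGamma_series_LIMSEQ tendsto_const]]) auto
  have "w \<notin> \<int>\<^sub>\<le>\<^sub>0" using x by (auto elim!: nonpos_Ints_cases simp: x_def complex_eq_iff)
  hence "norm (Gamma w) > 0" by (auto simp: Gamma_eq_zero_iff)
  moreover have "Gamma x > 0" using x by (auto intro: Gamma_real_pos)
  ultimately show ?thesis using le[unfolded rGamma_inverse_Gamma norm_inverse]
    by (simp add: field_simps x_def y_def exp_minus)
qed

text \<open>
By log-convexity the slope of \<open>ln Gamma\<close> over \<open>[x - \<eta>, x]\<close> is at least its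
slope over the unit interval \<open>[x - \<eta> - 1, x - \<eta>]\<close>, which is \<open>ln (x - \<eta> -
1)\<close> by the functional equation.
\<close>

lemma Gamma_real_shift_le:
  fixes x \<eta> :: real
  assumes \<eta>: "\<eta> > 0" and x: "x > 1 + \<eta>"
  shows "Gamma (x - \<eta>) \<le> Gamma x * (x - \<eta> - 1) powr (- \<eta>)"
proof -
  define t where "t = x - \<eta> - 1"
  define f where "f = ln \<circ> (Gamma :: real \<Rightarrow> real)"
  have t: "t > 0" using x by (simp add: t_def)
  have cv: "convex_on {0<..} f" unfolding f_def by (rule log_convex_Gamma_real)
  have "(f t - f (t + 1)) / (t - (t + 1)) \<le> (f t - f x) / (t - x)"
    by (rule convex_on_slope_le(1)[OF cv]) (use t \<eta> in \<open>auto simp: t_def\<close>)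
  also have "\<dots> \<le> (f (t + 1) - f x) / (t + 1 - x)"
    by (rule convex_on_slope_le(2)[OF cv]) (use t \<eta> in \<open>auto simp: t_def\<close>)
  finally have "f (t + 1) - f t \<le> (f x - f (t + 1)) / \<eta>"
    using \<eta> by (simp add: t_def field_simps)
  moreover have "Gamma (t + 1) = t * Gamma t"
    using t by (intro Gamma_plus1) (auto elim!: nonpos_Ints_cases)
  hence "f (t + 1) - f t = ln t"
    using ln_mult_pos[OF t Gamma_real_pos[OF t]] by (simp add: f_def)
  ultimately have "f (t + 1) \<le> f x - \<eta> * ln t" using \<eta> by (simp add: field_simps)
  hence "exp (f (t + 1)) \<le> exp (f x - \<eta> * ln t)" by simp
  moreover have "exp (f (t + 1)) = Gamma (x - \<eta>)" using t Gamma_real_pos[of "t + 1"] by (simp add: f_def t_def)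
  moreover have "exp (f x) = Gamma x" using x \<eta> Gamma_real_pos[of x] by (simp add: f_def)
  ultimately show ?thesis using t by (simp add: exp_diff powr_def exp_minus field_simps t_def)
qed

section \<open>A maximum principle in strips and a lower bound for zero-free functions\<close>

text \<open>
Multiplying by \<open>exp (- e * z\<^sup>4)\<close> makes the function decay at both ends of the strip,
because there the real part of \<open>z\<^sup>4\<close> grows like the fourth power of the imaginary part and
beats the quadratic exponent in the hypothesis. The maximum principle on large rectangles followed by \<open>e
\<rightarrow> 0\<close> gives the claim.
\<close>

lemma strip_Phragmen_Lindelof:
  fixes f :: "complex \<Rightarrow> complex"
  assumes holf: "f holomorphic_on {z. a \<le> Re z \<and> Re z \<le> b}"
    and growth: "\<And>z. a \<le> Re z \<Longrightarrow> Re z \<le> b \<Longrightarrow> norm (f z) \<le> exp (C * (1 + (Im z)\<^sup>2))"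
    and bdry: "\<And>z. Re z = a \<or> Re z = b \<Longrightarrow> norm (f z) \<le> 1"
    and z: "a \<le> Re z" "Re z \<le> b"
  shows "norm (f z) \<le> 1"
proof -
  define X where "X = max \<bar>a\<bar> \<bar>b\<bar>"
  define M where "M = 17 * X ^ 4"
  have Re4: "Re (w ^ 4) \<ge> (Im w) ^ 4 / 2 - M" if "a \<le> Re w" "Re w \<le> b" for w
  proof -
    have "Re (w ^ 4) = (Re w) ^ 4 - 6 * (Re w)\<^sup>2 * (Im w)\<^sup>2 + (Im w) ^ 4"
      by (simp add: eval_nat_numeral algebra_simps)
    moreover have "0 \<le> ((Im w)\<^sup>2 - 6 * (Re w)\<^sup>2)\<^sup>2" by simp
    hence "6 * (Re w)\<^sup>2 * (Im w)\<^sup>2 \<le> (Im w) ^ 4 / 2 + 18 * (Re w) ^ 4"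
      by (simp add: eval_nat_numeral algebra_simps)
    moreover have "\<bar>Re w\<bar> \<le> X" using that by (auto simp: X_def)
    hence "\<bar>Re w\<bar> ^ 4 \<le> X ^ 4" by (intro power_mono) auto
    hence "(Re w) ^ 4 \<le> X ^ 4" by simp
    ultimately show ?thesis unfolding M_def by linarith
  qed
  have ineq: "norm (f z) \<le> exp (e * (M + Re (z ^ 4)))" if e: "e > 0" for e
  proof -
    define T where "T = max (max 1 \<bar>Im z\<bar>) (sqrt (4 * \<bar>C\<bar> / e))"
    have T: "T \<ge> 1" "T \<ge> \<bar>Im z\<bar>" "T\<^sup>2 \<ge> 4 * \<bar>C\<bar> / e"
    proof -
      have "4 * \<bar>C\<bar> / e = (sqrt (4 * \<bar>C\<bar> / e))\<^sup>2" using e by simp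
      also have "\<dots> \<le> T\<^sup>2" by (intro power_mono) (use e in \<open>auto simp: T_def\<close>)
      finally show "T\<^sup>2 \<ge> 4 * \<bar>C\<bar> / e" .
    qed (auto simp: T_def)
    define S where "S = cbox (Complex a (- T)) (Complex b T)"
    have S: "w \<in> S \<longleftrightarrow> a \<le> Re w \<and> Re w \<le> b \<and> - T \<le> Im w \<and> Im w \<le> T" for w
      by (auto simp: S_def in_cbox_complex_iff)
    define h where "h = (\<lambda>w. f w * exp (- of_real e * w ^ 4))"
    have nh: "norm (h w) = norm (f w) * exp (- e * Re (w ^ 4))" for w
      by (simp add: h_def norm_mult)
    have holh: "h holomorphic_on S"
      unfolding h_def by (intro holomorphic_intros holomorphic_on_subset[OF holf]) (auto simp: S)
    have "norm (h z) \<le> exp (e * M)"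
    proof (rule maximum_modulus_frontier[where S = S and f = h])
      show "h holomorphic_on interior S" by (rule holomorphic_on_subset[OF holh interior_subset])
      show "continuous_on (closure S) h" using holomorphic_on_imp_continuous_on[OF holh] by (simp add: S_def)
      show "bounded S" by (simp add: S_def)
      show "z \<in> S" using z T by (auto simp: S)
      fix w assume "w \<in> frontier S"
      hence wS: "w \<in> S" and "w \<notin> box (Complex a (- T)) (Complex b T)"
        by (auto simp: S_def frontier_def)
      hence w: "Re w = a \<or> Re w = b \<or> \<bar>Im w\<bar> = T" using S[of w] by (auto simp: in_box_complex_iff)
      have wS': "a \<le> Re w" "Re w \<le> b" using wS S by auto
      have re: "- e * Re (w ^ 4) \<le> e * M - e * ((Im w) ^ 4 / 2)"
        using mult_left_mono[OF Re4[OF wS'], of e] e by (simp add: algebra_simps)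
      show "norm (h w) \<le> exp (e * M)"
      proof (cases "\<bar>Im w\<bar> = T")
        case True
        hence im: "(Im w)\<^sup>2 = T\<^sup>2" by (metis power2_abs)
        hence "(Im w) ^ 4 = T\<^sup>2 * T\<^sup>2" by (metis (no_types) numeral_Bit0 power_add)
        have "C * (1 + T\<^sup>2) \<le> \<bar>C\<bar> * (2 * T\<^sup>2)"
          using T(1) by (intro mult_mono) (auto simp: one_le_power)
        also have "\<dots> \<le> e * (T\<^sup>2 * T\<^sup>2 / 2)"
        proof -
          have "4 * \<bar>C\<bar> \<le> e * T\<^sup>2" using T(3) e by (simp add: field_simps)
          hence "4 * \<bar>C\<bar> * T\<^sup>2 \<le> e * T\<^sup>2 * T\<^sup>2" by (intro mult_right_mono) auto
          moreover have "\<bar>C\<bar> * (2 * T\<^sup>2) = (4 * \<bar>C\<bar> * T\<^sup>2) / 2" "e * (T\<^sup>2 * T\<^sup>2 / 2) = (e * T\<^sup>2 * T\<^sup>2) / 2"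
            by simp_all
          ultimately show ?thesis by linarith
        qed
        finally have C: "C * (1 + T\<^sup>2) \<le> e * ((Im w) ^ 4 / 2)" using \<open>(Im w) ^ 4 = T\<^sup>2 * T\<^sup>2\<close> by simp
        have "norm (h w) \<le> exp (C * (1 + T\<^sup>2)) * exp (e * M - e * ((Im w) ^ 4 / 2))"
          unfolding nh using growth[OF wS'] re by (intro mult_mono) (auto simp: im)
        also have "\<dots> = exp (C * (1 + T\<^sup>2) + (e * M - e * ((Im w) ^ 4 / 2)))" by (rule exp_add [symmetric])
        also have "\<dots> \<le> exp (e * M)" using C by simp
        finally show ?thesis .
      next
        case False
        hence "norm (f w) \<le> 1" using bdry w by blast
        moreover have "e * ((Im w) ^ 4 / 2) \<ge> 0" using e by simp
        hence "- e * Re (w ^ 4) \<le> e * M" using re by linarith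
        ultimately have "norm (h w) \<le> 1 * exp (e * M)" unfolding nh by (intro mult_mono) auto
        thus ?thesis by simp
      qed
    qed
    hence "norm (f z) * exp (- e * Re (z ^ 4)) * exp (e * Re (z ^ 4)) \<le> exp (e * M) * exp (e * Re (z ^ 4))"
      unfolding nh by (intro mult_right_mono) auto
    thus ?thesis by (simp add: mult.assoc exp_add [symmetric] algebra_simps)
  qed
  have "((\<lambda>e. exp (e * (M + Re (z ^ 4)))) \<longlongrightarrow> exp (0 * (M + Re (z ^ 4)))) (at_right 0)"
    by (intro tendsto_intros)
  moreover have "eventually (\<lambda>e. norm (f z) \<le> exp (e * (M + Re (z ^ 4)))) (at_right 0)"
    using eventually_at_right_less[of 0] by eventually_elim (rule ineq)
  ultimately have "norm (f z) \<le> exp (0 * (M + Re (z ^ 4)))"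
    by (intro tendsto_lowerbound) auto
  thus ?thesis by simp
qed

text \<open>
The Borel-Caratheodory inequality for the logarithm of \<open>f / f c\<close>: an upper bound for its real
part on the disc bounds its modulus on a smaller disc. The proof applies the Schwarz lemma to \<open>L / (2 *
M - L)\<close>, which maps the disc into itself because \<open>Re L < M\<close>.
\<close>

lemma nonvanishing_lower_bound:
  fixes f :: "complex \<Rightarrow> complex"
  assumes holf: "f holomorphic_on ball c \<rho>" and nz: "\<And>z. z \<in> ball c \<rho> \<Longrightarrow> f z \<noteq> 0"
    and ub: "\<And>z. z \<in> ball c \<rho> \<Longrightarrow> norm (f z) < exp M * norm (f c)"
    and r: "0 \<le> r" "r < \<rho>" and z: "dist c z \<le> r"
  shows "norm (f z) \<ge> norm (f c) * exp (- (2 * M * r / (\<rho> - r)))"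
proof -
  have \<rho>: "\<rho> > 0" using r by simp
  have c: "c \<in> ball c \<rho>" using \<rho> by simp
  have M: "M > 0"
  proof -
    have "1 * norm (f c) < exp M * norm (f c)" using ub[OF c] by simp
    hence "1 < exp M" using nz[OF c] mult_less_cancel_right_pos[of "norm (f c)"] by (metis zero_less_norm_iff)
    thus ?thesis by simp
  qed
  obtain g where g: "g holomorphic_on ball c \<rho>" "\<And>z. z \<in> ball c \<rho> \<Longrightarrow> f z = exp (g z)"
    using contractible_imp_holomorphic_log[OF holf convex_imp_contractible[OF convex_ball] nz] by blast
  define L where "L = (\<lambda>w. g (c + of_real \<rho> * w) - g c)"
  have inb: "c + of_real \<rho> * w \<in> ball c \<rho>" if "norm w < 1" for w
    using that \<rho> by (simp add: dist_norm norm_mult)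
  have holL: "L holomorphic_on ball 0 1"
  proof -
    have "(\<lambda>w. g (c + of_real \<rho> * w)) holomorphic_on ball 0 1"
      using holomorphic_on_compose_gen[of "\<lambda>w. c + of_real \<rho> * w" "ball 0 1" g "ball c \<rho>"] g(1) inb
      by (force simp: o_def intro!: holomorphic_intros)
    thus ?thesis unfolding L_def by (intro holomorphic_intros)
  qed
  have fL: "f (c + of_real \<rho> * w) = f c * exp (L w)" if "norm w < 1" for w
    using g(2)[OF inb[OF that]] g(2)[OF c] by (simp add: L_def exp_add [symmetric])
  have ReL: "Re (L w) < M" if "norm w < 1" for w
  proof -
    have "norm (f c) * exp (Re (L w)) < norm (f c) * exp M"
      using ub[OF inb[OF that]] fL[OF that] by (simp add: norm_mult mult.commute)
    thus ?thesis using nz[OF c] by simp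
  qed
  define \<phi> where "\<phi> = (\<lambda>w. L w / (2 * of_real M - L w))"
  have den: "2 * of_real M - L w \<noteq> 0" if "norm w < 1" for w
  proof
    assume "2 * of_real M - L w = 0"
    hence "Re (L w) = 2 * M" by (simp add: complex_eq_iff)
    thus False using ReL[OF that] M by simp
  qed
  define w where "w = (z - c) / of_real \<rho>"
  have nw: "norm w \<le> r / \<rho>" using z \<rho> by (simp add: w_def norm_divide divide_right_mono dist_norm norm_minus_commute)
  also have "r / \<rho> < 1" using r \<rho> by simp
  finally have w1: "norm w < 1" .
  have "norm (\<phi> w) \<le> norm w"
  proof (rule Schwarz_Lemma(1))
    show "\<phi> holomorphic_on ball 0 1"
      unfolding \<phi>_def by (intro holomorphic_intros holL) (use den in auto)
    show "\<phi> 0 = 0" by (simp add: \<phi>_def L_def)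
    fix v :: complex assume v: "norm v < 1"
    have "norm (L v) < norm (2 * of_real M - L v)"
    proof (rule power2_less_imp_less)
      have "4 * (M * Re (L v)) < 4 * (M * M)" using ReL[OF v] M by simp
      thus "(norm (L v))\<^sup>2 < (norm (2 * of_real M - L v))\<^sup>2"
        unfolding cmod_power2 by (simp add: power2_eq_square algebra_simps)
    qed auto
    thus "norm (\<phi> v) < 1" by (simp add: \<phi>_def norm_divide divide_simps)
  qed (fact w1)
  hence "norm (L w) / norm (2 * of_real M - L w) \<le> r / \<rho>" using nw by (simp add: \<phi>_def norm_divide)
  hence "norm (L w) \<le> r / \<rho> * norm (2 * of_real M - L w)" using den[OF w1] by (simp add: field_simps)
  also have "\<dots> \<le> r / \<rho> * (2 * M + norm (L w))"
    using norm_triangle_ineq4[of "2 * of_real M" "L w"] M r \<rho> by (intro mult_left_mono) (auto simp: norm_mult)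
  finally have "norm (L w) * (\<rho> - r) \<le> 2 * M * r" using \<rho> by (simp add: field_simps)
  hence "norm (L w) \<le> 2 * M * r / (\<rho> - r)" using r by (simp add: field_simps)
  hence "- (2 * M * r / (\<rho> - r)) \<le> Re (L w)" using abs_Re_le_cmod[of "L w"] by linarith
  hence "norm (f c) * exp (- (2 * M * r / (\<rho> - r))) \<le> norm (f c) * exp (Re (L w))" by (intro mult_left_mono) auto
  also have "\<dots> = norm (f z)" using fL[OF w1] \<rho> by (simp add: w_def norm_mult)
  finally show ?thesis .
qed

section \<open>Horizontal monotonicity of the modulus of xi\<close>

lemma sum_inverse_squares_le: "summable (\<lambda>n. real (Suc n) powr (-2))" "(\<Sum>n. real (Suc n) powr (-2)) \<le> 3"
proof -
  have eq: "real (Suc n) powr (-2) = 1 / (real n + 1)\<^sup>2" for n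
    by (simp add: powr_minus powr_numeral divide_inverse add.commute)
  have S: "summable (\<lambda>n. 1 / (real n + 1)\<^sup>2)" "(\<Sum>n. 1 / (real n + 1)\<^sup>2) = pi\<^sup>2 / 6"
    using inverse_squares_sums by (simp_all add: sums_iff add.commute)
  show "summable (\<lambda>n. real (Suc n) powr (-2))" unfolding eq by (rule S)
  have "pi\<^sup>2 \<le> 4\<^sup>2" by (intro power_mono) (use pi_less_4 in auto)
  thus "(\<Sum>n. real (Suc n) powr (-2)) \<le> 3" unfolding eq S by simp
qed

lemma norm_zeta_series_le:
  assumes "Re s \<ge> 2"
  shows "norm (zeta_series s) \<le> 3"
proof -
  have le: "norm (1 / of_nat (Suc n) powr s :: complex) \<le> real (Suc n) powr (-2)" for n
    unfolding norm_zeta_series_term using assms by (intro powr_mono) auto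
  have "norm (zeta_series s) \<le> (\<Sum>n. real (Suc n) powr (-2))"
    unfolding zeta_series_def by (rule norm_suminf_le[OF le sum_inverse_squares_le(1)])
  also note sum_inverse_squares_le(2)
  finally show ?thesis .
qed

text \<open>
Far to the right the first term of the Dirichlet series dominates the rest.
\<close>

lemma norm_zeta_series_ge:
  assumes "Re s \<ge> 4"
  shows "norm (zeta_series s) \<ge> 1 / 4"
proof -
  define a where "a = (\<lambda>n. 1 / of_nat (Suc n) powr s :: complex)"
  have le: "norm (a (Suc n)) \<le> 1/4 * real (Suc n) powr (-2)" for n
  proof -
    have "norm (a (Suc n)) \<le> real (Suc (Suc n)) powr (-4)"
      unfolding a_def norm_zeta_series_term using assms by (intro powr_mono) auto
    also have "\<dots> = real (Suc (Suc n)) powr (-2) * real (Suc (Suc n)) powr (-2)" by (simp add: powr_add [symmetric])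
    also have "\<dots> \<le> 2 powr (-2) * real (Suc n) powr (-2)" 
      by (intro mult_mono powr_mono2') auto
    also have "(2::real) powr (-2) = 1/4" by (simp add: powr_minus)
    finally show ?thesis .
  qed
  have sm: "summable (\<lambda>n. 1/4 * real (Suc n) powr (-2))" by (intro summable_mult sum_inverse_squares_le)
  have sa: "summable (\<lambda>n. a (Suc n))" by (rule summable_comparison_test[OF _ sm]) (use le in auto)
  hence "zeta_series s = a 0 + (\<Sum>n. a (Suc n))"
    unfolding zeta_series_def a_def [symmetric] by (subst suminf_split_head) (auto simp: summable_Suc_iff)
  hence "zeta_series s = 1 + (\<Sum>n. a (Suc n))" by (simp add: a_def)
  moreover have "norm (\<Sum>n. a (Suc n)) \<le> 3/4"
  proof -
    have "norm (\<Sum>n. a (Suc n)) \<le> (\<Sum>n. 1/4 * real (Suc n) powr (-2))" by (rule norm_suminf_le[OF le sm])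
    also have "\<dots> = 1/4 * (\<Sum>n. real (Suc n) powr (-2))" by (rule suminf_mult[OF sum_inverse_squares_le(1)])
    also have "\<dots> \<le> 1/4 * 3" by (intro mult_left_mono sum_inverse_squares_le(2)) auto
    finally show ?thesis by simp
  qed
  ultimately show ?thesis using norm_diff_ineq[of 1 "\<Sum>n. a (Suc n)"] by simp
qed

lemma norm_xi_entire:
  assumes "Re s > 1"
  shows "norm (xi_entire s) = 1 / 2 * norm s * norm (s - 1) * pi powr (- (Re s / 2)) * norm (Gamma (s / 2)) * norm (zeta_series s)"
proof -
  have "s / 2 \<notin> \<int>\<^sub>\<le>\<^sub>0"
  proof
    assume "s / 2 \<in> \<int>\<^sub>\<le>\<^sub>0"
    then obtain n where "s / 2 = - of_nat n" by (elim nonpos_Ints_cases')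
    hence "Re (s / 2) \<le> 0" by simp
    thus False using assms by simp
  qed
  moreover have "s \<noteq> 1" using assms by auto
  ultimately have eq: "xi_entire s = 1 / 2 * s * (s - 1) * of_real pi powr (- s / 2) * Gamma (s / 2) * zeta_series s"
    using xi_formula_eq_xi_entire[of s] assms by (simp add: zeta_eq_zeta_continuation zeta_continuation_eq_series)
  have pow: "norm (complex_of_real pi powr (- s / 2)) = pi powr (- (Re s / 2))"
    using norm_powr_real_powr[of "of_real pi" "- s / 2"] by simp
  show ?thesis unfolding eq norm_mult pow by simp
qed

text \<open>
Far to the right the Gamma quotient decays like a negative power of the real part, uniformly in the imaginary
part, while the powers of \<open>\<pi>\<close> and the two zeta values contribute only a constant factor.
\<close>

lemma xi_entire_shift_le_far:
  assumes \<delta>: "0 < \<delta>" "\<delta> \<le> 1"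
  obtains K where "K \<ge> 10" "\<And>z. Re z \<ge> K \<Longrightarrow> norm (xi_entire (z - of_real \<delta>)) \<le> norm (xi_entire z)"
proof -
  define \<eta> where "\<eta> = \<delta> / 2"
  have \<eta>: "0 < \<eta>" "\<eta> \<le> 1/2" using \<delta> by (auto simp: \<eta>_def)
  \<comment> \<open>The 12 is the upper bound 3 for the shifted zeta value divided by the lower bound 1/4 for the other.\<close>
  define Y0 where "Y0 = pi * 12 powr (1 / \<eta>)"
  have Y0: "Y0 > 0" by (simp add: Y0_def)
  define K where "K = max 10 (2 * (Y0 + \<eta> + 1))"
  have "norm (xi_entire (z - of_real \<delta>)) \<le> norm (xi_entire z)" if z: "Re z \<ge> K" for z
  proof -
    define x where "x = Re z"
    define Y where "Y = x / 2 - \<eta> - 1"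
    have x: "x \<ge> 10" "Y \<ge> Y0" using z by (auto simp: x_def Y_def K_def field_simps)
    have "norm (Gamma (z / 2 - of_real \<eta>)) * Gamma (x / 2) \<le> norm (Gamma (z / 2)) * Gamma (x / 2 - \<eta>)"
      using norm_Gamma_shift_le[of \<eta> "z / 2"] \<eta> x by (simp add: x_def)
    also have "\<dots> \<le> norm (Gamma (z / 2)) * (Gamma (x / 2) * Y powr (- \<eta>))"
      using Gamma_real_shift_le[of \<eta> "x / 2"] \<eta> x by (intro mult_left_mono) (auto simp: Y_def)
    finally have "norm (Gamma (z / 2 - of_real \<eta>)) * Gamma (x / 2) \<le> (norm (Gamma (z / 2)) * Y powr (- \<eta>)) * Gamma (x / 2)"
      by (simp add: mult_ac)
    hence G: "norm (Gamma (z / 2 - of_real \<eta>)) \<le> norm (Gamma (z / 2)) * Y powr (- \<eta>)"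
      by (rule mult_right_le_imp_le) (use x in \<open>auto intro: Gamma_real_pos\<close>)
    have Ypow: "pi powr \<eta> * Y powr (- \<eta>) \<le> 1 / 12"
    proof -
      have "Y powr (- \<eta>) \<le> Y0 powr (- \<eta>)" by (rule powr_mono2') (use x Y0 \<eta> in auto)
      also have "\<dots> = pi powr (- \<eta>) * (12 powr (1 / \<eta>)) powr (- \<eta>)" by (simp add: Y0_def powr_mult)
      also have "(12 powr (1 / \<eta>)) powr (- \<eta>) = (1 / 12 :: real)" using \<eta> by (simp add: powr_powr powr_minus)
      finally have "pi powr \<eta> * Y powr (- \<eta>) \<le> pi powr \<eta> * (pi powr (- \<eta>) * (1 / 12))" by (intro mult_left_mono) auto
      also have "\<dots> = (pi powr \<eta> * pi powr (- \<eta>)) * (1 / 12)" by simp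
      also have "pi powr \<eta> * pi powr (- \<eta>) = 1" by (simp add: powr_minus)
      finally show ?thesis by simp
    qed
    have n1: "norm (z - of_real \<delta>) \<le> norm z" if "Re z \<ge> 1" for z
    proof -
      have "(Re z - \<delta>)\<^sup>2 \<le> (Re z)\<^sup>2" using that \<delta> by (intro power_mono) auto
      thus ?thesis by (simp add: cmod_def)
    qed
    have n: "norm (z - of_real \<delta>) \<le> norm z" "norm (z - of_real \<delta> - 1) \<le> norm (z - 1)"
      using n1[of z] n1[of "z - 1"] x by (auto simp: x_def algebra_simps)
    have pow: "pi powr (- (Re (z - of_real \<delta>) / 2)) = pi powr (- (x / 2)) * pi powr \<eta>"
    proof -
      have "- (Re (z - of_real \<delta>) / 2) = - (x / 2) + \<eta>" by (simp add: x_def \<eta>_def field_simps)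
      thus ?thesis by (simp only: powr_add)
    qed
    have half: "(z - of_real \<delta>) / 2 = z / 2 - of_real \<eta>" by (simp add: \<eta>_def field_simps)
    have "norm (xi_entire (z - of_real \<delta>)) = 1 / 2 * norm (z - of_real \<delta>) * norm (z - of_real \<delta> - 1) * (pi powr (- (x / 2)) * pi powr \<eta>) *
        norm (Gamma (z / 2 - of_real \<eta>)) * norm (zeta_series (z - of_real \<delta>))"
      using norm_xi_entire[of "z - of_real \<delta>"] x \<delta> unfolding pow half by (simp add: x_def)
    also have "\<dots> \<le> 1 / 2 * norm z * norm (z - 1) * (pi powr (- (x / 2)) * pi powr \<eta>) * (norm (Gamma (z / 2)) * Y powr (- \<eta>)) * 3"
      using n G norm_zeta_series_le[of "z - of_real \<delta>"] x \<delta>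
      by (intro mult_mono mult_nonneg_nonneg) (auto simp: x_def)
    also have "\<dots> = 1 / 2 * norm z * norm (z - 1) * pi powr (- (x / 2)) * norm (Gamma (z / 2)) * (3 * (pi powr \<eta> * Y powr (- \<eta>)))"
      by (simp add: mult_ac)
    also have "\<dots> \<le> 1 / 2 * norm z * norm (z - 1) * pi powr (- (x / 2)) * norm (Gamma (z / 2)) * norm (zeta_series z)"
      using norm_zeta_series_ge[of z] Ypow x by (intro mult_left_mono mult_nonneg_nonneg) (auto simp: x_def)
    also have "\<dots> = norm (xi_entire z)" using norm_xi_entire[of z] x by (simp add: x_def)
    finally show ?thesis .
  qed
  thus ?thesis by (intro that[of K]) (auto simp: K_def)
qed

lemma power2_add_le: "(a + b)\<^sup>2 \<le> 2 * a\<^sup>2 + 2 * (b::real)\<^sup>2"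
  using zero_le_power2[of "a - b"] by (simp add: power2_eq_square algebra_simps)

text \<open>
A zero-free half-plane forces a lower bound on xi in a closed strip inside it: around a centre
\<open>c\<close> at the same height with \<open>Re c = K\<close>, where the factors of its defining formula
bound xi from below, the disc reaching to the critical line contains the part of the strip at that height well
inside, and \<open>nonvanishing_lower_bound\<close> applies.
\<close>

lemma xi_entire_lower_bound:
  assumes nz: "\<And>z. Re z > 1/2 \<Longrightarrow> xi_entire z \<noteq> 0"
    and s: "1/2 < s" "s \<le> K" and K: "K \<ge> 4"
  obtains C where "C \<ge> 0" "\<And>z. s \<le> Re z \<Longrightarrow> Re z \<le> K \<Longrightarrow> norm (xi_entire z) \<ge> exp (- (C * (1 + (Im z)\<^sup>2)))"
proof -
  define \<kappa> where "\<kappa> = pi powr (- (K / 2)) * Gamma (K / 2) / 4"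
  have \<kappa>: "\<kappa> > 0" using K by (auto simp: \<kappa>_def intro!: Gamma_real_pos mult_pos_pos)
  define \<rho> where "\<rho> = K - 1/2"
  define r where "r = K - s"
  define Q where "Q = 2 * r / (\<rho> - r)"
  have r: "0 \<le> r" "r < \<rho>" using s by (auto simp: r_def \<rho>_def)
  have Q: "Q \<ge> 0" using r by (simp add: Q_def)
  define A where "A = 8 * (1 + 2 * K)\<^sup>2 + 1 + \<bar>ln \<kappa>\<bar>"
  have A: "A \<ge> 0" by (simp add: A_def)
  define C where "C = \<bar>ln \<kappa>\<bar> + 1/4 + Q * A + 9 * Q"
  have "norm (xi_entire z) \<ge> exp (- (C * (1 + (Im z)\<^sup>2)))" if z: "s \<le> Re z" "Re z \<le> K" for z
  proof -
    define y where "y = Im z"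
    define c where "c = Complex K y"
    have c_lower: "norm (xi_entire c) \<ge> \<kappa> * exp (- y\<^sup>2 / 4)"
    proof -
      have "norm c \<ge> 4" "norm (c - 1) \<ge> 1" 
        using complex_Re_le_cmod[of c] complex_Re_le_cmod[of "c - 1"] K by (auto simp: c_def)
      hence "4 * 1 \<le> norm c * norm (c - 1)" by (intro mult_mono) auto
      hence 1: "1 \<le> 1 / 2 * norm c * norm (c - 1)" by simp
      have 2: "Gamma (K / 2) * exp (- y\<^sup>2 / 4) \<le> norm (Gamma (c / 2))"
        using norm_Gamma_ge[of "c / 2"] K by (simp add: c_def power_divide)
      have 3: "1/4 \<le> norm (zeta_series c)" by (rule norm_zeta_series_ge) (use K in \<open>simp add: c_def\<close>)
      have "1 * pi powr (- (K / 2)) * (Gamma (K / 2) * exp (- y\<^sup>2 / 4)) * (1/4) \<le>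
         1 / 2 * norm c * norm (c - 1) * pi powr (- (K / 2)) * norm (Gamma (c / 2)) * norm (zeta_series c)"
        using K Gamma_real_pos[of "K / 2"] by (intro mult_mono 1 2 3 mult_nonneg_nonneg) auto
      also have "\<dots> = norm (xi_entire c)" using norm_xi_entire[of c] K by (simp add: c_def)
      finally show ?thesis by (simp add: \<kappa>_def mult_ac)
    qed
    define M where "M = A + 9 * y\<^sup>2"
    have expM: "exp (8 * (1 + 2 * K)\<^sup>2 + 8 * y\<^sup>2) < exp M * norm (xi_entire c)"
    proof -
      have "exp (8 * (1 + 2 * K)\<^sup>2 + 8 * y\<^sup>2) < exp (M + (ln \<kappa> + - y\<^sup>2 / 4))"
        unfolding exp_less_cancel_iff M_def A_def using zero_le_power2[of y] by linarith
      also have "\<dots> = exp M * (\<kappa> * exp (- y\<^sup>2 / 4))" using \<kappa> by (simp only: exp_add exp_ln)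
      also have "\<dots> \<le> exp M * norm (xi_entire c)" by (intro mult_left_mono c_lower) auto
      finally show ?thesis .
    qed
    have "norm (xi_entire z) \<ge> norm (xi_entire c) * exp (- (2 * M * r / (\<rho> - r)))"
    proof (rule nonvanishing_lower_bound[where f = xi_entire and M = M])
      show "xi_entire holomorphic_on ball c \<rho>" by (rule xi_entire_holomorphic)
      show "dist c z \<le> r"
      proof -
        have "c - z = of_real (K - Re z)" by (simp add: c_def y_def complex_eq_iff)
        hence "dist c z = K - Re z" using z by (simp only: dist_norm norm_of_real)
        thus ?thesis using z by (simp add: r_def)
      qed
      fix w assume w: "w \<in> ball c \<rho>"
      hence wd: "norm (c - w) < \<rho>" by (simp add: dist_norm)
      have "Re w > 1/2" using complex_Re_le_cmod[of "c - w"] wd by (simp add: c_def \<rho>_def)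
      thus "xi_entire w \<noteq> 0" by (rule nz)
      have "norm c \<le> K + \<bar>y\<bar>" using cmod_le[of c] K by (simp add: c_def)
      moreover have "norm w \<le> norm c + norm (c - w)" using norm_triangle_ineq4[of c "c - w"] by simp
      ultimately have "1 + norm w \<le> (1 + 2 * K) + \<bar>y\<bar>" using wd by (simp add: \<rho>_def)
      hence "(1 + norm w)\<^sup>2 \<le> ((1 + 2 * K) + \<bar>y\<bar>)\<^sup>2" by (intro power_mono) auto
      also have "\<dots> \<le> 2 * (1 + 2 * K)\<^sup>2 + 2 * \<bar>y\<bar>\<^sup>2" by (rule power2_add_le)
      finally have "4 * (1 + norm w)\<^sup>2 \<le> 8 * (1 + 2 * K)\<^sup>2 + 8 * y\<^sup>2" by simp
      hence "exp (4 * (1 + norm w)\<^sup>2) \<le> exp (8 * (1 + 2 * K)\<^sup>2 + 8 * y\<^sup>2)" by simp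
      with xi_entire_growth[of w] expM show "norm (xi_entire w) < exp M * norm (xi_entire c)" by linarith
    qed (use r in auto)
    moreover have "norm (xi_entire c) * exp (- (2 * M * r / (\<rho> - r))) \<ge> \<kappa> * exp (- y\<^sup>2 / 4) * exp (- (Q * M))"
      using c_lower by (intro mult_mono) (auto simp: Q_def mult_ac)
    moreover have "\<kappa> * exp (- y\<^sup>2 / 4) * exp (- (Q * M)) = exp (ln \<kappa> + - y\<^sup>2 / 4 + - (Q * M))"
      using \<kappa> by (simp only: exp_add exp_ln)
    moreover have "exp (- (C * (1 + y\<^sup>2))) \<le> exp (ln \<kappa> + - y\<^sup>2 / 4 + - (Q * M))"
    proof -
      have "0 \<le> \<bar>ln \<kappa>\<bar> * y\<^sup>2" "0 \<le> Q * A * y\<^sup>2" using Q A by auto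
      moreover have "C * (1 + y\<^sup>2) = \<bar>ln \<kappa>\<bar> + 1/4 + Q * A + 9 * Q + (\<bar>ln \<kappa>\<bar> * y\<^sup>2 + y\<^sup>2 / 4 + Q * A * y\<^sup>2 + 9 * (Q * y\<^sup>2))"
        by (simp add: C_def algebra_simps)
      moreover have "Q * M = Q * A + 9 * (Q * y\<^sup>2)" by (simp add: M_def algebra_simps)
      moreover have "- \<bar>ln \<kappa>\<bar> \<le> ln \<kappa>" by simp
      ultimately show ?thesis using Q unfolding exp_le_cancel_iff by linarith
    qed
    ultimately show ?thesis unfolding y_def by linarith
  qed
  moreover have "C \<ge> 0" using Q A by (simp add: C_def)
  ultimately show ?thesis using that by blast
qed

text \<open>
The quotient \<open>G\<close> of the two sides is holomorphic in the strip between \<open>Re z = (1 +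
\<delta>) / 2\<close> and \<open>Re z = K\<close>. On the left edge it has modulus 1, because the points
\<open>z\<close> and \<open>z - \<delta>\<close> are mirror images in the critical line; on the right edge its
modulus is at most 1 by the estimate far to the right. The lower bound for xi gives the growth condition of
the maximum principle in strips.
\<close>

theorem xi_entire_shift_le:
  assumes nz: "\<And>z. Re z > 1/2 \<Longrightarrow> xi_entire z \<noteq> 0"
    and \<delta>: "0 < \<delta>" "\<delta> \<le> 1" and z: "Re z \<ge> (1 + \<delta>) / 2"
  shows "norm (xi_entire (z - of_real \<delta>)) \<le> norm (xi_entire z)"
proof -
  obtain K where K: "K \<ge> 10" "\<And>z. Re z \<ge> K \<Longrightarrow> norm (xi_entire (z - of_real \<delta>)) \<le> norm (xi_entire z)"
    using xi_entire_shift_le_far[OF \<delta>] by blast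
  define s where "s = (1 + \<delta>) / 2"
  have s: "1/2 < s" "s \<le> K" using \<delta> K by (auto simp: s_def)
  obtain C where C: "C \<ge> 0" "\<And>z. s \<le> Re z \<Longrightarrow> Re z \<le> K \<Longrightarrow> norm (xi_entire z) \<ge> exp (- (C * (1 + (Im z)\<^sup>2)))"
    using xi_entire_lower_bound[OF nz s] K(1) by auto
  define G where "G = (\<lambda>z. xi_entire (z - of_real \<delta>) / xi_entire z)"
  have G1: "norm (xi_entire (z - of_real \<delta>)) \<le> norm (xi_entire z) \<longleftrightarrow> norm (G z) \<le> 1" if "Re z \<ge> s" for z
    using nz[of z] that s by (simp add: G_def norm_divide)
  show ?thesis
  proof (cases "Re z \<ge> K")
    case False
    have "norm (G z) \<le> 1"
    proof (rule strip_Phragmen_Lindelof[where a = s and b = K and f = G])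
      have "(\<lambda>z. xi_entire (z - of_real \<delta>)) holomorphic_on S" for S
        using holomorphic_on_compose_gen[OF _ xi_entire_holomorphic[of UNIV], of "\<lambda>z. z - of_real \<delta>" S]
        by (simp add: o_def holomorphic_intros)
      thus "G holomorphic_on {z. s \<le> Re z \<and> Re z \<le> K}"
        unfolding G_def using nz s by (intro holomorphic_on_divide xi_entire_holomorphic) auto
      show "norm (G w) \<le> 1" if "Re w = s \<or> Re w = K" for w
      proof (cases "Re w = K")
        case True
        thus ?thesis using K(2)[of w] G1[of w] s by auto
      next
        case False
        hence w: "Re w = s" using that by simp
        \<comment> \<open>This is where the position of the left edge is used.\<close>
        have "1 - cnj (w - of_real \<delta>) = w" using w by (simp add: complex_eq_iff s_def)
        hence "xi_entire w = cnj (xi_entire (w - of_real \<delta>))"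
          by (metis xi_entire_reflect xi_entire_cnj)
        thus ?thesis using G1[of w] w by simp
      qed
      fix w assume w: "s \<le> Re w" "Re w \<le> K"
      define D where "D = 8 * (2 + K)\<^sup>2 + 8 + C"
      have "norm (w - of_real \<delta>) \<le> norm w + \<delta>" using norm_triangle_ineq4[of w "of_real \<delta>"] \<delta> by simp
      also have "norm w \<le> K + \<bar>Im w\<bar>" using cmod_le[of w] w s by simp
      finally have "1 + norm (w - of_real \<delta>) \<le> (2 + K) + \<bar>Im w\<bar>" using \<delta> by simp
      hence "(1 + norm (w - of_real \<delta>))\<^sup>2 \<le> ((2 + K) + \<bar>Im w\<bar>)\<^sup>2" by (intro power_mono) auto
      also have "\<dots> \<le> 2 * (2 + K)\<^sup>2 + 2 * \<bar>Im w\<bar>\<^sup>2" by (rule power2_add_le)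
      finally have "4 * (1 + norm (w - of_real \<delta>))\<^sup>2 \<le> 8 * (2 + K)\<^sup>2 + 8 * (Im w)\<^sup>2" by simp
      hence up: "norm (xi_entire (w - of_real \<delta>)) \<le> exp (8 * (2 + K)\<^sup>2 + 8 * (Im w)\<^sup>2)"
        using xi_entire_growth[of "w - of_real \<delta>"] by (smt (verit) exp_le_cancel_iff)
      have "norm (G w) \<le> exp (8 * (2 + K)\<^sup>2 + 8 * (Im w)\<^sup>2) / exp (- (C * (1 + (Im w)\<^sup>2)))"
        unfolding G_def norm_divide using up C(2)[OF w] by (intro frac_le) auto
      also have "\<dots> = exp (8 * (2 + K)\<^sup>2 + 8 * (Im w)\<^sup>2 - - (C * (1 + (Im w)\<^sup>2)))" by (rule exp_diff [symmetric])
      also have "\<dots> \<le> exp (D * (1 + (Im w)\<^sup>2))"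
        unfolding exp_le_cancel_iff D_def by (simp add: algebra_simps)
      finally show "norm (G w) \<le> exp (D * (1 + (Im w)\<^sup>2))" .
    qed (use z False in \<open>auto simp: s_def\<close>)
    thus ?thesis using G1 z by (simp add: s_def)
  qed (use K in auto)
qed

text \<open>
The real part of the logarithmic derivative is the horizontal derivative of \<open>ln \<bar>xi\<bar>\<close>,
so this is the infinitesimal form of the previous theorem.
\<close>

theorem Re_logderiv_xi_entire_nonneg:
  assumes nz: "\<And>z. Re z > 1/2 \<Longrightarrow> xi_entire z \<noteq> 0" and z: "Re z > 1/2"
  shows "Re (deriv xi_entire z / xi_entire z) \<ge> 0"
proof (rule ccontr)
  assume neg: "\<not> ?thesis"
  have nz': "xi_entire z \<noteq> 0" using nz z by simp
  have D: "(xi_entire has_field_derivative deriv xi_entire z) (at z)"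
    using xi_entire_holomorphic[of UNIV] by (simp add: holomorphic_derivI)
  define d where "d = deriv xi_entire z / xi_entire z"
  have D1: "((\<lambda>t::real. xi_entire (z - of_real t) / xi_entire z) has_vector_derivative - d) (at 0)"
  proof -
    have "((\<lambda>w. xi_entire (z - w) / xi_entire z) has_field_derivative (deriv xi_entire z * (0 - 1)) / xi_entire z) (at (of_real 0))"
      by (intro DERIV_cdivide DERIV_chain2[where f = xi_entire] derivative_intros) (use D in simp)
    from has_vector_derivative_real_field[OF this] show ?thesis by (simp add: d_def)
  qed
  have Re1: "((\<lambda>t. Re (xi_entire (z - of_real t) / xi_entire z)) has_real_derivative - Re d) (at 0)"
    using bounded_linear.has_vector_derivative[OF bounded_linear_Re D1] by (simp add: has_real_derivative_iff_has_vector_derivative)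
  obtain e where e: "e > 0" "\<And>t. 0 < t \<Longrightarrow> t < e \<Longrightarrow> Re (xi_entire (z - of_real (0::real)) / xi_entire z) < Re (xi_entire (z - of_real (0 + t)) / xi_entire z)"
    using DERIV_pos_inc_right[OF Re1] neg by (auto simp: d_def)
  define t where "t = min (e / 2) (min 1 (2 * Re z - 1))"
  have t: "0 < t" "t < e" "t \<le> 1" "Re z \<ge> (1 + t) / 2" using e(1) z by (auto simp: t_def min_def)
  have "norm (xi_entire (z - of_real t)) \<le> norm (xi_entire z)"
    by (rule xi_entire_shift_le[OF nz]) (use t in auto)
  hence "norm (xi_entire (z - of_real t) / xi_entire z) \<le> 1" using nz' by (simp add: norm_divide)
  hence "Re (xi_entire (z - of_real t) / xi_entire z) \<le> 1" using complex_Re_le_cmod order_trans by blast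
  thus False using e(2)[of t] t nz' by simp
qed

section \<open>Li coefficients as Taylor coefficients on the unit disc\<close>

text \<open>
With \<open>U = X / (X + c)\<close>, the summand \<open>(X + c) ^ (n - 1) * U ^ m\<close> is, for \<open>m <
n\<close>, the polynomial \<open>X ^ m * (X + c) ^ (n - 1 - m)\<close> of degree \<open>n - 1\<close>, and for
\<open>m > n\<close> it vanishes to order \<open>m\<close>. So only \<open>m = n\<close> contributes to the
coefficient of \<open>X ^ n\<close>. This is the reason for the weight \<open>(z - a) ^ (n - 1)\<close> in the
Li coefficients.
\<close>

lemma fps_nth_mult_compose_Moebius:
  fixes \<Phi> :: "complex fps"
  assumes c: "c \<noteq> 0" and n: "n \<ge> 1"
  shows "fps_nth ((fps_X + fps_const c) ^ (n - 1) * (\<Phi> oo (fps_X * inverse (fps_X + fps_const c)))) n = fps_nth \<Phi> n / c"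
proof -
  define P where "P = fps_X + fps_const c"
  define U where "U = fps_X * inverse P"
  have P0: "fps_nth P 0 = c" by (simp add: P_def)
  have inv: "P * inverse P = 1" using c P0 by (simp add: inverse_mult_eq_1')
  have Um: "U ^ m = fps_X ^ m * inverse P ^ m" for m by (simp add: U_def power_mult_distrib)
  have U0: "fps_nth (U ^ m) k = 0" if "k < m" for m k
    using that by (simp add: Um fps_X_power_mult_nth)
  have PU: "fps_nth (P ^ (n - 1) * U ^ m) n = (if m = n then 1 / c else 0)" if "m \<le> n" for m
  proof (cases "m = n")
    case True
    have "P ^ (n - 1) * U ^ m = fps_X ^ n * (P ^ (n - 1) * inverse P ^ n)" using True by (simp add: Um mult_ac)
    also have "inverse P ^ n = inverse P ^ (n - 1) * inverse P" using n by (metis power_minus_mult less_le_trans zero_less_one)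
    also have "P ^ (n - 1) * (inverse P ^ (n - 1) * inverse P) = inverse P"
      by (simp add: mult.assoc [symmetric] power_mult_distrib [symmetric] inv)
    finally show ?thesis using True P0 by (simp add: fps_X_power_mult_nth divide_inverse)
  next
    case False
    hence m: "m \<le> n - 1" using that by simp
    hence "n - 1 = (n - 1 - m) + m" by simp
    hence "P ^ (n - 1) = P ^ (n - 1 - m) * P ^ m" by (metis power_add)
    hence "P ^ (n - 1) * U ^ m = fps_X ^ m * (P ^ (n - 1 - m) * (P * inverse P) ^ m)"
      by (simp add: Um power_mult_distrib mult_ac)
    moreover have "P ^ k = fps_of_poly ([:c, 1:] ^ k)" for k
      by (simp add: fps_of_poly_power fps_of_poly_linear P_def)
    ultimately have eq: "P ^ (n - 1) * U ^ m = fps_X ^ m * fps_of_poly ([:c, 1:] ^ (n - 1 - m))"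
      by (simp only: inv power_one mult_1_right)
    have "degree ([:c, 1:] ^ (n - 1 - m)) < n - m"
    proof -
      have "degree ([:c, 1:] ^ (n - 1 - m)) \<le> degree [:c, 1:] * (n - 1 - m)" by (rule degree_power_le)
      thus ?thesis using m n by simp
    qed
    hence "coeff ([:c, 1:] ^ (n - 1 - m)) (n - m) = 0" by (rule coeff_eq_0)
    thus ?thesis using False m unfolding eq by (simp add: fps_X_power_mult_nth)
  qed
  have "fps_nth (P ^ (n - 1) * (\<Phi> oo U)) n = (\<Sum>i=0..n. fps_nth (P ^ (n - 1)) i * (\<Sum>m=0..n-i. fps_nth \<Phi> m * fps_nth (U ^ m) (n - i)))"
    by (simp only: fps_mult_nth fps_compose_nth)
  also have "\<dots> = (\<Sum>i=0..n. fps_nth (P ^ (n - 1)) i * (\<Sum>m=0..n. fps_nth \<Phi> m * fps_nth (U ^ m) (n - i)))"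
    by (intro sum.cong refl arg_cong2[where f = "(*)"] sum.mono_neutral_left) (auto simp: U0)
  also have "\<dots> = (\<Sum>m=0..n. fps_nth \<Phi> m * fps_nth (P ^ (n - 1) * U ^ m) n)"
    unfolding fps_mult_nth[of "P ^ (n - 1)"] sum_distrib_left by (subst sum.swap) (simp add: mult_ac)
  also have "\<dots> = (\<Sum>m=0..n. if m = n then fps_nth \<Phi> m / c else 0)"
    by (intro sum.cong refl) (subst PU, auto)
  also have "\<dots> = fps_nth \<Phi> n / c" by simp
  finally show ?thesis by (simp add: P_def U_def)
qed

lemma higher_deriv_Li_substitution:
  fixes a b :: complex and g :: "complex \<Rightarrow> complex"
  assumes g: "(\<lambda>u. g ((b - a * u) / (1 - u))) has_fps_expansion \<Phi>" and ab: "a \<noteq> b" and n: "n \<ge> 1"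
  shows "(deriv ^^ n) (\<lambda>z. (z - a) ^ (n - 1) * g z) b = fact n * (fps_nth \<Phi> n / (b - a))"
proof -
  define c where "c = b - a"
  have c: "c \<noteq> 0" using ab by (simp add: c_def)
  define f where "f = (\<lambda>z. (z - a) ^ (n - 1) * g z)"
  define F where "F = (fps_X + fps_const c) ^ (n - 1) * (\<Phi> oo (fps_X * inverse (fps_X + fps_const c)))"
  have wc: "(\<lambda>w. w + c) has_fps_expansion fps_X + fps_const c"
    by (intro fps_expansion_intros)
  have "(\<lambda>w. w * inverse (w + c)) has_fps_expansion fps_X * inverse (fps_X + fps_const c)"
    by (intro has_fps_expansion_mult has_fps_expansion_fps_X has_fps_expansion_inverse wc) (use c in simp)
  from has_fps_expansion_compose[OF g this]
  have "((\<lambda>u. g ((b - a * u) / (1 - u))) \<circ> (\<lambda>w. w * inverse (w + c))) has_fps_expansion (\<Phi> oo (fps_X * inverse (fps_X + fps_const c)))"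
    by simp
  from has_fps_expansion_mult[OF has_fps_expansion_power[OF wc] this]
  have "(\<lambda>w. (w + c) ^ (n - 1) * ((\<lambda>u. g ((b - a * u) / (1 - u))) \<circ> (\<lambda>w. w * inverse (w + c))) w) has_fps_expansion F"
    by (simp only: F_def)
  note E = this
  have ev: "eventually (\<lambda>w. (w + c) ^ (n - 1) * ((\<lambda>u. g ((b - a * u) / (1 - u))) \<circ> (\<lambda>w. w * inverse (w + c))) w = f (b + w)) (nhds 0)"
  proof -
    have "eventually (\<lambda>w. w \<in> - {- c}) (nhds 0)" by (rule eventually_nhds_in_open) (use c in auto)
    thus ?thesis
    proof eventually_elim
      case (elim w)
      hence wc: "w + c \<noteq> 0" by (auto simp: add_eq_0_iff2)
      have "b - a * (w * inverse (w + c)) = (b + w) * (c / (w + c))" "1 - w * inverse (w + c) = c / (w + c)"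
        using wc by (simp_all add: field_simps c_def)
      hence eq: "(b - a * (w * inverse (w + c))) / (1 - w * inverse (w + c)) = b + w" using wc c by simp
      have "w + c = b + w - a" by (simp add: c_def)
      thus ?case unfolding o_def eq f_def by (simp only:)
    qed
  qed
  have "(\<lambda>w. f (b + w)) has_fps_expansion F"
    by (rule iffD1[OF has_fps_expansion_cong[OF ev refl] E])
  from fps_nth_fps_expansion[OF this, of n]
  have "(deriv ^^ n) (\<lambda>w. f (b + w)) 0 = fact n * fps_nth F n" by simp
  also have "(deriv ^^ n) (\<lambda>w. f (b + w)) 0 = (deriv ^^ n) f b"
    using higher_deriv_shift_0[of n f b] by (simp add: o_def)
  also have "fps_nth F n = fps_nth \<Phi> n / c" unfolding F_def by (rule fps_nth_mult_compose_Moebius[OF c n])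
  finally show ?thesis by (simp add: f_def c_def)
qed

text \<open>
The Moebius map that sends 0 to \<open>1 - a\<close> and \<open>\<infinity>\<close> to \<open>a\<close>.
Written around the critical line it shows that replacing \<open>a\<close> by \<open>1 - a\<close> amounts to
the reflection \<open>z \<mapsto> 1 - z\<close>, and that for \<open>a < 1/2\<close> the unit disc corresponds
to the half-plane right of that line.
\<close>

definition disc_to_plane :: "real \<Rightarrow> complex \<Rightarrow> complex" where
  "disc_to_plane a u = 1/2 + (1/2 - of_real a) * ((1 + u) / (1 - u))"

definition disc_log_xi :: "real \<Rightarrow> complex \<Rightarrow> complex" where
  "disc_log_xi a u = Ln (xi_entire (disc_to_plane a u))"

definition disc_logderiv_xi :: "real \<Rightarrow> complex \<Rightarrow> complex" where
  "disc_logderiv_xi a u = deriv xi_entire (disc_to_plane a u) / xi_entire (disc_to_plane a u)"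

lemma disc_to_plane_0: "disc_to_plane a 0 = of_real (1 - a)"
  by (simp add: disc_to_plane_def)

lemma disc_to_plane_altdef:
  assumes "u \<noteq> 1"
  shows "disc_to_plane a u = (of_real (1 - a) - of_real a * u) / (1 - u)"
proof -
  have "1 - u \<noteq> 0" using assms by simp
  thus ?thesis by (simp add: disc_to_plane_def field_simps)
qed

lemma disc_to_plane_has_derivative:
  assumes "u \<noteq> 1"
  shows "(disc_to_plane a has_field_derivative (of_real (1 - 2 * a) / (1 - u)\<^sup>2)) (at u)"
proof -
  have u: "1 - u \<noteq> 0" using assms by simp
  define k where "k = 1/2 - complex_of_real a"
  have "((\<lambda>u. 1/2 + k * ((1 + u) / (1 - u))) has_field_derivative
     (0 + k * (((0 + 1) * (1 - u) - (1 + u) * (0 - 1)) / ((1 - u) * (1 - u))))) (at u)"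
    by (intro DERIV_add DERIV_const DERIV_cmult DERIV_divide DERIV_diff DERIV_ident u)
  moreover have "0 + k * (((0 + 1) * (1 - u) - (1 + u) * (0 - 1)) / ((1 - u) * (1 - u))) = of_real (1 - 2 * a) / (1 - u)\<^sup>2"
    by (simp add: power2_eq_square k_def algebra_simps)
  ultimately show ?thesis unfolding disc_to_plane_def k_def by (simp only:)
qed

lemma disc_to_plane_holomorphic: "disc_to_plane a holomorphic_on - {1}"
  by (rule holomorphic_onI) (use disc_to_plane_has_derivative[of _ a] has_field_derivative_at_within field_differentiable_def in blast)

lemma disc_xi_holomorphic: "(\<lambda>u. xi_entire (disc_to_plane a u)) holomorphic_on - {1}"
  using holomorphic_on_compose_gen[OF disc_to_plane_holomorphic xi_entire_holomorphic[of UNIV]] by (simp add: o_def)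

lemma disc_logderiv_xi_holomorphic:
  assumes "A \<subseteq> - {1}" "\<And>u. u \<in> A \<Longrightarrow> xi_entire (disc_to_plane a u) \<noteq> 0"
  shows "disc_logderiv_xi a holomorphic_on A"
proof -
  have "deriv xi_entire holomorphic_on UNIV" by (rule holomorphic_deriv[OF xi_entire_holomorphic]) auto
  hence "(\<lambda>u. deriv xi_entire (disc_to_plane a u)) holomorphic_on - {1}"
    using holomorphic_on_compose_gen[OF disc_to_plane_holomorphic] by (fastforce simp: o_def)
  thus ?thesis unfolding disc_logderiv_xi_def using assms disc_xi_holomorphic[of a]
    by (intro holomorphic_on_divide) (auto intro: holomorphic_on_subset)
qed

lemma xi_entire_not_nonpos: "xi_entire (of_real r) \<notin> \<real>\<^sub>\<le>\<^sub>0"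
  using xi_entire_real_pos[of r] by (auto elim!: nonpos_Reals_cases)

text \<open>the neighbourhood on which things are fine\<close>
text \<open>
Since xi is positive at real points, the principal logarithm is holomorphic near the centre of the disc; it
need not be on the whole disc.
\<close>

lemma disc_log_xi_domain:
  obtains S where "open S" "0 \<in> S" "S \<subseteq> - {1}" "\<And>u. u \<in> S \<Longrightarrow> xi_entire (disc_to_plane a u) \<notin> \<real>\<^sub>\<le>\<^sub>0"
proof
  define S where "S = {u \<in> - {1}. xi_entire (disc_to_plane a u) \<in> - \<real>\<^sub>\<le>\<^sub>0}"
  show "open S"
    using continuous_open_preimage[OF holomorphic_on_imp_continuous_on[OF disc_xi_holomorphic[of a]], of "- \<real>\<^sub>\<le>\<^sub>0"]
    by (simp add: S_def vimage_def Int_def open_Compl)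
  show "0 \<in> S" using xi_entire_not_nonpos[of "1 - a"] by (simp add: S_def disc_to_plane_0 del: of_real_diff)
qed auto

lemma disc_log_xi_has_fps_expansion: "disc_log_xi a has_fps_expansion fps_expansion (disc_log_xi a) 0"
proof -
  obtain S where S: "open S" "0 \<in> S" "S \<subseteq> - {1}" "\<And>u. u \<in> S \<Longrightarrow> xi_entire (disc_to_plane a u) \<notin> \<real>\<^sub>\<le>\<^sub>0"
    using disc_log_xi_domain by blast
  have "disc_log_xi a holomorphic_on S" unfolding disc_log_xi_def
    by (intro holomorphic_intros holomorphic_on_subset[OF disc_xi_holomorphic] S)
  thus ?thesis using S by blast
qed

lemma disc_logderiv_xi_has_fps_expansion: "disc_logderiv_xi a has_fps_expansion fps_expansion (disc_logderiv_xi a) 0"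
proof -
  obtain S where S: "open S" "0 \<in> S" "S \<subseteq> - {1}" "\<And>u. u \<in> S \<Longrightarrow> xi_entire (disc_to_plane a u) \<notin> \<real>\<^sub>\<le>\<^sub>0"
    using disc_log_xi_domain by blast
  have "disc_logderiv_xi a holomorphic_on S"
    by (rule disc_logderiv_xi_holomorphic) (use S in force)+
  thus ?thesis using S by blast
qed

lemma fps_deriv_disc_log_xi:
  "(1 - fps_X)\<^sup>2 * fps_deriv (fps_expansion (disc_log_xi a) 0) = fps_const (of_real (1 - 2 * a)) * fps_expansion (disc_logderiv_xi a) 0"
proof (rule fps_expansion_unique_complex)
  obtain S where S: "open S" "0 \<in> S" "S \<subseteq> - {1}" "\<And>u. u \<in> S \<Longrightarrow> xi_entire (disc_to_plane a u) \<notin> \<real>\<^sub>\<le>\<^sub>0"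
    using disc_log_xi_domain by blast
  show "(\<lambda>u. of_real (1 - 2 * a) * disc_logderiv_xi a u) has_fps_expansion fps_const (of_real (1 - 2 * a)) * fps_expansion (disc_logderiv_xi a) 0"
    by (intro fps_expansion_intros disc_logderiv_xi_has_fps_expansion)
  have "(\<lambda>u. (1 - u)\<^sup>2 * deriv (disc_log_xi a) u) has_fps_expansion (1 - fps_X)\<^sup>2 * fps_deriv (fps_expansion (disc_log_xi a) 0)"
    by (intro fps_expansion_intros disc_log_xi_has_fps_expansion)
  note E = this
  have ev: "eventually (\<lambda>u. (1 - u)\<^sup>2 * deriv (disc_log_xi a) u = of_real (1 - 2 * a) * disc_logderiv_xi a u) (nhds 0)"
    using eventually_nhds_in_open[OF S(1,2)]
  proof eventually_elim
    case (elim u)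
    hence u: "u \<noteq> 1" "xi_entire (disc_to_plane a u) \<notin> \<real>\<^sub>\<le>\<^sub>0" using S by auto
    have nz: "xi_entire (disc_to_plane a u) \<noteq> 0" using u by auto
    have "(xi_entire has_field_derivative deriv xi_entire (disc_to_plane a u)) (at (disc_to_plane a u))"
      using xi_entire_holomorphic[of UNIV] by (simp add: holomorphic_derivI)
    from DERIV_chain2[OF has_field_derivative_Ln[OF u(2)] DERIV_chain2[OF this disc_to_plane_has_derivative[OF u(1)]]]
    have "deriv (disc_log_xi a) u = inverse (xi_entire (disc_to_plane a u)) * (deriv xi_entire (disc_to_plane a u) * (of_real (1 - 2 * a) / (1 - u)\<^sup>2))"
      unfolding disc_log_xi_def by (intro DERIV_imp_deriv)
    moreover have "(1 - u)\<^sup>2 \<noteq> 0" using u by simp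
    moreover have "q * (inverse X * (d * (c / q))) = c * (d / X)" if "q \<noteq> 0" "X \<noteq> 0" for q X d c :: complex
      using that by (simp add: field_simps)
    ultimately show ?case using nz by (simp only: disc_logderiv_xi_def) blast
  qed
  show "(\<lambda>u. of_real (1 - 2 * a) * disc_logderiv_xi a u) has_fps_expansion (1 - fps_X)\<^sup>2 * fps_deriv (fps_expansion (disc_log_xi a) 0)"
    by (rule iffD1[OF has_fps_expansion_cong[OF ev refl] E])
qed

lemma li_coeff_eq_log_coeff:
  assumes a: "a \<noteq> 1/2" and n: "n \<ge> 1"
  shows "of_real (1 - 2 * a) * li_coeff a n = of_nat n * fps_nth (fps_expansion (disc_log_xi a) 0) n"
proof -
  define c where "c = complex_of_real (1 - 2 * a)"
  have c: "c \<noteq> 0" using a unfolding c_def of_real_eq_0_iff by simp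
  have ev: "eventually (\<lambda>u. disc_log_xi a u = Ln (xi ((of_real (1 - a) - of_real a * u) / (1 - u)))) (nhds 0)"
  proof -
    have "eventually (\<lambda>u. u \<in> - {1}) (nhds (0::complex))" by (rule eventually_nhds_in_open) auto
    thus ?thesis
      by eventually_elim (simp only: disc_log_xi_def disc_to_plane_altdef xi_eq_xi_entire Compl_iff singleton_iff not_False_eq_True)
  qed
  have "(\<lambda>u. Ln (xi ((of_real (1 - a) - of_real a * u) / (1 - u)))) has_fps_expansion fps_expansion (disc_log_xi a) 0"
    using disc_log_xi_has_fps_expansion[of a] has_fps_expansion_cong[OF ev refl] by blast
  from higher_deriv_Li_substitution[where g = "\<lambda>z. Ln (xi z)", OF this _ n]
  have "(deriv ^^ n) (\<lambda>z. (z - of_real a) ^ (n - 1) * Ln (xi z)) (of_real (1 - a)) = fact n * (fps_nth (fps_expansion (disc_log_xi a) 0) n / c)"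
    using a c by (simp add: c_def)
  moreover have "fact n = of_nat n * (fact (n - 1) :: complex)" using n fact_reduce[of n, where 'a = complex] by simp
  ultimately show ?thesis using c unfolding c_def [symmetric] by (simp add: li_coeff_def)
qed

text \<open>
The derivative of \<open>disc_log_xi\<close> is \<open>(1 - 2 * a) / (1 - u)\<^sup>2\<close> times
\<open>disc_logderiv_xi\<close>, and \<open>1 / (1 - u)\<^sup>2\<close> has the coefficients 1, 2, 3, and so
on. The result is an unnormalized Fejer sum of the Taylor coefficients of \<open>disc_logderiv_xi\<close> at
radius 1.
\<close>

lemma li_coeff_eq_sum:
  assumes a: "a \<noteq> 1/2" and n: "n \<ge> 1"
  shows "li_coeff a n = (\<Sum>k<n. of_nat (n - k) * fps_nth (fps_expansion (disc_logderiv_xi a) 0) k)"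
proof -
  define c where "c = complex_of_real (1 - 2 * a)"
  have c: "c \<noteq> 0" using a unfolding c_def of_real_eq_0_iff by simp
  define H where "H = fps_expansion (disc_logderiv_xi a) 0"
  define \<Phi> where "\<Phi> = fps_expansion (disc_log_xi a) 0"
  define A where "A = Abs_fps (\<lambda>n. of_nat (Suc n) :: complex)"
  have A1: "A * (1 - fps_X) = Abs_fps (\<lambda>_. 1)"
    by (rule fps_ext) (simp add: A_def algebra_simps fps_X_mult_right_nth)
  have A2: "Abs_fps (\<lambda>_. 1 :: complex) * (1 - fps_X) = 1"
    by (rule fps_ext) (simp add: algebra_simps fps_X_mult_right_nth)
  have A: "A * (1 - fps_X)\<^sup>2 = 1" unfolding power2_eq_square mult.assoc [symmetric] A1 A2 ..
  have "A * ((1 - fps_X)\<^sup>2 * fps_deriv \<Phi>) = A * (fps_const c * H)"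
    unfolding \<Phi>_def H_def c_def fps_deriv_disc_log_xi ..
  hence "fps_deriv \<Phi> = fps_const c * (H * A)"
    unfolding mult.assoc [symmetric] A by (simp add: mult_ac)
  hence "fps_nth (fps_deriv \<Phi>) (n - 1) = c * (\<Sum>k=0..n-1. fps_nth H k * of_nat (Suc (n - 1 - k)))"
    by (simp only: fps_mult_left_const_nth fps_mult_nth[of H] A_def fps_nth_Abs_fps)
  moreover have "fps_nth (fps_deriv \<Phi>) (n - 1) = of_nat n * fps_nth \<Phi> n" using n by simp
  moreover have "(\<Sum>k=0..n-1. fps_nth H k * of_nat (Suc (n - 1 - k))) = (\<Sum>k<n. of_nat (n - k) * fps_nth H k)"
    by (rule sum.cong) (use n in \<open>auto simp: mult.commute Suc_diff_le\<close>)
  ultimately have "c * li_coeff a n = c * (\<Sum>k<n. of_nat (n - k) * fps_nth H k)"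
    using li_coeff_eq_log_coeff[OF a n] by (simp add: c_def \<Phi>_def)
  thus ?thesis using c by (simp add: H_def)
qed

lemma deriv_xi_entire_reflect: "deriv xi_entire (1 - z) = - deriv xi_entire z"
proof -
  have "(xi_entire has_field_derivative deriv xi_entire (1 - z)) (at (1 - z))"
    using xi_entire_holomorphic[of UNIV] by (simp add: holomorphic_derivI)
  hence "((\<lambda>z. xi_entire (1 - z)) has_field_derivative deriv xi_entire (1 - z) * (0 - 1)) (at z)"
    by (intro DERIV_chain2[where f = xi_entire] derivative_intros)
  hence "deriv xi_entire z = - deriv xi_entire (1 - z)"
    by (simp add: xi_entire_reflect DERIV_imp_deriv)
  thus ?thesis by simp
qed

text \<open>
The functional equation makes the logarithmic derivative of xi odd about \<open>1/2\<close>.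
\<close>

lemma li_coeff_reflect:
  assumes a: "a \<noteq> 1/2" and n: "n \<ge> 1"
  shows "li_coeff (1 - a) n = - li_coeff a n"
proof -
  have "disc_to_plane (1 - a) u = 1 - disc_to_plane a u" for u
    by (simp add: disc_to_plane_def algebra_simps)
  hence "disc_logderiv_xi (1 - a) = (\<lambda>u. - disc_logderiv_xi a u)"
    by (simp add: disc_logderiv_xi_def deriv_xi_entire_reflect xi_entire_reflect fun_eq_iff)
  moreover have "(\<lambda>u. - disc_logderiv_xi a u) has_fps_expansion - fps_expansion (disc_logderiv_xi a) 0"
    by (intro fps_expansion_intros disc_logderiv_xi_has_fps_expansion)
  ultimately have "fps_expansion (disc_logderiv_xi (1 - a)) 0 = - fps_expansion (disc_logderiv_xi a) 0"
    using disc_logderiv_xi_has_fps_expansion[of "1 - a"] fps_expansion_unique_complex by simp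
  moreover have "1 - a \<noteq> 1/2" using a by simp
  ultimately show ?thesis using a n by (simp add: li_coeff_eq_sum sum_negf)
qed

section \<open>Positivity of Fejer sums\<close>

lemma circle_Fourier_coeff:
  fixes h :: "complex \<Rightarrow> complex"
  assumes h: "h holomorphic_on ball 0 1" and r: "0 < r" "r < 1"
  shows "((\<lambda>t. h (of_real r * exp (2 * of_real pi * \<i> * of_real t)) * exp (- (2 * of_real pi * \<i> * of_real t)) ^ k) 
            has_integral (of_real r ^ k * (deriv ^^ k) h 0 / fact k)) {0..1}"
proof -
  let ?e = "\<lambda>t::real. exp (2 * of_real pi * \<i> * of_real t)"
  have "((\<lambda>u. h u / (u - 0) ^ (Suc k)) has_contour_integral ((2 * pi * \<i>) / (fact k) * (deriv ^^ k) h 0)) (circlepath 0 r)"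
  proof (rule Cauchy_has_contour_integral_higher_derivative_circlepath)
    show "continuous_on (cball 0 r) h" 
      by (rule continuous_on_subset[OF holomorphic_on_imp_continuous_on[OF h]]) (use r in auto)
    show "h holomorphic_on ball 0 r" by (rule holomorphic_on_subset[OF h]) (use r in auto)
  qed (use r in auto)
  hence "((\<lambda>t. h (circlepath 0 r t) / (circlepath 0 r t) ^ (Suc k) * (2 * pi * \<i> * r * ?e t)) has_integral 
      ((2 * pi * \<i>) / (fact k) * (deriv ^^ k) h 0)) {0..1}"
    unfolding has_contour_integral vector_derivative_circlepath by simp
  moreover have "h (circlepath 0 r t) / (circlepath 0 r t) ^ (Suc k) * (2 * pi * \<i> * r * ?e t) = 
      (2 * pi * \<i> / of_real r ^ k) * (h (of_real r * ?e t) * exp (- (2 * of_real pi * \<i> * of_real t)) ^ k)" for t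
  proof -
    have c: "circlepath 0 r t = of_real r * ?e t" by (simp add: circlepath)
    have em: "exp (- (2 * of_real pi * \<i> * of_real t)) = inverse (?e t)" by (rule exp_minus)
    have alg: "y / (\<rho> * E) ^ Suc k * (c * \<rho> * E) = c / \<rho> ^ k * (y * inverse E ^ k)" if "\<rho> \<noteq> 0" "E \<noteq> 0" for y \<rho> E c :: complex
      using that by (simp add: power_mult_distrib power_inverse field_simps)
    show ?thesis unfolding c em by (rule alg) (use r in auto)
  qed
  ultimately have "((\<lambda>t. (2 * pi * \<i> / of_real r ^ k) * (h (of_real r * ?e t) * exp (- (2 * of_real pi * \<i> * of_real t)) ^ k)) has_integral 
      ((2 * pi * \<i>) / (fact k) * (deriv ^^ k) h 0)) {0..1}" by (simp only:)
  from has_integral_mult_right[OF this, of "of_real r ^ k / (2 * pi * \<i>)"] r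
  show ?thesis by (simp add: field_simps)
qed

lemma circle_Fourier_coeff_neg:
  fixes h :: "complex \<Rightarrow> complex"
  assumes h: "h holomorphic_on ball 0 1" and r: "0 < r" "r < 1" and k: "k > 0"
  shows "((\<lambda>t. h (of_real r * exp (2 * of_real pi * \<i> * of_real t)) * exp (2 * of_real pi * \<i> * of_real t) ^ k) 
            has_integral 0) {0..1}"
proof -
  have "(\<lambda>u. h u * u ^ k) holomorphic_on ball 0 1" by (intro holomorphic_intros h)
  from circle_Fourier_coeff[OF this r, of 0]
  have "((\<lambda>t. h (of_real r * exp (2 * of_real pi * \<i> * of_real t)) * (of_real r * exp (2 * of_real pi * \<i> * of_real t)) ^ k) has_integral 0) {0..1}"
    using k by (simp add: power_0_left)
  from has_integral_mult_right[OF this, of "1 / of_real r ^ k"] r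
  show ?thesis by (simp add: power_mult_distrib field_simps)
qed

lemma sum_Toeplitz:
  fixes a :: "nat \<Rightarrow> 'a::comm_ring_1"
  shows "(\<Sum>m<n. \<Sum>l<n. if l \<le> m then a (m - l) else 0) = (\<Sum>k<n. of_nat (n - k) * a k)"
proof (induction n)
  case (Suc n)
  have "(\<Sum>m<Suc n. \<Sum>l<Suc n. if l \<le> m then a (m - l) else 0) =
      (\<Sum>m<n. \<Sum>l<n. if l \<le> m then a (m - l) else 0) + (\<Sum>l<Suc n. a (n - l))"
    by (simp add: sum.distrib)
  also have "(\<Sum>l<Suc n. a (n - l)) = (\<Sum>k<Suc n. a k)"
    by (rule sum.reindex_bij_witness[of _ "\<lambda>k. n - k" "\<lambda>l. n - l"]) auto
  also have "(\<Sum>m<n. \<Sum>l<n. if l \<le> m then a (m - l) else 0) = (\<Sum>k<Suc n. of_nat (n - k) * a k)"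
    using Suc by simp
  also have "\<dots> + (\<Sum>k<Suc n. a k) = (\<Sum>k<Suc n. of_nat (Suc n - k) * a k)"
    unfolding sum.distrib [symmetric] by (rule sum.cong) (auto simp: Suc_diff_le algebra_simps)
  finally show ?case .
qed simp

text \<open>
On a circle of radius \<open>r < 1\<close> the sum with weights \<open>r ^ k\<close> is the mean of
\<open>h\<close> against the Fejer kernel \<open>\<bar>\<Sum>m<n. exp (\<i> * m *
\<theta>)\<bar>\<^sup>2\<close>, which is nonnegative; the double sum over the frequencies is a Toeplitz sum
because the negative Fourier coefficients of \<open>h\<close> vanish. Then \<open>r \<rightarrow> 1\<close>.
\<close>

theorem Fejer_sum_nonneg:
  fixes h :: "complex \<Rightarrow> complex"
  assumes h: "h holomorphic_on ball 0 1" and Re: "\<And>u. u \<in> ball 0 1 \<Longrightarrow> Re (h u) \<ge> 0"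
  shows "Re (\<Sum>k<n. of_nat (n - k) * ((deriv ^^ k) h 0 / fact k)) \<ge> 0"
proof -
  define H where "H = (\<lambda>k. (deriv ^^ k) h 0 / fact k)"
  have ineq: "Re (\<Sum>k<n. of_nat (n - k) * (of_real r ^ k * H k)) \<ge> 0" if r: "0 < r" "r < 1" for r
  proof -
    define e where "e = (\<lambda>t::real. exp (2 * of_real pi * \<i> * of_real t))"
    have em: "exp (- (2 * of_real pi * \<i> * of_real t)) = inverse (e t)" for t by (simp add: e_def exp_minus)
    have ee: "exp (2 * of_real pi * \<i> * of_real t) = e t" for t by (simp add: e_def)
    have ne: "e t \<noteq> 0" for t by (simp add: e_def)
    have ce: "cnj (e t) = inverse (e t)" for t by (simp add: e_def exp_cnj exp_minus [symmetric])
    have term_int: "((\<lambda>t. h (of_real r * e t) * (e t ^ l * inverse (e t) ^ m)) has_integral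
        (if l \<le> m then of_real r ^ (m - l) * H (m - l) else 0)) {0..1}" for m l
    proof (cases "l \<le> m")
      case True
      have "e t ^ l * inverse (e t) ^ m = inverse (e t) ^ (m - l)" for t
        using True ne[of t] by (simp add: power_inverse power_diff field_simps)
      thus ?thesis using circle_Fourier_coeff[OF h r, of "m - l", unfolded em ee] True
        by (simp add: H_def)
    next
      case False
      have "e t ^ l * inverse (e t) ^ m = e t ^ (l - m)" for t
        using False ne[of t] by (simp add: power_inverse power_diff field_simps)
      thus ?thesis using circle_Fourier_coeff_neg[OF h r, of "l - m", unfolded ee] False
        by simp
    qed
    define P where "P = (\<lambda>t. \<Sum>m<n. e t ^ m)"
    have "((\<lambda>t. \<Sum>m<n. \<Sum>l<n. h (of_real r * e t) * (e t ^ l * inverse (e t) ^ m)) has_integral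
        (\<Sum>m<n. \<Sum>l<n. if l \<le> m then of_real r ^ (m - l) * H (m - l) else 0)) {0..1}"
      by (intro has_integral_sum term_int) auto
    moreover have "(\<Sum>m<n. \<Sum>l<n. h (of_real r * e t) * (e t ^ l * inverse (e t) ^ m)) = h (of_real r * e t) * of_real ((norm (P t))\<^sup>2)" for t
    proof -
      have "of_real ((norm (P t))\<^sup>2) = cnj (P t) * P t" using complex_norm_square[of "P t"] by (simp add: mult.commute)
      also have "cnj (P t) = (\<Sum>m<n. inverse (e t) ^ m)" by (simp add: P_def ce)
      also have "\<dots> * P t = (\<Sum>m<n. \<Sum>l<n. inverse (e t) ^ m * e t ^ l)" unfolding P_def by (rule sum_product)
      finally show ?thesis by (simp add: sum_distrib_left mult.commute)
    qed
    ultimately have "((\<lambda>t. h (of_real r * e t) * of_real ((norm (P t))\<^sup>2)) has_integral (\<Sum>k<n. of_nat (n - k) * (of_real r ^ k * H k))) {0..1}"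
      by (simp only: sum_Toeplitz[where a = "\<lambda>k. of_real r ^ k * H k"])
    from has_integral_linear[OF this bounded_linear_Re]
    have "((\<lambda>t. Re (h (of_real r * e t)) * (norm (P t))\<^sup>2) has_integral Re (\<Sum>k<n. of_nat (n - k) * (of_real r ^ k * H k))) {0..1}"
      by (simp add: o_def)
    thus ?thesis
    proof (rule has_integral_nonneg)
      fix t :: real
      have "norm (e t) = 1" by (simp add: e_def)
      hence "of_real r * e t \<in> ball 0 1" using r by (simp add: norm_mult)
      thus "0 \<le> Re (h (of_real r * e t)) * (norm (P t))\<^sup>2" using Re by simp
    qed
  qed
  have "((\<lambda>r. Re (\<Sum>k<n. of_nat (n - k) * (of_real r ^ k * H k))) \<longlongrightarrow> Re (\<Sum>k<n. of_nat (n - k) * (of_real 1 ^ k * H k))) (at_left 1)"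
    by (intro tendsto_intros)
  moreover have "eventually (\<lambda>r. Re (\<Sum>k<n. of_nat (n - k) * (of_real r ^ k * H k)) \<ge> 0) (at_left 1)"
    by (rule eventually_mono[OF eventually_at_left_real[of 0 1]]) (simp, rule ineq, auto)
  ultimately have "Re (\<Sum>k<n. of_nat (n - k) * (of_real 1 ^ k * H k)) \<ge> 0"
    by (intro tendsto_lowerbound) auto
  thus ?thesis by (simp add: H_def)
qed

lemma higher_deriv_real_of_cnj_symmetric:
  fixes h :: "complex \<Rightarrow> complex"
  assumes h: "h holomorphic_on ball 0 1" and sym: "\<And>u. h (cnj u) = cnj (h u)"
  shows "(deriv ^^ k) h 0 / fact k \<in> \<real>"
proof -
  define H where "H = (\<lambda>k. (deriv ^^ k) h 0 / fact k)"
  have ser: "(\<lambda>n. H n * u ^ n) sums h u" if "u \<in> ball 0 1" for u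
    using holomorphic_power_series[OF h that] by (simp add: H_def)
  have ser': "(\<lambda>n. cnj (H n) * u ^ n) sums h u" if "u \<in> ball 0 1" for u
  proof -
    have "(\<lambda>n. cnj (H n * cnj u ^ n)) sums cnj (h (cnj u))"
      unfolding sums_cnj by (rule ser) (use that in simp)
    thus ?thesis by (simp add: sym)
  qed
  have ev: "eventually (\<lambda>u. u \<in> ball 0 1) (nhds (0::complex))" by (rule eventually_nhds_in_open) auto
  have "h has_fps_expansion Abs_fps H"
    by (rule has_fps_expansionI) (use ev ser in \<open>auto elim!: eventually_mono\<close>)
  moreover have "h has_fps_expansion Abs_fps (\<lambda>k. cnj (H k))"
    by (rule has_fps_expansionI) (use ev ser' in \<open>auto elim!: eventually_mono\<close>)
  ultimately have "Abs_fps H = Abs_fps (\<lambda>k. cnj (H k))" by (rule fps_expansion_unique_complex)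
  hence "cnj (H k) = H k" by (metis fps_nth_Abs_fps)
  hence "H k \<in> \<real>" by (simp only: Reals_cnj_iff)
  thus ?thesis by (simp only: H_def)
qed

section \<open>Absence of zeros from nonnegative coefficients\<close>

text \<open>
A Pringsheim argument. Let \<open>u0\<close> be a zero of least modulus \<open>R\<close> and \<open>g\<close>
a logarithm of \<open>F\<close> on the disc of radius \<open>R\<close>. Nonnegativity of the coefficients
gives \<open>\<bar>g w - g 0\<bar> \<le> g \<bar>w\<bar> - g 0\<close>, and the right-hand side is bounded
above because \<open>F\<close> is bounded along the radius. Hence \<open>Re g\<close> is bounded below on the
disc and \<open>F\<close> stays away from 0, which contradicts \<open>F u0 = 0\<close>.
\<close>

theorem nonvanishing_of_nonneg_log_coeffs:
  fixes F :: "complex \<Rightarrow> complex"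
  assumes F: "F holomorphic_on ball 0 1"
    and \<phi>: "\<phi> has_fps_expansion \<Phi>" and exp: "eventually (\<lambda>u. F u = exp (\<phi> u)) (nhds 0)"
    and nonneg: "\<And>n. n \<ge> 1 \<Longrightarrow> fps_nth \<Phi> n \<in> \<real>\<^sub>\<ge>\<^sub>0"
    and u: "u \<in> ball 0 1"
  shows "F u \<noteq> 0"
proof
  assume "F u = 0"
  have F0: "F 0 \<noteq> 0" using eventually_nhds_x_imp_x[OF exp] by simp
  define Z where "Z = {w \<in> cball 0 (norm u). F w \<in> {0}}"
  have cball: "cball 0 (norm u) \<subseteq> ball (0::complex) 1" using u by auto
  have contF: "continuous_on (cball 0 (norm u)) F"
    using holomorphic_on_imp_continuous_on[OF F] cball continuous_on_subset by blast
  have "closed Z" unfolding Z_def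
    using continuous_closed_preimage[OF contF closed_cball closed_singleton] by (simp add: vimage_def Int_def)
  moreover have "u \<in> Z" using \<open>F u = 0\<close> by (simp add: Z_def)
  ultimately obtain u0 where u0: "u0 \<in> Z" "\<And>w. w \<in> Z \<Longrightarrow> dist 0 u0 \<le> dist 0 w"
    using distance_attains_inf[of Z 0] by blast
  define R where "R = norm u0"
  have Fu0: "F u0 = 0" and Ru: "R \<le> norm u" using u0 by (auto simp: Z_def R_def)
  have R: "R > 0" "R < 1" using F0 Fu0 Ru u by (auto simp: R_def)
  have nz: "F w \<noteq> 0" if "w \<in> ball 0 R" for w
  proof
    assume "F w = 0"
    hence "w \<in> Z" using that Ru by (auto simp: Z_def)
    thus False using u0(2)[of w] that by (simp add: R_def)
  qed
  have FR: "F holomorphic_on ball 0 R" by (rule holomorphic_on_subset[OF F]) (use R in auto)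
  obtain g where g: "g holomorphic_on ball 0 R" "\<And>w. w \<in> ball 0 R \<Longrightarrow> F w = exp (g w)"
    using contractible_imp_holomorphic_log[OF FR convex_imp_contractible[OF convex_ball] nz] by blast
  define G where "G = fps_expansion g 0"
  have gG: "g has_fps_expansion G" unfolding G_def using g(1) R by (intro has_fps_expansion_fps_expansion[of "ball 0 R"]) auto
  have G: "fps_nth G n \<in> \<real>\<^sub>\<ge>\<^sub>0" if n: "n \<ge> 1" for n
  proof -
    have "eventually (\<lambda>w. w \<in> ball 0 R) (nhds (0::complex))" by (rule eventually_nhds_in_open) (use R in auto)
    hence eq: "eventually (\<lambda>w. exp (g w) = exp (\<phi> w)) (nhds 0)"
      using exp by eventually_elim (use g in auto)
    \<comment> \<open>The two logarithms may differ by a multiple of \<open>2 * \<pi> * \<i>\<close>, so only their derivatives are compared.\<close>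
    have eg: "eventually (\<lambda>w. deriv g w = deriv \<phi> w) (nhds 0)"
    proof -
      have "eventually (\<lambda>w. eventually (\<lambda>w. exp (g w) = exp (\<phi> w)) (nhds w)) (nhds 0)" using eq by (simp add: eventually_eventually)
      moreover obtain S where S: "open S" "0 \<in> S" "\<phi> holomorphic_on S" using has_fps_expansion_imp_holomorphic[OF \<phi>] by metis
      have "eventually (\<lambda>w. w \<in> S \<inter> ball 0 R) (nhds 0)" by (rule eventually_nhds_in_open) (use S R in auto)
      ultimately show ?thesis
      proof eventually_elim
        case (elim w)
        have dg: "(g has_field_derivative deriv g w) (at w)" using elim g(1) by (auto intro: holomorphic_derivI)
        have d\<phi>: "(\<phi> has_field_derivative deriv \<phi> w) (at w)" using elim S by (auto intro: holomorphic_derivI)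
        have "((\<lambda>w. exp (g w)) has_field_derivative exp (g w) * deriv g w) (at w)" using dg by (auto intro!: derivative_eq_intros)
        moreover have "((\<lambda>w. exp (\<phi> w)) has_field_derivative exp (\<phi> w) * deriv \<phi> w) (at w)" using d\<phi> by (auto intro!: derivative_eq_intros)
        ultimately have "exp (g w) * deriv g w = exp (\<phi> w) * deriv \<phi> w"
          using elim(1) by (metis DERIV_imp_deriv deriv_cong_ev)
        moreover have "exp (g w) = exp (\<phi> w)" using eventually_nhds_x_imp_x[OF elim(1)] .
        ultimately show ?case by simp
      qed
    qed
    have "deriv \<phi> has_fps_expansion fps_deriv G"
      by (rule iffD1[OF has_fps_expansion_cong[OF eg refl] has_fps_expansion_deriv[OF gG]])
    hence "fps_deriv G = fps_deriv \<Phi>" using has_fps_expansion_deriv[OF \<phi>] by (rule fps_expansion_unique_complex)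
    hence "fps_nth (fps_deriv G) (n - 1) = fps_nth (fps_deriv \<Phi>) (n - 1)" by simp
    hence "of_nat n * fps_nth G n = of_nat n * fps_nth \<Phi> n" using n by simp
    thus ?thesis using nonneg[OF n] n by simp
  qed
  have ser: "(\<lambda>n. fps_nth G n * w ^ n) sums g w" if "w \<in> ball 0 R" for w
    using holomorphic_power_series[OF g(1) that] by (simp add: G_def fps_expansion_def)
  have ser1: "(\<lambda>n. fps_nth G (Suc n) * w ^ Suc n) sums (g w - g 0)" if "w \<in> ball 0 R" for w
  proof -
    have "g 0 = fps_nth G 0" by (simp add: G_def fps_expansion_def)
    thus ?thesis using ser[OF that] by (subst sums_Suc_iff) simp
  qed
  have "compact (F ` cball 0 (norm u))" by (intro compact_continuous_image contF) auto
  then obtain B where B: "\<And>w. w \<in> cball 0 (norm u) \<Longrightarrow> norm (F w) \<le> B"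
    using compact_imp_bounded[THEN bounded_normE] by (metis imageI)
  have B0: "B > 0" using B[of 0] F0 by (simp add: order_less_le_trans[of _ "norm (F 0)"])
  have bound: "norm (g w - g 0) \<le> ln B - Re (g 0)" if w: "w \<in> ball 0 R" for w
  proof -
    define s where "s = complex_of_real (norm w)"
    have s: "s \<in> ball 0 R" using w by (simp add: s_def)
    have re: "(\<lambda>n. Re (fps_nth G (Suc n) * s ^ Suc n)) sums Re (g s - g 0)" by (rule sums_Re[OF ser1[OF s]])
    have eq: "norm (fps_nth G (Suc n) * w ^ Suc n) = Re (fps_nth G (Suc n) * s ^ Suc n)" for n
    proof -
      obtain x where x: "fps_nth G (Suc n) = of_real x" "x \<ge> 0" using G[of "Suc n"] by (auto elim: nonneg_Reals_cases)
      have "s ^ Suc n = of_real (norm w ^ Suc n)" by (simp add: s_def)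
      thus ?thesis using x(2) unfolding x(1) by (simp only: norm_mult norm_power norm_of_real of_real_mult [symmetric] Re_complex_of_real)
    qed
    have "norm (g w - g 0) \<le> Re (g s - g 0)"
      using norm_suminf_le[of "\<lambda>n. fps_nth G (Suc n) * w ^ Suc n" "\<lambda>n. norm (fps_nth G (Suc n) * w ^ Suc n)"]
        sums_unique[OF ser1[OF w]] sums_unique[OF re] sums_summable[OF re] unfolding eq by simp
    moreover have "Re (g s) \<le> ln B"
    proof -
      have "exp (Re (g s)) = norm (F s)" using g(2)[OF s] by simp
      also have "\<dots> \<le> B" by (rule B) (use w Ru in \<open>auto simp: s_def\<close>)
      finally show ?thesis using B0 by (simp add: ln_ge_iff)
    qed
    ultimately show ?thesis by simp
  qed
  define \<epsilon> where "\<epsilon> = exp (2 * Re (g 0) - ln B)"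
  have lower: "norm (F w) \<ge> \<epsilon>" if "w \<in> ball 0 R" for w
  proof -
    have "Re (g 0) - Re (g w) \<le> norm (g w - g 0)" using abs_Re_le_cmod[of "g w - g 0"] by simp
    hence "2 * Re (g 0) - ln B \<le> Re (g w)" using bound[OF that] by linarith
    thus ?thesis unfolding \<epsilon>_def using g(2)[OF that] by simp
  qed
  have "((\<lambda>t. norm (F (of_real t * u0))) \<longlongrightarrow> norm (F u0)) (at_left 1)"
  proof (intro tendsto_norm)
    have "isCont F u0"
      using F R by (metis R_def dist_0_norm holomorphic_on_imp_continuous_on continuous_on_eq_continuous_at mem_ball open_ball)
    moreover have "((\<lambda>t. of_real t * u0) \<longlongrightarrow> of_real 1 * u0) (at_left 1)" by (intro tendsto_intros)
    ultimately show "((\<lambda>t. F (of_real t * u0)) \<longlongrightarrow> F u0) (at_left 1)"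
      by (intro isCont_tendsto_compose[of u0 F]) auto
  qed
  moreover have "eventually (\<lambda>t. norm (F (of_real t * u0)) \<ge> \<epsilon>) (at_left 1)"
    using eventually_at_left_real[of 0 "1::real"]
  proof (rule eventually_mono)
    fix t :: real assume "t \<in> {0<..<1}"
    thus "norm (F (of_real t * u0)) \<ge> \<epsilon>" using R by (intro lower) (auto simp: norm_mult R_def [symmetric])
  qed auto
  ultimately have "norm (F u0) \<ge> \<epsilon>" by (intro tendsto_lowerbound) auto
  moreover have "\<epsilon> > 0" by (simp add: \<epsilon>_def)
  ultimately show False using Fu0 by simp
qed

section \<open>The criterion\<close>

lemma riemann_hypothesis_iff_half_plane:
  "riemann_hypothesis \<longleftrightarrow> (\<forall>z. Re z > 1/2 \<longrightarrow> xi_entire z \<noteq> 0)"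
proof
  assume *: "\<forall>z. Re z > 1/2 \<longrightarrow> xi_entire z \<noteq> 0"
  show riemann_hypothesis unfolding riemann_hypothesis_def xi_eq_xi_entire
  proof safe
    fix \<rho> assume z: "xi_entire \<rho> = 0"
    moreover have "xi_entire (1 - \<rho>) = 0" using z by (simp add: xi_entire_reflect)
    ultimately have "\<not> Re \<rho> > 1/2" "\<not> Re (1 - \<rho>) > 1/2" using * by blast+
    thus "Re \<rho> = 1/2" by simp
  qed
qed (auto simp: riemann_hypothesis_def xi_eq_xi_entire)

lemma Re_disc_to_plane:
  assumes a: "a < 1/2" and u: "norm u < 1"
  shows "Re (disc_to_plane a u) > 1/2"
proof -
  have u1: "1 - u \<noteq> 0" using u by auto
  have "Re ((1 + u) / (1 - u)) = (1 - (norm u)\<^sup>2) / (norm (1 - u))\<^sup>2"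
    unfolding Re_divide cmod_power2 by (simp add: power2_eq_square algebra_simps)
  moreover have "(norm u)\<^sup>2 < 1" using u by (simp add: power_less_one_iff)
  ultimately have "Re ((1 + u) / (1 - u)) > 0" using u1 by simp
  moreover have "Re (disc_to_plane a u) = 1/2 + (1/2 - a) * Re ((1 + u) / (1 - u))"
  proof -
    have "1/2 - complex_of_real a = of_real (1/2 - a)" by simp
    thus ?thesis unfolding disc_to_plane_def by (simp only: plus_complex.sel Re_complex_of_real times_complex.sel Im_complex_of_real) simp
  qed
  ultimately show ?thesis using a by simp
qed

lemma disc_to_plane_surj:
  assumes a: "a < 1/2" and z: "Re z > 1/2"
  obtains u where "norm u < 1" "disc_to_plane a u = z"
proof -
  define k where "k = 1/2 - a"
  have k: "k > 0" using a by (simp add: k_def)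
  define w where "w = z - 1/2"
  have w: "Re w > 0" using z by (simp add: w_def)
  have nz: "w + of_real k \<noteq> 0" using w k by (auto simp: complex_eq_iff)
  define u where "u = (w - of_real k) / (w + of_real k)"
  have "norm (w - of_real k) < norm (w + of_real k)"
  proof (rule power2_less_imp_less)
    show "(norm (w - of_real k))\<^sup>2 < (norm (w + of_real k))\<^sup>2"
      unfolding cmod_power2 using w k by (simp add: power2_eq_square algebra_simps)
  qed auto
  hence "norm u < 1" using nz by (simp add: u_def norm_divide divide_simps)
  moreover have "disc_to_plane a u = z"
  proof -
    have "1 + u = 2 * w / (w + of_real k)" "1 - u = 2 * of_real k / (w + of_real k)" using nz by (simp_all add: u_def field_simps)
    hence "(1 + u) / (1 - u) = w / of_real k" using nz k by simp
    moreover have "1/2 - complex_of_real a = of_real k" by (simp add: k_def)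
    ultimately have "disc_to_plane a u = 1/2 + w" unfolding disc_to_plane_def using k by simp
    thus ?thesis by (simp add: w_def)
  qed
  ultimately show ?thesis using that by blast
qed

lemma disc_logderiv_xi_cnj: "disc_logderiv_xi a (cnj u) = cnj (disc_logderiv_xi a u)"
proof -
  have d: "disc_to_plane a (cnj u) = cnj (disc_to_plane a u)" by (simp add: disc_to_plane_def)
  have "deriv xi_entire (cnj z) = cnj (deriv xi_entire z)" for z
  proof -
    have "(xi_entire has_field_derivative deriv xi_entire z) (at z)"
      using xi_entire_holomorphic[of UNIV] by (simp add: holomorphic_derivI)
    hence "(cnj \<circ> xi_entire \<circ> cnj has_field_derivative cnj (deriv xi_entire z)) (at (cnj z))"
      by (intro has_field_derivative_cnj_cnj) simp
    moreover have "cnj \<circ> xi_entire \<circ> cnj = xi_entire" by (simp add: fun_eq_iff xi_entire_cnj)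
    ultimately show ?thesis by (simp add: DERIV_imp_deriv)
  qed
  thus ?thesis by (simp add: disc_logderiv_xi_def d xi_entire_cnj)
qed

text \<open>
The forward direction is the Fejer sum for the logarithmic derivative, whose real part is nonnegative on the
disc under the hypothesis; the converse excludes zeros in the disc by nonnegativity of the coefficients of the
logarithm.
\<close>

lemma li_criterion_below_half:
  assumes a: "a < 1/2"
  shows "riemann_hypothesis \<longleftrightarrow> (\<forall>n\<ge>1. li_coeff a n \<in> \<real>\<^sub>\<ge>\<^sub>0)"
proof
  assume riemann_hypothesis
  hence nz: "\<And>z. Re z > 1/2 \<Longrightarrow> xi_entire z \<noteq> 0" by (simp add: riemann_hypothesis_iff_half_plane)
  have h: "disc_logderiv_xi a holomorphic_on ball 0 1"
    by (rule disc_logderiv_xi_holomorphic) (use a nz Re_disc_to_plane in auto)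
  show "\<forall>n\<ge>1. li_coeff a n \<in> \<real>\<^sub>\<ge>\<^sub>0"
  proof safe
    fix n :: nat assume n: "n \<ge> 1"
    have eq: "li_coeff a n = (\<Sum>k<n. of_nat (n - k) * ((deriv ^^ k) (disc_logderiv_xi a) 0 / fact k))"
      using li_coeff_eq_sum[OF _ n, of a] a by (simp add: fps_expansion_def)
    have "Re (li_coeff a n) \<ge> 0" unfolding eq
      by (rule Fejer_sum_nonneg[OF h]) 
         (use Re_logderiv_xi_entire_nonneg[OF nz] Re_disc_to_plane[OF a] in \<open>auto simp: disc_logderiv_xi_def\<close>)
    moreover have "li_coeff a n \<in> \<real>" unfolding eq
      by (intro sum_in_Reals Reals_mult higher_deriv_real_of_cnj_symmetric[OF h] disc_logderiv_xi_cnj) auto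
    ultimately show "li_coeff a n \<in> \<real>\<^sub>\<ge>\<^sub>0" by (simp add: complex_nonneg_Reals_iff complex_is_Real_iff)
  qed
next
  assume li: "\<forall>n\<ge>1. li_coeff a n \<in> \<real>\<^sub>\<ge>\<^sub>0"
  have nz: "xi_entire (disc_to_plane a u) \<noteq> 0" if u: "u \<in> ball 0 1" for u
  proof (rule nonvanishing_of_nonneg_log_coeffs[where F = "\<lambda>u. xi_entire (disc_to_plane a u)", OF _ disc_log_xi_has_fps_expansion[of a] _ _ u])
    show "(\<lambda>u. xi_entire (disc_to_plane a u)) holomorphic_on ball 0 1"
      by (rule holomorphic_on_subset[OF disc_xi_holomorphic]) auto
    obtain S where S: "open S" "0 \<in> S" "S \<subseteq> - {1}" "\<And>u. u \<in> S \<Longrightarrow> xi_entire (disc_to_plane a u) \<notin> \<real>\<^sub>\<le>\<^sub>0"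
      using disc_log_xi_domain by blast
    show "eventually (\<lambda>u. xi_entire (disc_to_plane a u) = exp (disc_log_xi a u)) (nhds 0)"
      using eventually_nhds_in_open[OF S(1,2)] 
    proof eventually_elim
      case (elim u)
      hence "xi_entire (disc_to_plane a u) \<noteq> 0" using S(4)[of u] by auto
      thus ?case by (simp add: disc_log_xi_def)
    qed
    fix n :: nat assume n: "n \<ge> 1"
    have "fps_nth (fps_expansion (disc_log_xi a) 0) n = of_real ((1 - 2 * a) / real n) * li_coeff a n"
      using li_coeff_eq_log_coeff[OF _ n, of a] a n by (simp add: field_simps)
    moreover have "complex_of_real ((1 - 2 * a) / real n) \<in> \<real>\<^sub>\<ge>\<^sub>0"
      unfolding nonneg_Reals_of_real_iff using a by simp
    ultimately show "fps_nth (fps_expansion (disc_log_xi a) 0) n \<in> \<real>\<^sub>\<ge>\<^sub>0"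
      using li n by (metis nonneg_Reals_mult_I)
  qed
  show riemann_hypothesis unfolding riemann_hypothesis_iff_half_plane
    using nz disc_to_plane_surj[OF a] by (metis dist_0_norm mem_ball)
qed

theorem theorem5:
  fixes a :: real
  shows "(a < 1 / 2 \<longrightarrow>
            (riemann_hypothesis \<longleftrightarrow> (\<forall>n\<ge>1. li_coeff a n \<in> \<real>\<^sub>\<ge>\<^sub>0))) \<and>
         (a > 1 / 2 \<longrightarrow>
            (riemann_hypothesis \<longleftrightarrow> (\<forall>n\<ge>1. li_coeff a n \<in> \<real>\<^sub>\<le>\<^sub>0)))"
proof (intro conjI impI)
  assume "a < 1 / 2"
  thus "riemann_hypothesis \<longleftrightarrow> (\<forall>n\<ge>1. li_coeff a n \<in> \<real>\<^sub>\<ge>\<^sub>0)" by (rule li_criterion_below_half)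
next
  assume a: "a > 1 / 2"
  hence "riemann_hypothesis \<longleftrightarrow> (\<forall>n\<ge>1. li_coeff (1 - a) n \<in> \<real>\<^sub>\<ge>\<^sub>0)"
    by (intro li_criterion_below_half) simp
  also have "\<dots> \<longleftrightarrow> (\<forall>n\<ge>1. li_coeff a n \<in> \<real>\<^sub>\<le>\<^sub>0)"
    using li_coeff_reflect[of a] a by (simp add: uminus_nonneg_Reals_iff)
  finally show "riemann_hypothesis \<longleftrightarrow> (\<forall>n\<ge>1. li_coeff a n \<in> \<real>\<^sub>\<le>\<^sub>0)" .
qed

end
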